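(* Let $0<p_0<p_1<1$, $\alpha(n)=\lfloor np_0\rfloor$, $\beta(n)=\lfloor np_1\rfloor$. (i) Let $X_k=\sum_{i=0}^\infty a_i\varepsilon_{k-i}$ be a linear process as in the context. Assume $\sup_x[f_\varepsilon(x)+|f_\varepsilon'(x)|]<\infty$, $\sup_x|f_\varepsilon''(x)|<\infty$, $\inf_{p_0\le p\le p_1}f(\xi_p)>0$, and that there exists $\alpha>0$ such that $\mathbb{E}(|\varepsilon_k|^\alpha)<\infty$ and $\sum_{i=1}^\infty|a_i|^{\min(\alpha/2,1)}<\infty$. Then there is a $\sigma<\infty$ such that $$\sqrt n\left[\frac{\sum_{i=\alpha(n)+1}^{\beta(n)}\xi_{n,i/n}}{\beta(n)-\alpha(n)}-\frac{1}{p_1-p_0}\int_{p_0}^{p_1}\xi_u\,du\right]\Rightarrow N(0,\sigma^2).$$ (ii) Let $X_n=G(\ldots,\varepsilon_{n-1},\varepsilon_n)$ be a stationary process as in the context. Assume that there exist $\alpha>0$, $C>0$ and $0<r<1$ such that for all $n\ge0$ $$\mathbb{E}\bigl[|G(\ldots,\varepsilon_{-1},\varepsilon_0,\varepsilon_1,\ldots,\varepsilon_n)-G(\ldots,\varepsilon_{-1}',\varepsilon_0',\varepsilon_1,\ldots,\varepsilon_n)|^\alpha\bigr]\le Cr^n,$$ and that $\sup_x[f(x)+|f'(x)|]<\infty$ and $\inf_{p_0\le p\le p_1}f(\xi_p)>0$. Then there is a $\sigma<\infty$ such that the same central limit theorem holds: $$\sqrt n\left[\frac{\sum_{i=\alpha(n)+1}^{\beta(n)}\xi_{n,i/n}}{\beta(n)-\alpha(n)}-\frac{1}{p_1-p_0}\int_{p_0}^{p_1}\xi_u\,du\right]\Rightarrow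 N(0,\sigma^2).$$
   Context: $(\varepsilon_k)_{k\in\mathbb{Z}}$ are i.i.d. random variables. In (i), the $\varepsilon_k$ are real with (twice differentiable) density $f_\varepsilon$, and $(a_i)_{i\ge0}$ are real coefficients with $a_0=1$ such that $X_k=\sum_{i=0}^\infty a_i\varepsilon_{k-i}$ exists almost surely. In (ii), $G$ is a measurable function such that $X_n=G(\ldots,\varepsilon_{n-1},\varepsilon_n)$ is a well-defined real random variable, and $(\varepsilon_k')_{k\in\mathbb{Z}}$ is an i.i.d. sequence, independent of $(\varepsilon_k)_{k\in\mathbb{Z}}$, with $\varepsilon'_k$ distributed as $\varepsilon_0$. In both cases $F$ and $f$ are the marginal distribution function and density of the process, $\xi_p=\inf\{x:F(x)\ge p\}$, $F_n(x)=\frac1n\sum_{i=1}^n\mathbf 1_{X_i\le x}$, $\xi_{n,p}=\inf\{x:F_n(x)\ge p\}$, so $\xi_{n,1/n}\le\xi_{n,2/n}\le\cdots\le\xi_{n,1}$ are the order statistics of $X_1,\dots,X_n$. $N(\mu,\sigma^2)$ is the normal distribution with mean $\mu$ and variance $\sigma^2$ ($\sigma=0$ allowed), and $\Rightarrow$ denotes convergence in distribution. *)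

theory Defs
  imports "HOL-Probability.Probability"
begin

definition iid :: "'a measure \<Rightarrow> 'b measure \<Rightarrow> (int \<Rightarrow> 'a \<Rightarrow> 'b) \<Rightarrow> bool" where
  "iid M S \<epsilon> \<longleftrightarrow> prob_space.indep_vars M (\<lambda>_. S) \<epsilon> UNIV \<and>
    (\<forall>k. distr M S (\<epsilon> k) = distr M S (\<epsilon> 0))"

text \<open>On the null set where the series diverges the value is irrelevant; almost sure convergence
  is stated as a separate hypothesis.\<close>

definition linear_process ::
    "(nat \<Rightarrow> real) \<Rightarrow> (int \<Rightarrow> 'a \<Rightarrow> real) \<Rightarrow> int \<Rightarrow> 'a \<Rightarrow> real" where
  "linear_process a \<epsilon> k \<omega> = (\<Sum>i. a i * \<epsilon> (k - int i) \<omega>)"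

text \<open>A left-infinite sequence \<open>(\<dots>, x\<^bsub>n-1\<^esub>, x\<^bsub>n\<^esub>)\<close> is encoded as the function
  mapping the lag \<open>j\<close> to \<open>x\<^bsub>n-j\<^esub>\<close>.\<close>

definition past :: "(int \<Rightarrow> 'a \<Rightarrow> 'b) \<Rightarrow> int \<Rightarrow> 'a \<Rightarrow> nat \<Rightarrow> 'b" where
  "past \<epsilon> n \<omega> = (\<lambda>j. \<epsilon> (n - int j) \<omega>)"

definition causal_process ::
    "((nat \<Rightarrow> 'b) \<Rightarrow> real) \<Rightarrow> (int \<Rightarrow> 'a \<Rightarrow> 'b) \<Rightarrow> int \<Rightarrow> 'a \<Rightarrow> real" where
  "causal_process G \<epsilon> n \<omega> = G (past \<epsilon> n \<omega>)"

definition coupled ::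
    "(int \<Rightarrow> 'a \<Rightarrow> 'b) \<Rightarrow> (int \<Rightarrow> 'a \<Rightarrow> 'b) \<Rightarrow> int \<Rightarrow> 'a \<Rightarrow> 'b" where
  "coupled \<epsilon> \<epsilon>' k = (if k \<le> 0 then \<epsilon>' k else \<epsilon> k)"

definition quantile :: "(real \<Rightarrow> real) \<Rightarrow> real \<Rightarrow> real" where
  "quantile F p = Inf {x. p \<le> F x}"

definition empirical_cdf :: "(int \<Rightarrow> 'a \<Rightarrow> real) \<Rightarrow> nat \<Rightarrow> 'a \<Rightarrow> real \<Rightarrow> real" where
  "empirical_cdf X n \<omega> x = (1 / real n) * (\<Sum>i=1..n. indicator {..x} (X (int i) \<omega>))"

definition marginal_cdf :: "'a measure \<Rightarrow> (int \<Rightarrow> 'a \<Rightarrow> real) \<Rightarrow> real \<Rightarrow> real" where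
  "marginal_cdf M X = cdf (distr M borel (X 0))"

definition trim_index :: "real \<Rightarrow> nat \<Rightarrow> nat" where
  "trim_index p n = nat \<lfloor>real n * p\<rfloor>"

definition trimmed_mean ::
    "real \<Rightarrow> real \<Rightarrow> (int \<Rightarrow> 'a \<Rightarrow> real) \<Rightarrow> nat \<Rightarrow> 'a \<Rightarrow> real" where
  "trimmed_mean p\<^sub>0 p\<^sub>1 X n \<omega> =
    (\<Sum>i = trim_index p\<^sub>0 n + 1..trim_index p\<^sub>1 n.
       quantile (empirical_cdf X n \<omega>) (real i / real n)) /
    (real (trim_index p\<^sub>1 n) - real (trim_index p\<^sub>0 n))"

definition normal_distribution :: "real \<Rightarrow> real \<Rightarrow> real measure" where
  "normal_distribution \<mu> \<sigma> =
    (if \<sigma> = 0 then return borel \<mu> else density lborel (normal_density \<mu> \<sigma>))"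

definition trimmed_mean_clt ::
    "real \<Rightarrow> real \<Rightarrow> 'a measure \<Rightarrow> (int \<Rightarrow> 'a \<Rightarrow> real) \<Rightarrow> real \<Rightarrow> bool" where
  "trimmed_mean_clt p\<^sub>0 p\<^sub>1 M X \<sigma> \<longleftrightarrow>
    weak_conv_m
      (\<lambda>n. distr M borel (\<lambda>\<omega>. sqrt (real n) *
        (trimmed_mean p\<^sub>0 p\<^sub>1 X n \<omega>
          - 1 / (p\<^sub>1 - p\<^sub>0) * integral {p\<^sub>0..p\<^sub>1} (quantile (marginal_cdf M X)))))
      (normal_distribution 0 \<sigma>)"

end

theory Submission
  imports Defs
begin

text \<open>Write \<open>u = m/n\<close>. The sum of the \<open>m\<close> smallest observations is
  \<open>max\<^sub>t (m t - \<Sum>\<^sub>k (t - X\<^sub>k)\<^sup>+)\<close>. Evaluating this concave function of \<open>t\<close> at the population quantile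
  \<open>z = \<xi>\<^sub>u\<close> instead of at its maximum costs \<open>o(\<surd>n)\<close> in probability: its values at
  \<open>z \<plusminus> \<eta> n\<^sup>-\<^sup>1\<^sup>/\<^sup>4\<close> are slightly negative with high probability, and by concavity they bound the
  maximum. Hence the trimmed sum is, up to \<open>o(\<surd>n)\<close>, an affine function of the sum of the
  bounded Lipschitz observables \<open>max \<xi>\<^bsub>p0\<^esub> (min \<xi>\<^bsub>p1\<^esub> X\<^sub>k)\<close>, and only a central limit theorem for such
  observables is needed; no Bahadur representation and no control of indicator functions enter.

  That theorem holds as soon as the effect of replacing the innovation of lag \<open>i\<close> by an
  independent copy is summable over \<open>i\<close> in \<open>L\<^sup>2\<close>. By the Efron--Stein inequality the variance of a
  sum of \<open>n\<close> observables is then \<open>O(n)\<close>, and averaging the terms of each block of length \<open>l\<close>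
  over the innovations outside the block changes the normalised sum by an amount that vanishes
  in \<open>L\<^sup>2\<close> as \<open>l \<rightarrow> \<infinity>\<close>, while it makes the block sums i.i.d. For a linear process the effect at
  lag \<open>i\<close> is at most a multiple of \<open>\<bar>a\<^sub>i\<bar>\<^bsup>min(\<alpha>/2,1)\<^esup>\<close>, under moment contraction it decays
  geometrically.\<close>

text \<open>The scale n^(-1/4) balances two effects. At distance d from the quantile the concave
  function has dropped by order n d^2, while its increment fluctuates with variance at most a
  constant times n times \<open>\<Sum>i. min (c i) d\<close>. With d = \<eta> n^(-1/4) the drop is
  of order \<eta>^2 sqrt n and the fluctuation is o(sqrt n), merely because that series tends to 0
  with d; a small \<eta> then makes the cost as small a multiple of sqrt n as desired. Low moments
  are the obstacle: \<alpha> may be less than 1, so differences of the process need not be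
  integrable. Every comparison therefore uses the truncated distance min 1 |x - y|, for which
  bounded Lipschitz observables are still Lipschitz. The root of E (min 1 |a_i (e - e')|)^2 is of
  order |a_i|^(min(\<alpha>, 2) / 2), the origin of the exponent in the linear case. The limiting
  variance comes by compactness from block variances, not from a series of covariances.
  \<open>mix\<close> covers both replacements in use: \<open>-{j}\<close> refreshes one innovation,
  \<open>{j<..}\<close> the whole past up to time j.\<close>

definition mix :: "'i set \<Rightarrow> ('i \<Rightarrow> 'c) \<Rightarrow> ('i \<Rightarrow> 'c) \<Rightarrow> 'i \<Rightarrow> 'c" where
  "mix A \<omega> \<omega>' = (\<lambda>k. if k \<in> A then \<omega> k else \<omega>' k)"

lemma mix_apply: "mix A \<omega> \<omega>' k = (if k \<in> A then \<omega> k else \<omega>' k)"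
  by (simp add: mix_def)

lemma mix_UNIV [simp]: "mix UNIV \<omega> \<omega>' = \<omega>" and mix_empty [simp]: "mix {} \<omega> \<omega>' = \<omega>'"
  by (simp_all add: mix_def)

section \<open>The canonical sequence space and the exchange of two independent copies\<close>

locale iid_sequence = D: prob_space D for D :: "'c measure"
begin

text \<open>On the canonical space, shifts and replacements of innovations are maps whose image laws
  can be computed. The conclusion speaks of distributions only, so it can be carried to the given
  process at the end.\<close>

definition P :: "(int \<Rightarrow> 'c) measure" where "P = PiM UNIV (\<lambda>_. D)"

abbreviation PP :: "((int \<Rightarrow> 'c) \<times> (int \<Rightarrow> 'c)) measure" where "PP \<equiv> P \<Otimes>\<^sub>M P"

lemma prob_space_P: "prob_space P"
  unfolding P_def by (intro prob_space_PiM D.prob_space_axioms)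

end

sublocale iid_sequence \<subseteq> P: prob_space P
  by (rule prob_space_P)

sublocale iid_sequence \<subseteq> PP: pair_prob_space P P
  by unfold_locales

context iid_sequence
begin

lemma space_P: "space P = {\<omega>. \<forall>k. \<omega> k \<in> space D}"
  by (auto simp: P_def space_PiM)

lemma measurable_coordinate [measurable]: "(\<lambda>\<omega>. \<omega> k) \<in> P \<rightarrow>\<^sub>M D"
  by (simp add: P_def)

lemma measurable_into_P:
  assumes "\<And>k. (\<lambda>x. f x k) \<in> N \<rightarrow>\<^sub>M D"
  shows "f \<in> N \<rightarrow>\<^sub>M P"
  unfolding P_def
  by (rule measurable_PiM_single') (use assms[THEN measurable_space] in \<open>auto simp: assms\<close>)

lemma measurable_mix_P [measurable (raw)]:
  assumes [measurable]: "f \<in> N \<rightarrow>\<^sub>M P" "g \<in> N \<rightarrow>\<^sub>M P"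
  shows "(\<lambda>x. mix A (f x) (g x)) \<in> N \<rightarrow>\<^sub>M P"
proof (rule measurable_into_P)
  show "(\<lambda>x. mix A (f x) (g x) k) \<in> N \<rightarrow>\<^sub>M D" for k
    by (cases "k \<in> A") (simp_all add: mix_apply)
qed

definition shift :: "int \<Rightarrow> (int \<Rightarrow> 'c) \<Rightarrow> int \<Rightarrow> 'c" where
  "shift s \<omega> = (\<lambda>k. \<omega> (k + s))"

lemma measurable_shift [measurable]: "shift s \<in> P \<rightarrow>\<^sub>M P"
  by (rule measurable_into_P) (simp add: shift_def)

lemma distr_shift: "distr P P (shift s) = P"
  using distr_PiM_reindex[of UNIV "\<lambda>_. D" "\<lambda>k::int. k + s" UNIV] D.prob_space_axioms
  by (simp add: P_def shift_def[abs_def] inj_def restrict_def)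

text \<open>A pair of sequences is one sequence indexed by \<open>bool \<times> int\<close>, so that exchanging the
  entries outside \<open>A\<close> becomes a permutation of the index set.\<close>

definition join :: "(int \<Rightarrow> 'c) \<times> (int \<Rightarrow> 'c) \<Rightarrow> bool \<times> int \<Rightarrow> 'c" where
  "join z = (\<lambda>(b, k). if b then fst z k else snd z k)"

lemma measurable_join: "join \<in> PP \<rightarrow>\<^sub>M PiM UNIV (\<lambda>_. D)"
proof (rule measurable_PiM_single')
  show "(\<lambda>z. join z i) \<in> PP \<rightarrow>\<^sub>M D" for i
    by (cases i; cases "fst i") (simp_all add: join_def)
qed (auto simp: join_def space_pair_measure space_P)

text \<open>Measures on an infinite product agree once they agree on cylinders. A cylinder over
  \<open>J\<close> pulls back to a rectangle of two cylinders, one for each Boolean label, and the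
  product of the factor probabilities splits along the same partition of \<open>J\<close>.\<close>

lemma distr_join: "distr PP (PiM UNIV (\<lambda>_. D)) join = PiM UNIV (\<lambda>_. D)"
proof (rule measure_eqI_PiM_infinite[symmetric, OF refl])
  interpret J: prob_space "PiM (UNIV :: (bool \<times> int) set) (\<lambda>_. D)"
    by (intro prob_space_PiM D.prob_space_axioms)
  show "finite_measure (PiM (UNIV :: (bool \<times> int) set) (\<lambda>_. D))" by unfold_locales
  fix A :: "bool \<times> int \<Rightarrow> 'c set" and J :: "(bool \<times> int) set"
  assume J: "finite J" and A: "\<And>i. i \<in> J \<Longrightarrow> A i \<in> sets D"
  define J1 where "J1 = Pair True -` J"
  define J0 where "J0 = Pair False -` J"
  have J_eq: "J = Pair True ` J1 \<union> Pair False ` J0"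
    proof (rule set_eqI)
    show "i \<in> J \<longleftrightarrow> i \<in> Pair True ` J1 \<union> Pair False ` J0" for i
      by (cases i; cases "fst i") (auto simp: J1_def J0_def image_iff)
  qed
  have fin: "finite J1" "finite J0"
    unfolding J1_def J0_def by (rule finite_vimageI[OF J], rule injI, simp)+
  let ?E = "prod_emb UNIV (\<lambda>_. D) J (Pi\<^sub>E J A)"
  let ?EL = "prod_emb UNIV (\<lambda>_. D) J1 (Pi\<^sub>E J1 (\<lambda>k. A (True, k)))"
  let ?ER = "prod_emb UNIV (\<lambda>_. D) J0 (Pi\<^sub>E J0 (\<lambda>k. A (False, k)))"
  have m: "?EL \<in> sets P" "?ER \<in> sets P"
    unfolding P_def using fin by (auto intro!: sets_PiM_I simp: A J1_def J0_def)
  have "emeasure (distr PP (PiM UNIV (\<lambda>_. D)) join) ?E = emeasure PP (join -` ?E \<inter> space PP)"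
    by (rule emeasure_distr[OF measurable_join]) (auto intro!: sets_PiM_I simp: J A)
  also have "join -` ?E \<inter> space PP = ?EL \<times> ?ER"
  proof (rule set_eqI)
    fix z :: "(int \<Rightarrow> 'c) \<times> (int \<Rightarrow> 'c)"
    have "(\<forall>i\<in>J. join z i \<in> A i) \<longleftrightarrow>
        (\<forall>k\<in>J1. fst z k \<in> A (True, k)) \<and> (\<forall>k\<in>J0. snd z k \<in> A (False, k))"
      by (subst J_eq) (auto simp: join_def ball_Un)
    moreover have "(\<forall>i. join z i \<in> space D) \<longleftrightarrow> z \<in> space PP"
      by (simp add: join_def space_pair_measure space_P mem_Times_iff all_bool_eq)
    moreover have "z \<in> join -` ?E \<longleftrightarrow> (\<forall>i. join z i \<in> space D) \<and> (\<forall>i\<in>J. join z i \<in> A i)"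
      by (simp add: prod_emb_iff PiE_iff conj_ac)
    moreover have "z \<in> ?EL \<times> ?ER \<longleftrightarrow> z \<in> space PP \<and>
        (\<forall>k\<in>J1. fst z k \<in> A (True, k)) \<and> (\<forall>k\<in>J0. snd z k \<in> A (False, k))"
      by (simp add: prod_emb_iff PiE_iff space_pair_measure space_P mem_Times_iff conj_ac)
    ultimately show "z \<in> join -` ?E \<inter> space PP \<longleftrightarrow> z \<in> ?EL \<times> ?ER"
      by blast
  qed
  also have "emeasure PP (?EL \<times> ?ER) = emeasure P ?EL * emeasure P ?ER"
    by (rule P.emeasure_pair_measure_Times[OF m])
  also have "\<dots> = (\<Prod>k\<in>J1. emeasure D (A (True, k))) * (\<Prod>k\<in>J0. emeasure D (A (False, k)))"
    unfolding P_def using fin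
    by (subst (1 2) emeasure_PiM_emb) (auto simp: A J1_def J0_def D.prob_space_axioms)
  also have "\<dots> = (\<Prod>i\<in>J. emeasure D (A i))"
    unfolding J_eq using fin
    by (subst prod.union_disjoint) (auto simp: prod.reindex inj_on_def)
  also have "\<dots> = emeasure (PiM UNIV (\<lambda>_. D)) ?E"
    by (rule emeasure_PiM_emb[symmetric]) (auto simp: J A D.prob_space_axioms)
  finally show "emeasure (PiM UNIV (\<lambda>_. D)) ?E = emeasure (distr PP (PiM UNIV (\<lambda>_. D)) join) ?E" ..
qed simp

definition exchange :: "int set \<Rightarrow> (int \<Rightarrow> 'c) \<times> (int \<Rightarrow> 'c) \<Rightarrow> (int \<Rightarrow> 'c) \<times> (int \<Rightarrow> 'c)" where
  "exchange A z = (mix A (fst z) (snd z), mix A (snd z) (fst z))"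

lemma measurable_exchange [measurable]: "exchange A \<in> PP \<rightarrow>\<^sub>M PP"
  unfolding exchange_def[abs_def] by measurable

lemma distr_exchange: "distr PP PP (exchange A) = PP"
proof -
  let ?J = "PiM (UNIV :: (bool \<times> int) set) (\<lambda>_. D)"
  define split where "split = (\<lambda>W :: bool \<times> int \<Rightarrow> 'c. ((\<lambda>k. W (True, k)), (\<lambda>k. W (False, k))))"
  \<comment> \<open>Indices outside \<open>A\<close> have their Boolean label flipped. Reindexing a
    product of identical factors by an injective map preserves the measure.\<close>
  define \<pi> where "\<pi> = (\<lambda>(b, k). (if k \<in> A then b else \<not> b, k))"
  have [measurable]: "split \<in> ?J \<rightarrow>\<^sub>M PP" "join \<in> PP \<rightarrow>\<^sub>M ?J"
    unfolding split_def by (intro measurable_Pair measurable_into_P; simp) (rule measurable_join)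
  have [measurable]: "(\<lambda>W. W \<circ> \<pi>) \<in> ?J \<rightarrow>\<^sub>M ?J"
    by (rule measurable_PiM_single') (auto simp: space_PiM)
  have "inj \<pi>"
    by (auto simp: \<pi>_def inj_def split: if_splits)
  then have \<pi>: "distr ?J ?J (\<lambda>W. W \<circ> \<pi>) = ?J"
    using distr_PiM_reindex[of UNIV "\<lambda>_. D" \<pi> UNIV] D.prob_space_axioms
    by (simp add: comp_def restrict_def)
  have id: "split (join z) = z" for z
    by (simp add: split_def join_def)
  have ex: "exchange A z = split (join z \<circ> \<pi>)" for z
    by (auto simp: split_def join_def \<pi>_def exchange_def mix_def)
  have "distr PP PP (exchange A) = distr (distr (distr PP ?J join) ?J (\<lambda>W. W \<circ> \<pi>)) PP split"
    by (simp add: distr_distr comp_def[of "split"] comp_def[of "(\<lambda>W. W \<circ> \<pi>)"] ex[abs_def] o_assoc)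
  also have "\<dots> = distr (distr PP ?J join) PP split"
    by (simp only: distr_join \<pi>)
  also have "\<dots> = distr PP PP (\<lambda>z. z)"
    by (simp add: distr_distr comp_def id)
  finally show ?thesis by (simp add: distr_id[unfolded id_def])
qed

lemma distr_mix: "distr PP P (\<lambda>z. mix A (fst z) (snd z)) = P"
proof -
  have "distr PP P (\<lambda>z. mix A (fst z) (snd z)) = distr (distr PP PP (exchange A)) P fst"
    by (simp add: distr_distr comp_def exchange_def)
  also have "\<dots> = P"
    unfolding distr_exchange by (rule P.distr_pair_fst)
  finally show ?thesis .
qed

end

lemma sum_int_telescope:
  fixes f :: "int \<Rightarrow> real"
  assumes "a \<le> b"
  shows "(\<Sum>j\<in>{a<..b}. f j - f (j - 1)) = f b - f a"
  using assms
proof (induction b rule: int_ge_induct)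
  case (step b)
  then have "{a<..b + 1} = insert (b + 1) {a<..b}" by auto
  with step show ?case by simp
qed simp

subsection \<open>The Efron--Stein inequality\<close>

context iid_sequence
begin

lemma integrable_bounded_P:
  "g \<in> borel_measurable P \<Longrightarrow> (\<And>\<omega>. \<bar>g \<omega>\<bar> \<le> (K::real)) \<Longrightarrow> integrable P g"
  by (rule P.integrable_const_bound[where B = K]) auto

lemma integrable_bounded_PP:
  "g \<in> borel_measurable PP \<Longrightarrow> (\<And>z. \<bar>g z\<bar> \<le> (K::real)) \<Longrightarrow> integrable PP g"
  by (rule PP.integrable_const_bound[where B = K]) auto

lemma integrable_bounded_square_P:
  assumes "g \<in> borel_measurable P" "\<And>\<omega>. \<bar>g \<omega>\<bar> \<le> (K::real)"
  shows "integrable P (\<lambda>\<omega>. (g \<omega>)\<^sup>2)"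
proof (rule integrable_bounded_P)
  show "\<bar>(g \<omega>)\<^sup>2\<bar> \<le> K\<^sup>2" for \<omega>
    using power_mono[OF assms(2)[of \<omega>], of 2] by simp
qed (use assms(1) in simp)

lemma integrable_bounded_square_PP:
  assumes "g \<in> borel_measurable PP" "\<And>z. \<bar>g z\<bar> \<le> (K::real)"
  shows "integrable PP (\<lambda>z. (g z)\<^sup>2)"
proof (rule integrable_bounded_PP)
  show "\<bar>(g z)\<^sup>2\<bar> \<le> K\<^sup>2" for z
    using power_mono[OF assms(2)[of z], of 2] by simp
qed (use assms(1) in simp)

lemma integral_exchange:
  "f \<in> borel_measurable PP \<Longrightarrow> (\<integral>z. f (exchange A z) \<partial>PP) = (\<integral>z. (f z::real) \<partial>PP)"
  using integral_distr[of "exchange A" PP PP f] by (simp add: distr_exchange)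

lemma integral_mix:
  "f \<in> borel_measurable P \<Longrightarrow> (\<integral>z. f (mix A (fst z) (snd z)) \<partial>PP) = (\<integral>\<omega>. (f \<omega>::real) \<partial>P)"
  using integral_distr[of "\<lambda>z. mix A (fst z) (snd z)" PP P f] by (simp add: distr_mix)

lemma integral_shift:
  "f \<in> borel_measurable P \<Longrightarrow> (\<integral>\<omega>. f (shift s \<omega>) \<partial>P) = (\<integral>\<omega>. (f \<omega>::real) \<partial>P)"
  using integral_distr[of "shift s" P P f] by (simp add: distr_shift)

lemma integral_fst_PP:
  "f \<in> borel_measurable P \<Longrightarrow> (\<integral>z. f (fst z) \<partial>PP) = (\<integral>\<omega>. (f \<omega>::real) \<partial>P)"
  using integral_mix[of f UNIV] by simp

lemma integral_snd_PP:
  "f \<in> borel_measurable P \<Longrightarrow> (\<integral>z. f (snd z) \<partial>PP) = (\<integral>\<omega>. (f \<omega>::real) \<partial>P)"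
  using integral_mix[of f "{}"] by simp

text \<open>The Efron-Stein quantity of coordinate \<open>j\<close>: half the sum of these over all
  \<open>j\<close> dominates the variance. Bounds for it are stated as squares because the triangle
  inequality is applied to its root.\<close>

definition influence :: "int \<Rightarrow> ((int \<Rightarrow> 'c) \<Rightarrow> real) \<Rightarrow> real" where
  "influence j g = (\<integral>z. (g (fst z) - g (mix (-{j}) (fst z) (snd z)))\<^sup>2 \<partial>PP)"

lemma influence_nonneg: "0 \<le> influence j g"
  by (simp add: influence_def)

text \<open>Exchanging the entry \<open>j\<close> of the two copies turns the increment of \<open>g\<close> into its negative,
  which replaces \<open>g \<omega>\<close> by half of its own increment.\<close>

lemma integral_increment_le_influence:
  assumes [measurable]: "g \<in> borel_measurable P" and K: "\<And>\<omega>. \<bar>g \<omega>\<bar> \<le> K"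
  shows "(\<integral>z. g (fst z) * (g (mix {..j} (fst z) (snd z)) - g (mix {..j - 1} (fst z) (snd z))) \<partial>PP)
    \<le> influence j g / 2"
proof -
  define inc where "inc z = g (mix {..j} (fst z) (snd z)) - g (mix {..j - 1} (fst z) (snd z))" for z
  define d where "d z = g (fst z) - g (mix (-{j}) (fst z) (snd z))" for z
  have [measurable]: "inc \<in> borel_measurable PP" "d \<in> borel_measurable PP"
    unfolding inc_def d_def by measurable
  have K0: "0 \<le> K" using K[of undefined] by simp
  have binc: "\<bar>inc z\<bar> \<le> 2 * K" and bd: "\<bar>d z\<bar> \<le> 2 * K" for z
    unfolding inc_def d_def
    using K[of "mix {..j} (fst z) (snd z)"] K[of "mix {..j - 1} (fst z) (snd z)"]
      K[of "fst z"] K[of "mix (-{j}) (fst z) (snd z)"] by linarith+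
  have ex: "exchange (-{j}) z = (mix (-{j}) (fst z) (snd z), mix (-{j}) (snd z) (fst z))" for z
    by (simp add: exchange_def)
  have swap: "inc (exchange (-{j}) z) = - inc z" for z
  proof -
    have "mix {..j} (mix (-{j}) (fst z) (snd z)) (mix (-{j}) (snd z) (fst z)) = mix {..j-1} (fst z) (snd z)"
      "mix {..j-1} (mix (-{j}) (fst z) (snd z)) (mix (-{j}) (snd z) (fst z)) = mix {..j} (fst z) (snd z)"
      by (auto simp: mix_def)
    then show ?thesis by (simp add: inc_def ex)
  qed
  have i1: "integrable PP (\<lambda>z. g (fst z) * inc z)"
    using binc K K0 by (intro integrable_bounded_PP[where K = "K * (2 * K)"])
      (auto simp: abs_mult intro!: mult_mono)
  have i2: "integrable PP (\<lambda>z. g (mix (-{j}) (fst z) (snd z)) * inc z)"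
    using binc K K0 by (intro integrable_bounded_PP[where K = "K * (2 * K)"])
      (auto simp: abs_mult intro!: mult_mono)
  have isq: "integrable PP (\<lambda>z. (inc z)\<^sup>2)" "integrable PP (\<lambda>z. (d z)\<^sup>2)"
    using binc bd by (auto intro!: integrable_bounded_square_PP[where K = "2 * K"])
  have "(\<integral>z. g (fst z) * inc z \<partial>PP) = (\<integral>z. g (fst (exchange (-{j}) z)) * inc (exchange (-{j}) z) \<partial>PP)"
    by (rule integral_exchange[symmetric]) measurable
  also have "\<dots> = - (\<integral>z. g (mix (-{j}) (fst z) (snd z)) * inc z \<partial>PP)"
    unfolding swap by (simp add: ex)
  finally have "2 * (\<integral>z. g (fst z) * inc z \<partial>PP)
      = (\<integral>z. g (fst z) * inc z \<partial>PP) - (\<integral>z. g (mix (-{j}) (fst z) (snd z)) * inc z \<partial>PP)"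
    by simp
  also have "\<dots> = (\<integral>z. d z * inc z \<partial>PP)"
    by (subst Bochner_Integration.integral_diff[OF i1 i2, symmetric]) (simp add: d_def algebra_simps)
  also have "\<dots> \<le> (\<integral>z. ((d z)\<^sup>2 + (inc z)\<^sup>2) / 2 \<partial>PP)"
  proof (rule integral_mono)
    show "integrable PP (\<lambda>z. d z * inc z)"
    proof (rule integrable_bounded_PP)
      show "\<bar>d z * inc z\<bar> \<le> 2 * K * (2 * K)" for z
        unfolding abs_mult using K0 by (intro mult_mono binc bd) simp_all
    qed measurable
    show "d z * inc z \<le> ((d z)\<^sup>2 + (inc z)\<^sup>2) / 2" for z
      using sum_squares_bound[of "d z" "inc z"] by simp
  qed (use isq in auto)
  also have "\<dots> = (influence j g + (\<integral>z. (inc z)\<^sup>2 \<partial>PP)) / 2"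
    using isq by (simp add: influence_def d_def)
  \<comment> \<open>Exchanging the copies above \<open>j\<close> maps a pair differing at
    \<open>j\<close> alone to the two consecutive hybrids, so \<open>inc\<close> has the law of
    \<open>d\<close>.\<close>
  also have "(\<integral>z. (inc z)\<^sup>2 \<partial>PP) = influence j g"
  proof -
    have "inc z = d (exchange {..j} z)" for z
    proof -
      have "mix (-{j}) (mix {..j} (fst z) (snd z)) (mix {..j} (snd z) (fst z)) = mix {..j-1} (fst z) (snd z)"
        by (auto simp: mix_def)
      then show ?thesis by (simp add: inc_def d_def exchange_def)
    qed
    then have "(\<integral>z. (inc z)\<^sup>2 \<partial>PP) = (\<integral>z. (d (exchange {..j} z))\<^sup>2 \<partial>PP)"
      by simp
    also have "\<dots> = (\<integral>z. (d z)\<^sup>2 \<partial>PP)"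
      by (rule integral_exchange) measurable
    finally show ?thesis by (simp add: influence_def d_def)
  qed
  finally show ?thesis by (simp add: inc_def)
qed

text \<open>The variance is E g(x) (g(x) - g(y)) for independent copies x, y. The difference
  telescopes over the hybrids \<open>mix {..j}\<close>, which follow x up to time j and y
  afterwards, and each step costs half an influence. Only finitely many steps can be taken, so what
  is left at -J is controlled by \<open>lim\<close> and vanishes as J grows.\<close>

lemma efron_stein:
  assumes gm [measurable]: "g \<in> borel_measurable P" and K: "\<And>\<omega>. \<bar>g \<omega>\<bar> \<le> K"
    and dep: "\<And>\<omega> \<omega>'. (\<And>k. k \<le> N \<Longrightarrow> \<omega> k = \<omega>' k) \<Longrightarrow> g \<omega> = g \<omega>'"
    and lim: "(\<lambda>J::nat. \<integral>z. \<bar>g (snd z) - g (mix {..- int J} (fst z) (snd z))\<bar> \<partial>PP) \<longlonglongrightarrow> 0"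
    and V: "\<And>J::nat. (\<Sum>j\<in>{- int J<..N}. influence j g) \<le> V"
  shows "P.variance g \<le> V / 2"
proof -
  have K0: "0 \<le> K" using K[of undefined] by simp
  define R where "R J = (\<integral>z. \<bar>g (snd z) - g (mix {..- int J} (fst z) (snd z))\<bar> \<partial>PP)" for J :: nat
  have ig: "integrable P g" "integrable P (\<lambda>\<omega>. (g \<omega>)\<^sup>2)"
    using K by (auto intro!: integrable_bounded_P[where K = K] integrable_bounded_square_P[where K = K])
  have bdd: "integrable PP (\<lambda>z. g (fst z) * h z)"
    if [measurable]: "h \<in> borel_measurable PP" and h: "\<And>z. \<bar>h z\<bar> \<le> 2 * K" for h
    using h K K0 by (intro integrable_bounded_PP[where K = "K * (2 * K)"])
      (auto simp: abs_mult intro!: mult_mono)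
  have tri: "\<bar>g x - g y\<bar> \<le> 2 * K" for x y
    using K[of x] K[of y] by linarith
  have var: "P.variance g = (\<integral>z. g (fst z) * (g (fst z) - g (snd z)) \<partial>PP)"
  proof -
    have i: "integrable PP (\<lambda>z. g (fst z) * g (snd z))"
      using K K0 by (intro bdd) (auto intro: order_trans[OF K])
    have "(\<integral>z. g (fst z) * g (snd z) \<partial>PP) = (\<integral>x. \<integral>y. g x * g y \<partial>P \<partial>P)"
      by (rule PP.integral_fst[of "\<lambda>x y. g x * g y", unfolded split_beta', OF i, symmetric])
    also have "\<dots> = (P.expectation g)\<^sup>2"
      by (simp add: power2_eq_square)
    finally have 1: "(\<integral>z. g (fst z) * g (snd z) \<partial>PP) = (P.expectation g)\<^sup>2" .
    have i2: "integrable PP (\<lambda>z. g (fst z) * g (fst z))"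
      using K K0 by (intro bdd) (auto intro: order_trans[OF K])
    have "(\<integral>z. g (fst z) * (g (fst z) - g (snd z)) \<partial>PP)
        = (\<integral>z. g (fst z) * g (fst z) \<partial>PP) - (\<integral>z. g (fst z) * g (snd z) \<partial>PP)"
      by (subst Bochner_Integration.integral_diff[OF i2 i, symmetric]) (simp add: algebra_simps)
    also have "(\<integral>z. g (fst z) * g (fst z) \<partial>PP) = (\<integral>\<omega>. (g \<omega>)\<^sup>2 \<partial>P)"
      using integral_fst_PP[of "\<lambda>\<omega>. (g \<omega>)\<^sup>2"] by (simp add: power2_eq_square)
    finally show ?thesis
      using ig by (simp add: P.variance_eq 1)
  qed
  have "P.variance g \<le> V / 2 + K * R J" if J: "- int J \<le> N" for J :: nat
  proof -
    have m: "g (mix {..N} \<omega> \<omega>') = g \<omega>" for \<omega> \<omega>'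
      by (rule dep) (simp add: mix_apply)
    have i1: "integrable PP (\<lambda>z. g (fst z) * (g (fst z) - g (mix {..- int J} (fst z) (snd z))))"
      by (intro bdd tri) measurable
    have i2: "integrable PP (\<lambda>z. g (fst z) * (g (mix {..- int J} (fst z) (snd z)) - g (snd z)))"
      by (intro bdd tri) measurable
    have i3: "integrable PP (\<lambda>z. g (snd z) - g (mix {..- int J} (fst z) (snd z)))"
      using tri by (intro integrable_bounded_PP[where K = "2 * K"]) auto
    have split: "P.variance g = (\<integral>z. g (fst z) * (g (fst z) - g (mix {..- int J} (fst z) (snd z))) \<partial>PP)
        + (\<integral>z. g (fst z) * (g (mix {..- int J} (fst z) (snd z)) - g (snd z)) \<partial>PP)"
      unfolding var by (subst Bochner_Integration.integral_add[OF i1 i2, symmetric]) (simp add: algebra_simps)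
    have "(\<integral>z. g (fst z) * (g (fst z) - g (mix {..- int J} (fst z) (snd z))) \<partial>PP)
      = (\<integral>z. (\<Sum>j\<in>{- int J<..N}. g (fst z) *
          (g (mix {..j} (fst z) (snd z)) - g (mix {..j - 1} (fst z) (snd z)))) \<partial>PP)"
      using sum_int_telescope[OF J, of "\<lambda>j. g (mix {..j} (fst z) (snd z))" for z]
      by (simp add: sum_distrib_left[symmetric] m)
    also have "\<dots> = (\<Sum>j\<in>{- int J<..N}. \<integral>z. g (fst z) *
          (g (mix {..j} (fst z) (snd z)) - g (mix {..j - 1} (fst z) (snd z))) \<partial>PP)"
      by (intro Bochner_Integration.integral_sum bdd tri) measurable
    also have "\<dots> \<le> (\<Sum>j\<in>{- int J<..N}. influence j g / 2)"
      by (intro sum_mono integral_increment_le_influence[OF gm K])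
    also have "\<dots> \<le> V / 2"
      using V[of J] by (simp add: sum_divide_distrib[symmetric])
    finally have "(\<integral>z. g (fst z) * (g (fst z) - g (mix {..- int J} (fst z) (snd z))) \<partial>PP) \<le> V / 2" .
    moreover have "(\<integral>z. g (fst z) * (g (mix {..- int J} (fst z) (snd z)) - g (snd z)) \<partial>PP)
      \<le> (\<integral>z. K * \<bar>g (snd z) - g (mix {..- int J} (fst z) (snd z))\<bar> \<partial>PP)"
    proof (rule integral_mono[OF i2])
      show "g (fst z) * (g (mix {..- int J} (fst z) (snd z)) - g (snd z))
        \<le> K * \<bar>g (snd z) - g (mix {..- int J} (fst z) (snd z))\<bar>" for z
      proof -
        have "g (fst z) * y \<le> K * \<bar>y\<bar>" for y
          using abs_le_D1[OF order_refl, of "g (fst z) * y"] mult_right_mono[OF K[of "fst z"], of "\<bar>y\<bar>"]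
          by (simp add: abs_mult)
        from this[of "g (mix {..- int J} (fst z) (snd z)) - g (snd z)"] show ?thesis
          by (simp only: abs_minus_commute)
      qed
    qed (use i3 in auto)
    ultimately show ?thesis unfolding split by (simp add: R_def)
  qed
  moreover have "(\<lambda>J. V / 2 + K * R J) \<longlonglongrightarrow> V / 2 + K * 0"
    unfolding R_def by (intro tendsto_intros lim)
  ultimately show ?thesis
    by (intro LIMSEQ_le_const[where X = "\<lambda>J. V / 2 + K * R J" and x = "V / 2" and a = "P.variance g"])
       (auto intro!: exI[of _ "nat (- N)"])
qed

end

section \<open>The triangle inequality in L2\<close>

text \<open>Young's inequality with weights in the ratio of the two norms gives the exact constant.
  A norm may vanish, so both bounds are first raised by \<open>e > 0\<close>, and \<open>e\<close>
  is then sent to 0.\<close>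

lemma L2_triangle:
  fixes f g :: "'a \<Rightarrow> real"
  assumes [measurable]: "f \<in> borel_measurable M" "g \<in> borel_measurable M"
    and f: "integrable M (\<lambda>x. (f x)\<^sup>2)" "(\<integral>x. (f x)\<^sup>2 \<partial>M) \<le> a\<^sup>2" "0 \<le> a"
    and g: "integrable M (\<lambda>x. (g x)\<^sup>2)" "(\<integral>x. (g x)\<^sup>2 \<partial>M) \<le> b\<^sup>2" "0 \<le> b"
  shows "integrable M (\<lambda>x. (f x + g x)\<^sup>2)" "(\<integral>x. (f x + g x)\<^sup>2 \<partial>M) \<le> (a + b)\<^sup>2"
proof -
  have young: "(u + v)\<^sup>2 \<le> (1 + y / x) * u\<^sup>2 + (1 + x / y) * v\<^sup>2" if "x > 0" "y > 0" for u v x y :: real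
  proof -
    have "(1 + y / x) * u\<^sup>2 + (1 + x / y) * v\<^sup>2 - (u + v)\<^sup>2 = (y * u - x * v)\<^sup>2 / (x * y)"
      using that by (simp add: field_simps power2_eq_square)
    also have "\<dots> \<ge> 0" using that by simp
    finally show ?thesis by simp
  qed
  show i: "integrable M (\<lambda>x. (f x + g x)\<^sup>2)"
  proof (rule Bochner_Integration.integrable_bound)
    show "integrable M (\<lambda>x. 2 * (f x)\<^sup>2 + 2 * (g x)\<^sup>2)" using f g by simp
    show "AE x in M. norm ((f x + g x)\<^sup>2) \<le> norm (2 * (f x)\<^sup>2 + 2 * (g x)\<^sup>2)"
      using young[of 1 1] by (intro AE_I2) simp
  qed measurable
  have "(\<integral>x. (f x + g x)\<^sup>2 \<partial>M) \<le> ((a + e) + (b + e))\<^sup>2" if e: "e > 0" for e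
  proof -
    define p q where pq_def: "p = a + e" "q = b + e"
    have pq: "p > 0" "q > 0" unfolding pq_def using f g e by auto
    have "(\<integral>x. (f x + g x)\<^sup>2 \<partial>M) \<le> (\<integral>x. (1 + q / p) * (f x)\<^sup>2 + (1 + p / q) * (g x)\<^sup>2 \<partial>M)"
      using f g young[OF pq] by (intro integral_mono i) auto
    also have "\<dots> = (1 + q / p) * (\<integral>x. (f x)\<^sup>2 \<partial>M) + (1 + p / q) * (\<integral>x. (g x)\<^sup>2 \<partial>M)"
      using f g by simp
    also have "\<dots> \<le> (1 + q / p) * p\<^sup>2 + (1 + p / q) * q\<^sup>2"
    proof (intro add_mono mult_left_mono)
      show "(\<integral>x. (f x)\<^sup>2 \<partial>M) \<le> p\<^sup>2" "(\<integral>x. (g x)\<^sup>2 \<partial>M) \<le> q\<^sup>2"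
        unfolding pq_def using f g e by (auto intro: order_trans power_mono)
    qed (use pq in auto)
    also have "\<dots> = (p\<^sup>2 + q * p) + (q\<^sup>2 + p * q)"
      using pq by (simp add: distrib_right power2_eq_square)
    also have "\<dots> = (p + q)\<^sup>2"
      by (simp add: power2_sum)
    finally show ?thesis by (simp only: pq_def)
  qed
  then have "\<forall>\<^sub>F e in at_right 0. (\<integral>x. (f x + g x)\<^sup>2 \<partial>M) \<le> ((a + e) + (b + e))\<^sup>2"
    by (auto simp: eventually_at_right_less intro: eventually_mono[OF eventually_at_right_less])
  moreover have "((\<lambda>e. ((a + e) + (b + e))\<^sup>2) \<longlongrightarrow> ((a + 0) + (b + 0))\<^sup>2) (at_right 0)"
    by (intro tendsto_intros)
  ultimately show "(\<integral>x. (f x + g x)\<^sup>2 \<partial>M) \<le> (a + b)\<^sup>2"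
    using tendsto_lowerbound[of "\<lambda>e. ((a + e) + (b + e))\<^sup>2" _ "at_right 0"] by simp
qed

lemma L2_triangle_sum:
  fixes f :: "'i \<Rightarrow> 'a \<Rightarrow> real"
  assumes "finite I" "\<And>i. i \<in> I \<Longrightarrow> f i \<in> borel_measurable M"
    and "\<And>i. i \<in> I \<Longrightarrow> integrable M (\<lambda>x. (f i x)\<^sup>2)"
    and "\<And>i. i \<in> I \<Longrightarrow> (\<integral>x. (f i x)\<^sup>2 \<partial>M) \<le> (a i)\<^sup>2" "\<And>i. i \<in> I \<Longrightarrow> 0 \<le> a i"
  shows "integrable M (\<lambda>x. (\<Sum>i\<in>I. f i x)\<^sup>2) \<and> (\<integral>x. (\<Sum>i\<in>I. f i x)\<^sup>2 \<partial>M) \<le> (\<Sum>i\<in>I. a i)\<^sup>2"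
  using assms
proof (induction I rule: finite_induct)
  case (insert i I)
  have "integrable M (\<lambda>x. (f i x + (\<Sum>i\<in>I. f i x))\<^sup>2)
    \<and> (\<integral>x. (f i x + (\<Sum>i\<in>I. f i x))\<^sup>2 \<partial>M) \<le> (a i + (\<Sum>i\<in>I. a i))\<^sup>2"
    using insert sum_nonneg[of I a]
    by (intro conjI L2_triangle[where f = "f i" and g = "\<lambda>x. \<Sum>i\<in>I. f i x" and a = "a i" and b = "\<Sum>i\<in>I. a i"]
        borel_measurable_sum) auto
  with insert show ?case by simp
qed simp

lemma sum_reindex_le_suminf:
  fixes c :: "nat \<Rightarrow> real"
  assumes "summable c" "\<And>i. 0 \<le> c i" "finite A" "inj_on f A"
  shows "(\<Sum>a\<in>A. c (f a)) \<le> suminf c"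
  using sum_le_suminf[of c "f ` A"] assms by (simp add: sum.reindex)

context iid_sequence
begin

lemma influence_sum_le:
  fixes Z :: "'i \<Rightarrow> (int \<Rightarrow> 'c) \<Rightarrow> real"
  assumes "finite I" and [measurable]: "\<And>m. Z m \<in> borel_measurable P" and K: "\<And>m \<omega>. \<bar>Z m \<omega>\<bar> \<le> K"
    and "\<And>m. m \<in> I \<Longrightarrow> influence j (Z m) \<le> (e m)\<^sup>2" "\<And>m. m \<in> I \<Longrightarrow> 0 \<le> e m"
  shows "influence j (\<lambda>\<omega>. \<Sum>m\<in>I. Z m \<omega>) \<le> (\<Sum>m\<in>I. e m)\<^sup>2"
proof -
  have "integrable PP (\<lambda>z. (Z m (fst z) - Z m (mix (-{j}) (fst z) (snd z)))\<^sup>2)" for m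
  proof (rule integrable_bounded_square_PP)
    show "\<bar>Z m (fst z) - Z m (mix (-{j}) (fst z) (snd z))\<bar> \<le> 2 * K" for z
      using K[of m "fst z"] K[of m "mix (-{j}) (fst z) (snd z)"] by linarith
  qed measurable
  then have "(\<integral>z. (\<Sum>m\<in>I. Z m (fst z) - Z m (mix (-{j}) (fst z) (snd z)))\<^sup>2 \<partial>PP) \<le> (\<Sum>m\<in>I. e m)\<^sup>2"
    using assms by (intro L2_triangle_sum[THEN conjunct2]) (auto simp: influence_def)
  then show ?thesis
    by (simp add: influence_def sum_subtractf)
qed

lemma influence_eq_0:
  assumes "\<And>\<omega> \<omega>'. (\<And>k. k \<noteq> j \<Longrightarrow> \<omega> k = \<omega>' k) \<Longrightarrow> g \<omega> = g \<omega>'"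
  shows "influence j g = 0"
proof -
  have "g (mix (-{j}) \<omega> \<omega>') = g \<omega>" for \<omega> \<omega>'
    by (rule assms) (simp add: mix_apply)
  then show ?thesis by (simp add: influence_def)
qed

text \<open>Efron--Stein, with \<open>\<Sum>\<^sub>j (\<Sum>\<^sub>m d\<^sub>m\<^sub>,\<^sub>j)\<^sup>2\<close> bounded as in Young's convolution inequality by
  \<open>max\<^sub>j (\<Sum>\<^sub>m d\<^sub>m\<^sub>,\<^sub>j) \<cdot> \<Sum>\<^sub>m \<Sum>\<^sub>j d\<^sub>m\<^sub>,\<^sub>j\<close>.\<close>

lemma variance_sum_le:
  fixes Z :: "nat \<Rightarrow> (int \<Rightarrow> 'c) \<Rightarrow> real"
  assumes [measurable]: "\<And>m. Z m \<in> borel_measurable P" and K: "\<And>m \<omega>. \<bar>Z m \<omega>\<bar> \<le> K"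
    and dep: "\<And>m \<omega> \<omega>'. (\<And>k. k \<le> int m + 1 \<Longrightarrow> \<omega> k = \<omega>' k) \<Longrightarrow> Z m \<omega> = Z m \<omega>'"
    and lim: "\<And>m. (\<lambda>J::nat. \<integral>z. \<bar>Z m (snd z) - Z m (mix {..- int J} (fst z) (snd z))\<bar> \<partial>PP) \<longlonglongrightarrow> 0"
    and infl: "\<And>m i. influence (int m + 1 - int i) (Z m) \<le> (d m i)\<^sup>2"
    and d: "\<And>m i. 0 \<le> d m i" "\<And>m i. d m i \<le> c i" "summable c"
    and \<delta>: "\<And>m. suminf (d m) \<le> \<delta> m"
  shows "P.variance (\<lambda>\<omega>. \<Sum>m<n. Z m \<omega>) \<le> suminf c * (\<Sum>m<n. \<delta> m) / 2"
proof (rule efron_stein[where N = "int n" and K = "real n * K"])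
  have sd: "summable (d m)" for m
    using d by (intro summable_comparison_test[OF _ d(3)]) (auto intro!: exI[of _ 0])
  have c0: "0 \<le> c i" for i using d(1,2) order_trans by blast
  show "\<bar>\<Sum>m<n. Z m \<omega>\<bar> \<le> real n * K" for \<omega>
    using order_trans[OF sum_abs sum_mono[of "{..<n}" "\<lambda>m. \<bar>Z m \<omega>\<bar>" "\<lambda>_. K"]] K by simp
  show "(\<Sum>m<n. Z m \<omega>) = (\<Sum>m<n. Z m \<omega>')" if "\<And>k. k \<le> int n \<Longrightarrow> \<omega> k = \<omega>' k" for \<omega> \<omega>'
    by (intro sum.cong dep that) auto
  have tri: "\<bar>Z m x - Z m y\<bar> \<le> 2 * K" for m x y
    using K[of m x] K[of m y] by linarith
  show "(\<lambda>J::nat. \<integral>z. \<bar>(\<Sum>m<n. Z m (snd z)) - (\<Sum>m<n. Z m (mix {..- int J} (fst z) (snd z)))\<bar> \<partial>PP) \<longlonglongrightarrow> 0"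
  proof (rule tendsto_sandwich[OF _ _ tendsto_const])
    have i: "integrable PP (\<lambda>z. \<bar>Z m (snd z) - Z m (mix {..- int J} (fst z) (snd z))\<bar>)" for m J
      using tri by (intro integrable_bounded_PP[where K = "2 * K"]) auto
    have "(\<integral>z. \<bar>(\<Sum>m<n. Z m (snd z)) - (\<Sum>m<n. Z m (mix {..- int J} (fst z) (snd z)))\<bar> \<partial>PP)
        \<le> (\<integral>z. (\<Sum>m<n. \<bar>Z m (snd z) - Z m (mix {..- int J} (fst z) (snd z))\<bar>) \<partial>PP)" for J
    proof (rule integral_mono)
      show "integrable PP (\<lambda>z. \<bar>(\<Sum>m<n. Z m (snd z)) - (\<Sum>m<n. Z m (mix {..- int J} (fst z) (snd z)))\<bar>)"
      proof (rule integrable_bounded_PP)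
        show "\<bar>\<bar>(\<Sum>m<n. Z m (snd z)) - (\<Sum>m<n. Z m (mix {..- int J} (fst z) (snd z)))\<bar>\<bar> \<le> real n * (2 * K)" for z
          unfolding sum_subtractf[symmetric] abs_idempotent
          using order_trans[OF sum_abs sum_mono[of "{..<n}" _ "\<lambda>_. 2 * K"]] tri by simp
      qed measurable
    qed (auto simp: sum_subtractf[symmetric] intro!: i)
    then show "\<forall>\<^sub>F J in sequentially. (\<integral>z. \<bar>(\<Sum>m<n. Z m (snd z)) - (\<Sum>m<n. Z m (mix {..- int J} (fst z) (snd z)))\<bar> \<partial>PP)
        \<le> (\<Sum>m<n. \<integral>z. \<bar>Z m (snd z) - Z m (mix {..- int J} (fst z) (snd z))\<bar> \<partial>PP)"
      using i by simp
    show "(\<lambda>J::nat. \<Sum>m<n. \<integral>z. \<bar>Z m (snd z) - Z m (mix {..- int J} (fst z) (snd z))\<bar> \<partial>PP) \<longlonglongrightarrow> 0"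
      using tendsto_sum[of "{..<n}", OF lim] by simp
  qed simp
  show "(\<Sum>j\<in>{- int J<..int n}. influence j (\<lambda>\<omega>. \<Sum>m<n. Z m \<omega>)) \<le> suminf c * (\<Sum>m<n. \<delta> m)" for J
  proof -
    \<comment> \<open>Term \<open>m\<close> is an observation at time \<open>m + 1\<close>, so
      innovation \<open>j\<close> acts on it at lag \<open>m + 1 - j\<close>; a later innovation has
      no influence at all.\<close>
    define e where "e j m = (if j \<le> int m + 1 then d m (nat (int m + 1 - j)) else 0)" for j :: int and m :: nat
    have e0: "0 \<le> e j m" for j m by (simp add: e_def d)
    have e_infl: "influence j (Z m) \<le> (e j m)\<^sup>2" for j m
    proof (cases "j \<le> int m + 1")
      case True
      then show ?thesis using infl[of m "nat (int m + 1 - j)"] by (simp add: e_def)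
    next
      case False
      then show ?thesis
        by (subst influence_eq_0) (auto simp: e_def intro!: dep)
    qed
    \<comment> \<open>For a fixed innovation, distinct terms see it at distinct lags, so the sum
      over \<open>m\<close> is part of the series \<open>c\<close>.\<close>
    have e_c: "(\<Sum>m<n. e j m) \<le> suminf c" for j
    proof -
      have "(\<Sum>m<n. e j m) = (\<Sum>m\<in>{m. m < n \<and> j \<le> int m + 1}. d m (nat (int m + 1 - j)))"
        unfolding e_def by (subst sum.If_cases) (auto intro!: sum.cong)
      also have "\<dots> \<le> (\<Sum>m\<in>{m. m < n \<and> j \<le> int m + 1}. c (nat (int m + 1 - j)))"
        by (intro sum_mono d)
      also have "\<dots> \<le> suminf c"
        by (intro sum_reindex_le_suminf d(3) c0) (auto simp: inj_on_def)
      finally show ?thesis .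
    qed
    have e_d: "(\<Sum>j\<in>{- int J<..int n}. e j m) \<le> \<delta> m" for m
    proof -
      have "(\<Sum>j\<in>{- int J<..int n}. e j m)
          = (\<Sum>j\<in>{- int J<..int n} \<inter> {..int m + 1}. d m (nat (int m + 1 - j)))"
        unfolding e_def by (subst sum.If_cases) (auto simp: atMost_def)
      also have "\<dots> \<le> suminf (d m)"
        by (intro sum_reindex_le_suminf sd d(1)) (auto simp: inj_on_def)
      finally show ?thesis using \<delta>[of m] by simp
    qed
    have "(\<Sum>j\<in>{- int J<..int n}. influence j (\<lambda>\<omega>. \<Sum>m<n. Z m \<omega>))
        \<le> (\<Sum>j\<in>{- int J<..int n}. (\<Sum>m<n. e j m)\<^sup>2)"
      by (intro sum_mono influence_sum_le[where K = K] K e_infl e0) auto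
    also have "\<dots> \<le> (\<Sum>j\<in>{- int J<..int n}. suminf c * (\<Sum>m<n. e j m))"
      unfolding power2_eq_square by (intro sum_mono mult_right_mono e_c sum_nonneg e0)
    also have "\<dots> = suminf c * (\<Sum>m<n. \<Sum>j\<in>{- int J<..int n}. e j m)"
      by (subst sum.swap) (simp add: sum_distrib_left)
    also have "\<dots> \<le> suminf c * (\<Sum>m<n. \<delta> m)"
      by (intro mult_left_mono sum_mono e_d suminf_nonneg d(3) c0)
    finally show ?thesis .
  qed
qed measurable

end

subsection \<open>Averaging over all entries outside a set\<close>

context iid_sequence
begin

text \<open>A version of the conditional expectation given the coordinates in \<open>A\<close>. As a
  partial integral it is defined at every point, and it depends on those coordinates literally, not
  just almost surely.\<close>

definition avg :: "int set \<Rightarrow> ((int \<Rightarrow> 'c) \<Rightarrow> real) \<Rightarrow> (int \<Rightarrow> 'c) \<Rightarrow> real" where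
  "avg A g \<omega> = (\<integral>\<omega>'. g (mix A \<omega> \<omega>') \<partial>P)"

lemma measurable_avg [measurable]:
  assumes [measurable]: "g \<in> borel_measurable P"
  shows "avg A g \<in> borel_measurable P"
  unfolding avg_def[abs_def] by measurable

text \<open>No measurability is assumed, because \<open>avg\<close> is also bounded at points
  outside the space of \<open>P\<close>, where a section may fail to be measurable; a non-integrable
  function has integral 0, for which the bound is trivial.\<close>

lemma abs_integral_le_P:
  assumes "\<And>\<omega>. \<bar>g \<omega>\<bar> \<le> (K::real)"
  shows "\<bar>\<integral>\<omega>. g \<omega> \<partial>P\<bar> \<le> K"
proof (cases "integrable P g")
  case True
  have "\<bar>\<integral>\<omega>. g \<omega> \<partial>P\<bar> \<le> (\<integral>\<omega>. \<bar>g \<omega>\<bar> \<partial>P)" by (rule integral_abs_bound)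
  also have "\<dots> \<le> (\<integral>\<omega>. K \<partial>P)" using True assms by (intro integral_mono) auto
  finally show ?thesis by (simp add: P.prob_space)
next
  case False
  then show ?thesis using assms[of undefined] by (simp add: not_integrable_integral_eq)
qed

lemma abs_avg_le: "(\<And>\<omega>. \<bar>g \<omega>\<bar> \<le> K) \<Longrightarrow> \<bar>avg A g \<omega>\<bar> \<le> K"
  unfolding avg_def by (rule abs_integral_le_P)

lemma avg_cong:
  assumes "\<And>\<omega> \<omega>'. (\<And>k. k \<in> B \<Longrightarrow> \<omega> k = \<omega>' k) \<Longrightarrow> g \<omega> = g \<omega>'"
    and "\<And>k. k \<in> A \<inter> B \<Longrightarrow> \<omega> k = \<omega>' k"
  shows "avg A g \<omega> = avg A g \<omega>'"
  unfolding avg_def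
  by (intro Bochner_Integration.integral_cong refl assms(1)) (use assms(2) in \<open>auto simp: mix_apply\<close>)

lemma integral_avg:
  assumes [measurable]: "g \<in> borel_measurable P" and K: "\<And>\<omega>. \<bar>g \<omega>\<bar> \<le> K"
  shows "(\<integral>\<omega>. avg A g \<omega> \<partial>P) = (\<integral>\<omega>. g \<omega> \<partial>P)"
proof -
  have i: "integrable PP (\<lambda>z. g (mix A (fst z) (snd z)))"
    using K by (intro integrable_bounded_PP[where K = K]) auto
  have "(\<integral>\<omega>. avg A g \<omega> \<partial>P) = (\<integral>z. g (mix A (fst z) (snd z)) \<partial>PP)"
    unfolding avg_def
    by (rule PP.integral_fst[of "\<lambda>x y. g (mix A x y)", unfolded split_beta', OF i])
  then show ?thesis by (simp add: integral_mix)
qed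

lemma square_integral_le_P:
  fixes g :: "(int \<Rightarrow> 'c) \<Rightarrow> real"
  assumes [measurable]: "g \<in> borel_measurable P" and K: "\<And>\<omega>. \<bar>g \<omega>\<bar> \<le> K"
  shows "(\<integral>\<omega>. g \<omega> \<partial>P)\<^sup>2 \<le> (\<integral>\<omega>. (g \<omega>)\<^sup>2 \<partial>P)"
proof -
  have "integrable P g" "integrable P (\<lambda>\<omega>. (g \<omega>)\<^sup>2)"
    using integrable_bounded_P[OF assms(1) K] integrable_bounded_square_P[OF assms(1) K] by auto
  from P.variance_eq[OF this] P.variance_positive[of g] show ?thesis by linarith
qed

text \<open>Jensen's inequality in the second copy: \<open>g - avg A g\<close> is the mean over that
  copy of the difference on the right.\<close>

lemma L2_minus_avg_le:
  assumes [measurable]: "g \<in> borel_measurable P" and K: "\<And>\<omega>. \<bar>g \<omega>\<bar> \<le> K"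
  shows "(\<integral>\<omega>. (g \<omega> - avg A g \<omega>)\<^sup>2 \<partial>P) \<le> (\<integral>z. (g (fst z) - g (mix A (fst z) (snd z)))\<^sup>2 \<partial>PP)"
proof -
  have tri: "\<bar>g x - g y\<bar> \<le> 2 * K" for x y
    using K[of x] K[of y] by linarith
  have i: "integrable PP (\<lambda>z. (g (fst z) - g (mix A (fst z) (snd z)))\<^sup>2)"
    using tri by (intro integrable_bounded_square_PP[where K = "2 * K"]) auto
  have "(\<integral>\<omega>. (g \<omega> - avg A g \<omega>)\<^sup>2 \<partial>P) \<le> (\<integral>\<omega>. (\<integral>\<omega>'. (g \<omega> - g (mix A \<omega> \<omega>'))\<^sup>2 \<partial>P) \<partial>P)"
  proof (rule integral_mono)
    show "integrable P (\<lambda>\<omega>. (g \<omega> - avg A g \<omega>)\<^sup>2)"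
    proof (rule integrable_bounded_square_P)
      show "\<bar>g \<omega> - avg A g \<omega>\<bar> \<le> 2 * K" for \<omega>
        using K[of \<omega>] abs_avg_le[of g K A \<omega>, OF K] by linarith
    qed measurable
    show "integrable P (\<lambda>\<omega>. \<integral>\<omega>'. (g \<omega> - g (mix A \<omega> \<omega>'))\<^sup>2 \<partial>P)"
      using PP.integrable_fst[of "\<lambda>x y. (g x - g (mix A x y))\<^sup>2", unfolded split_beta', OF i] .
    show "(g \<omega> - avg A g \<omega>)\<^sup>2 \<le> (\<integral>\<omega>'. (g \<omega> - g (mix A \<omega> \<omega>'))\<^sup>2 \<partial>P)" if [measurable]: "\<omega> \<in> space P" for \<omega>
    proof -
      have ii: "integrable P (\<lambda>\<omega>'. g (mix A \<omega> \<omega>'))"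
        using K by (intro integrable_bounded_P[where K = K]) auto
      have "g \<omega> - avg A g \<omega> = (\<integral>\<omega>'. g \<omega> - g (mix A \<omega> \<omega>') \<partial>P)"
        using ii by (simp add: avg_def P.prob_space)
      then show ?thesis
        using square_integral_le_P[of "\<lambda>\<omega>'. g \<omega> - g (mix A \<omega> \<omega>')" "2 * K"] tri by simp
    qed
  qed
  also have "\<dots> = (\<integral>z. (g (fst z) - g (mix A (fst z) (snd z)))\<^sup>2 \<partial>PP)"
    by (rule PP.integral_fst[of "\<lambda>x y. (g x - g (mix A x y))\<^sup>2", unfolded split_beta', OF i])
  finally show ?thesis .
qed

text \<open>If \<open>j\<close> lies outside \<open>A\<close>, the average ignores coordinate
  \<open>j\<close>. Otherwise refreshing \<open>j\<close> commutes with averaging, Jensen moves the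
  square inside the average, and \<open>mix A\<close> of two independent copies again has law
  \<open>P\<close>.\<close>

lemma influence_avg_le:
  assumes [measurable]: "g \<in> borel_measurable P" and K: "\<And>\<omega>. \<bar>g \<omega>\<bar> \<le> K"
  shows "influence j (avg A g) \<le> influence j g"
proof (cases "j \<in> A")
  case False
  have "influence j (avg A g) = 0"
  proof (rule influence_eq_0)
    fix \<omega> \<omega>' :: "int \<Rightarrow> 'c" assume "\<And>k. k \<noteq> j \<Longrightarrow> \<omega> k = \<omega>' k"
    with False show "avg A g \<omega> = avg A g \<omega>'"
      by (intro avg_cong[where B = UNIV] arg_cong[where f = g]) (auto, metis)
  qed
  then show ?thesis by (simp add: influence_nonneg)
next
  case True
  define F where "F u \<omega>' = (g u - g (mix (-{j}) u \<omega>'))\<^sup>2" for u \<omega>'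
  have tri: "\<bar>g x - g y\<bar> \<le> 2 * K" for x y
    using K[of x] K[of y] by linarith
  have F_le: "\<bar>F u \<omega>'\<bar> \<le> (2 * K)\<^sup>2" for u \<omega>'
    unfolding F_def using power_mono[OF tri[of u "mix (-{j}) u \<omega>'"] abs_ge_zero, of 2] by simp
  have swap: "mix A (mix (-{j}) \<omega> \<omega>') \<omega>'' = mix (-{j}) (mix A \<omega> \<omega>'') \<omega>'" for \<omega> \<omega>' \<omega>'' :: "int \<Rightarrow> 'c"
    using True by (auto simp: mix_def)
  define H where "H z = (\<integral>\<omega>''. F (mix A (fst z) \<omega>'') (snd z) \<partial>P)" for z
  have H_m [measurable]: "H \<in> borel_measurable PP"
    unfolding H_def[abs_def] F_def by measurable
  have iH: "integrable PP H"
  proof (rule integrable_bounded_PP[OF H_m])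
    show "\<bar>H z\<bar> \<le> (2 * K)\<^sup>2" for z
      unfolding H_def by (rule abs_integral_le_P[OF F_le])
  qed
  have "influence j (avg A g) \<le> (\<integral>z. H z \<partial>PP)"
    unfolding influence_def
  proof (rule integral_mono[OF _ iH])
    show "integrable PP (\<lambda>z. (avg A g (fst z) - avg A g (mix (-{j}) (fst z) (snd z)))\<^sup>2)"
    proof (rule integrable_bounded_square_PP)
      show "\<bar>avg A g (fst z) - avg A g (mix (-{j}) (fst z) (snd z))\<bar> \<le> 2 * K" for z
        using abs_avg_le[of g K A "fst z", OF K] abs_avg_le[of g K A "mix (-{j}) (fst z) (snd z)", OF K] by linarith
    qed measurable
    show "(avg A g (fst z) - avg A g (mix (-{j}) (fst z) (snd z)))\<^sup>2 \<le> H z" if z: "z \<in> space PP" for z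
    proof -
      have [measurable]: "fst z \<in> space P" "snd z \<in> space P"
        using z by (auto simp: space_pair_measure)
      have i: "integrable P (\<lambda>\<omega>''. g (mix A (fst z) \<omega>''))"
        "integrable P (\<lambda>\<omega>''. g (mix (-{j}) (mix A (fst z) \<omega>'') (snd z)))"
        using K by (auto intro!: integrable_bounded_P[where K = K])
      have "avg A g (fst z) - avg A g (mix (-{j}) (fst z) (snd z))
          = (\<integral>\<omega>''. g (mix A (fst z) \<omega>'') - g (mix (-{j}) (mix A (fst z) \<omega>'') (snd z)) \<partial>P)"
        using i by (simp add: avg_def swap)
      then show ?thesis
        using square_integral_le_P[of "\<lambda>\<omega>''. g (mix A (fst z) \<omega>'') - g (mix (-{j}) (mix A (fst z) \<omega>'') (snd z))" "2 * K"] tri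
        by (simp add: H_def F_def)
    qed
  qed
  also have "\<dots> = (\<integral>\<omega>'. \<integral>\<omega>. H (\<omega>, \<omega>') \<partial>P \<partial>P)"
    using PP.integral_snd[of "\<lambda>x y. H (x, y)"] iH by simp
  also have "\<dots> = (\<integral>\<omega>'. \<integral>u. F u \<omega>' \<partial>P \<partial>P)"
  proof (rule Bochner_Integration.integral_cong[OF refl])
    fix \<omega>' assume [measurable]: "\<omega>' \<in> space P"
    have i: "integrable PP (\<lambda>z. F (mix A (fst z) (snd z)) \<omega>')"
      using F_le by (intro integrable_bounded_PP[where K = "(2 * K)\<^sup>2"]) (auto simp: F_def)
    have "(\<integral>\<omega>. H (\<omega>, \<omega>') \<partial>P) = (\<integral>z. F (mix A (fst z) (snd z)) \<omega>' \<partial>PP)"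
      unfolding H_def fst_conv snd_conv
      by (rule PP.integral_fst[of "\<lambda>x y. F (mix A x y) \<omega>'", unfolded split_beta', OF i])
    also have "\<dots> = (\<integral>u. F u \<omega>' \<partial>P)"
      by (rule integral_mix) (simp add: F_def)
    finally show "(\<integral>\<omega>. H (\<omega>, \<omega>') \<partial>P) = (\<integral>u. F u \<omega>' \<partial>P)" .
  qed
  also have "\<dots> = (\<integral>z. F (fst z) (snd z) \<partial>PP)"
  proof -
    have i: "integrable PP (\<lambda>z. F (fst z) (snd z))"
      using F_le by (intro integrable_bounded_PP[where K = "(2 * K)\<^sup>2"]) (auto simp: F_def)
    show ?thesis
      by (rule PP.integral_snd[of "\<lambda>x y. F x y", unfolded split_beta', OF i])
  qed
  also have "\<dots> = influence j g"
    by (simp add: F_def influence_def)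
  finally show ?thesis .
qed

text \<open>A bound by the norm alone, uniform in \<open>j\<close>. For the block error it competes
  with the bound by lag, and the smaller of the two is used.\<close>

lemma influence_le_L2:
  assumes [measurable]: "g \<in> borel_measurable P" and K: "\<And>\<omega>. \<bar>g \<omega>\<bar> \<le> K"
    and a: "(\<integral>\<omega>. (g \<omega>)\<^sup>2 \<partial>P) \<le> a\<^sup>2" "0 \<le> a"
  shows "influence j g \<le> (a + a)\<^sup>2"
proof -
  have i: "integrable PP (\<lambda>z. (g (fst z))\<^sup>2)" "integrable PP (\<lambda>z. (- g (mix (-{j}) (fst z) (snd z)))\<^sup>2)"
    using K by (auto intro!: integrable_bounded_square_PP[where K = K])
  have "(\<integral>z. (g (fst z) + - g (mix (-{j}) (fst z) (snd z)))\<^sup>2 \<partial>PP) \<le> (a + a)\<^sup>2"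
    using a integral_fst_PP[of "\<lambda>\<omega>. (g \<omega>)\<^sup>2"] integral_mix[of "\<lambda>\<omega>. (g \<omega>)\<^sup>2" "-{j}"]
    by (intro L2_triangle(2) i) auto
  then show ?thesis by (simp add: influence_def)
qed

lemma influence_diff_le:
  assumes [measurable]: "g \<in> borel_measurable P" "h \<in> borel_measurable P"
    and K: "\<And>\<omega>. \<bar>g \<omega>\<bar> \<le> K" "\<And>\<omega>. \<bar>h \<omega>\<bar> \<le> K"
    and a: "influence j g \<le> a\<^sup>2" "0 \<le> a" and b: "influence j h \<le> b\<^sup>2" "0 \<le> b"
  shows "influence j (\<lambda>\<omega>. g \<omega> - h \<omega>) \<le> (a + b)\<^sup>2"
proof -
  have "\<bar>g x - g y\<bar> \<le> 2 * K" "\<bar>h x - h y\<bar> \<le> 2 * K" for x y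
    using K(1)[of x] K(1)[of y] K(2)[of x] K(2)[of y] by linarith+
  then have i: "integrable PP (\<lambda>z. (g (fst z) - g (mix (-{j}) (fst z) (snd z)))\<^sup>2)"
    "integrable PP (\<lambda>z. (h (mix (-{j}) (fst z) (snd z)) - h (fst z))\<^sup>2)"
    by (auto intro!: integrable_bounded_square_PP[where K = "2 * K"])
  have "(\<integral>z. ((g (fst z) - g (mix (-{j}) (fst z) (snd z)))
        + (h (mix (-{j}) (fst z) (snd z)) - h (fst z)))\<^sup>2 \<partial>PP) \<le> (a + b)\<^sup>2"
    using a b by (intro L2_triangle(2) i) (auto simp: influence_def power2_commute)
  then show ?thesis by (simp add: influence_def algebra_simps)
qed

lemma integral_shift_PP:
  assumes [measurable]: "f \<in> borel_measurable PP"
  shows "(\<integral>z. f (shift s (fst z), shift s (snd z)) \<partial>PP) = (\<integral>z. (f z::real) \<partial>PP)"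
proof -
  interpret S: prob_space "distr P P (shift s)"
    by (rule P.prob_space_distr) measurable
  have "distr PP PP (\<lambda>(x, y). (shift s x, shift s y)) = PP"
    using pair_measure_distr[of "shift s" P P "shift s" P P] S.sigma_finite_measure_axioms
    by (simp add: distr_shift)
  then have "(\<integral>z. f z \<partial>PP) = (\<integral>z. f z \<partial>distr PP PP (\<lambda>(x, y). (shift s x, shift s y)))"
    by simp
  also have "\<dots> = (\<integral>z. f (shift s (fst z), shift s (snd z)) \<partial>PP)"
    by (subst integral_distr) (auto simp: case_prod_beta')
  finally show ?thesis ..
qed

lemma shift_mix: "shift s (mix A \<omega> \<omega>') = mix {k. k + s \<in> A} (shift s \<omega>) (shift s \<omega>')"
  by (auto simp: shift_def mix_def)

lemma avg_shift:
  assumes [measurable]: "g \<in> borel_measurable P" and \<omega>: "\<omega> \<in> space P"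
  shows "avg A (\<lambda>\<omega>. g (shift s \<omega>)) \<omega> = avg {k. k + s \<in> A} g (shift s \<omega>)"
proof -
  have [measurable]: "shift s \<omega> \<in> space P"
    using measurable_space[OF measurable_shift \<omega>] .
  show ?thesis
    unfolding avg_def shift_mix by (rule integral_shift) measurable
qed

end

text \<open>Tannery's theorem with majorant \<open>c\<close>. This is what turns bare summability
  into smallness, both for clips over short intervals and for the block error.\<close>

lemma tendsto_suminf_min:
  fixes c :: "nat \<Rightarrow> real"
  assumes "summable c" "\<And>i. 0 \<le> c i" and x: "(x \<longlongrightarrow> 0) F" "\<And>n. 0 \<le> x n"
  shows "((\<lambda>n. \<Sum>i. min (c i) (x n)) \<longlongrightarrow> 0) F"
proof (cases "F = bot")
  case False
  have "((\<lambda>n. \<Sum>i. min (c i) (x n)) \<longlongrightarrow> (\<Sum>i. 0 :: real)) F"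
  proof (rule tannerys_theorem[where M = c, THEN conjunct2, THEN conjunct2])
    show "((\<lambda>n. min (c k) (x n)) \<longlongrightarrow> 0) F" for k
      using tendsto_min[OF tendsto_const[of "c k"] x(1)] assms(2)[of k] by (simp add: min_absorb2)
    show "\<forall>\<^sub>F (k, n) in at_top \<times>\<^sub>F F. norm (min (c k) (x n)) \<le> c k"
      using assms by (intro always_eventually) (auto simp: min_def)
  qed (use assms False in auto)
  then show ?thesis by simp
qed simp

subsection \<open>Causal processes of independent innovations\<close>

definition coord :: "int \<Rightarrow> (int \<Rightarrow> 'c) \<Rightarrow> 'c" where
  "coord k \<omega> = \<omega> k"

locale causal_map = iid_sequence D
  for D :: "'c measure" +
  fixes G :: "(nat \<Rightarrow> 'c) \<Rightarrow> real"
  assumes measurable_G: "G \<in> borel_measurable (PiM UNIV (\<lambda>_. D))"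
begin

abbreviation X :: "int \<Rightarrow> (int \<Rightarrow> 'c) \<Rightarrow> real" where "X \<equiv> causal_process G coord"

lemma X_eq: "X k \<omega> = G (\<lambda>j. \<omega> (k - int j))"
  by (simp add: causal_process_def past_def[abs_def] coord_def)

lemma measurable_X [measurable]: "X k \<in> borel_measurable P"
proof -
  have "(\<lambda>\<omega> j. \<omega> (k - int j)) \<in> P \<rightarrow>\<^sub>M PiM UNIV (\<lambda>_::nat. D)"
    by (rule measurable_PiM_single') (auto simp: space_P)
  from measurable_compose[OF this measurable_G] show ?thesis
    by (simp add: X_eq[abs_def])
qed

lemma X_cong: "(\<And>i. i \<le> k \<Longrightarrow> \<omega> i = \<omega>' i) \<Longrightarrow> X k \<omega> = X k \<omega>'"
  by (simp add: X_eq)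

lemma X_shift: "X k (shift s \<omega>) = X (k + s) \<omega>"
  by (simp add: X_eq shift_def algebra_simps)

text \<open>The truncation at 1 keeps the expectation finite whatever the tails of \<open>X\<close>.
  It measures how well time \<open>n\<close> has forgotten everything up to time 0.\<close>

definition gap :: "nat \<Rightarrow> real" where
  "gap n = (\<integral>z. min 1 \<bar>X (int n) (fst z) - X (int n) (mix {0<..} (fst z) (snd z))\<bar> \<partial>PP)"

lemma gap_nonneg: "0 \<le> gap n"
  by (simp add: gap_def)

lemma integrable_gap:
  "integrable PP (\<lambda>z. min 1 \<bar>X k (fst z) - X k (mix A (fst z) (snd z))\<bar>)"
  "integrable PP (\<lambda>z. (min 1 \<bar>X k (fst z) - X k (mix A (fst z) (snd z))\<bar>)\<^sup>2)"
  by (auto intro!: integrable_bounded_PP[where K = 1] integrable_bounded_square_PP[where K = 1])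

lemma gap_shift:
  assumes "j \<le> k"
  shows "(\<integral>z. min 1 \<bar>X k (fst z) - X k (mix {j<..} (fst z) (snd z))\<bar> \<partial>PP) = gap (nat (k - j))"
proof -
  let ?f = "\<lambda>z. min 1 \<bar>X (k - j) (fst z) - X (k - j) (mix {0<..} (fst z) (snd z))\<bar>"
  have "mix {0<..} (shift j \<omega>) (shift j \<omega>') = shift j (mix {j<..} \<omega> \<omega>')" for \<omega> \<omega>' :: "int \<Rightarrow> 'c"
    by (auto simp: mix_def shift_def)
  then have "(\<integral>z. min 1 \<bar>X k (fst z) - X k (mix {j<..} (fst z) (snd z))\<bar> \<partial>PP)
      = (\<integral>z. ?f (shift j (fst z), shift j (snd z)) \<partial>PP)"
    by (simp add: X_shift)
  also have "\<dots> = (\<integral>z. ?f z \<partial>PP)"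
    by (rule integral_shift_PP) measurable
  finally show ?thesis using assms by (simp add: gap_def)
qed

text \<open>The tail term of the Efron--Stein inequality is a coupling with the two copies exchanged.\<close>

lemma integral_mix_flip:
  fixes g :: "(int \<Rightarrow> 'c) \<Rightarrow> real"
  assumes [measurable]: "g \<in> borel_measurable P"
  shows "(\<integral>z. \<bar>g (snd z) - g (mix {..j} (fst z) (snd z))\<bar> \<partial>PP)
    = (\<integral>z. \<bar>g (fst z) - g (mix {j<..} (fst z) (snd z))\<bar> \<partial>PP)"
proof -
  have "mix {..j} \<omega> \<omega>' = mix {j<..} \<omega>' \<omega>" for \<omega> \<omega>' :: "int \<Rightarrow> 'c"
    by (auto simp: mix_def)
  then have "(\<integral>z. \<bar>g (snd z) - g (mix {..j} (fst z) (snd z))\<bar> \<partial>PP)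
    = (\<integral>z. \<bar>g (fst (exchange {} z)) - g (mix {j<..} (fst (exchange {} z)) (snd (exchange {} z)))\<bar> \<partial>PP)"
    by (simp add: exchange_def)
  also have "\<dots> = (\<integral>z. \<bar>g (fst z) - g (mix {j<..} (fst z) (snd z))\<bar> \<partial>PP)"
    by (rule integral_exchange[of "\<lambda>z. \<bar>g (fst z) - g (mix {j<..} (fst z) (snd z))\<bar>"]) measurable
  finally show ?thesis .
qed

end

text \<open>\<open>coupling\<close> treats one innovation at a time and feeds the Efron-Stein sums;
  \<open>gap_tendsto\<close> treats the replacement of the entire past at once and feeds the tail
  condition and the comparison with block averages.\<close>

locale causal_sequence = causal_map D G
  for D :: "'c measure" and G +
  fixes c :: "nat \<Rightarrow> real"
  assumes summable_c: "summable c" and c_nonneg: "\<And>i. 0 \<le> c i"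
    and coupling: "\<And>n. (\<integral>z. (min 1 \<bar>X (int n) (fst z) - X (int n) (mix (-{0}) (fst z) (snd z))\<bar>)\<^sup>2 \<partial>PP) \<le> (c n)\<^sup>2"
    and gap_tendsto: "gap \<longlonglongrightarrow> 0"
begin

lemma coupling_shift:
  "(\<integral>z. (min 1 \<bar>X k (fst z) - X k (mix (-{k - int i}) (fst z) (snd z))\<bar>)\<^sup>2 \<partial>PP) \<le> (c i)\<^sup>2"
proof -
  let ?j = "k - int i"
  let ?f = "\<lambda>z. (min 1 \<bar>X (int i) (fst z) - X (int i) (mix (-{0}) (fst z) (snd z))\<bar>)\<^sup>2"
  have "mix (-{0}) (shift ?j \<omega>) (shift ?j \<omega>') = shift ?j (mix (-{?j}) \<omega> \<omega>')" for \<omega> \<omega>' :: "int \<Rightarrow> 'c"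
    by (auto simp: mix_def shift_def)
  then have "(\<integral>z. (min 1 \<bar>X k (fst z) - X k (mix (-{?j}) (fst z) (snd z))\<bar>)\<^sup>2 \<partial>PP)
      = (\<integral>z. ?f (shift ?j (fst z), shift ?j (snd z)) \<partial>PP)"
    by (simp add: X_shift)
  also have "\<dots> = (\<integral>z. ?f z \<partial>PP)"
    by (rule integral_shift_PP) measurable
  finally show ?thesis using coupling[of i] by simp
qed

text \<open>Lipschitz for the truncated distance, the one that the coupling bounds control. This
  contains both an ordinary Lipschitz bound and a bound \<open>L\<close> on the oscillation.\<close>

definition observable :: "real \<Rightarrow> real \<Rightarrow> (real \<Rightarrow> real) \<Rightarrow> bool" where
  "observable L K h \<longleftrightarrow> h \<in> borel_measurable borel \<and> 0 \<le> L \<and> (\<forall>x. \<bar>h x\<bar> \<le> K) \<and>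
    (\<forall>x y. \<bar>h x - h y\<bar> \<le> L * min 1 \<bar>x - y\<bar>)"

lemma observableD:
  assumes "observable L K h"
  shows "h \<in> borel_measurable borel" "0 \<le> L" "\<And>x. \<bar>h x\<bar> \<le> K"
    "\<And>x y. \<bar>h x - h y\<bar> \<le> L * min 1 \<bar>x - y\<bar>"
  using assms by (auto simp: observable_def)

text \<open>Shifted by one, so that \<open>{..<n}\<close> enumerates the observations at times 1 to
  \<open>n\<close>.\<close>

definition Y :: "(real \<Rightarrow> real) \<Rightarrow> nat \<Rightarrow> (int \<Rightarrow> 'c) \<Rightarrow> real" where
  "Y h m \<omega> = h (X (int m + 1) \<omega>)"

context
  fixes L K :: real and h :: "real \<Rightarrow> real"
  assumes obs: "observable L K h"
begin

lemma measurable_Y [measurable]: "Y h m \<in> borel_measurable P"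
  unfolding Y_def[abs_def] using observableD(1)[OF obs] by measurable

lemma abs_Y_le: "\<bar>Y h m \<omega>\<bar> \<le> K"
  by (simp add: Y_def observableD[OF obs])

lemma Y_cong: "(\<And>k. k \<le> int m + 1 \<Longrightarrow> \<omega> k = \<omega>' k) \<Longrightarrow> Y h m \<omega> = Y h m \<omega>'"
  unfolding Y_def by (simp add: X_cong[of "int m + 1" \<omega> \<omega>'])

lemma Y_shift: "Y h m (shift (int s) \<omega>) = Y h (m + s) \<omega>"
  by (simp add: Y_def X_shift algebra_simps)

lemma Y_coupling_square:
  "(\<integral>z. (Y h m (fst z) - Y h m (mix A (fst z) (snd z)))\<^sup>2 \<partial>PP)
    \<le> L\<^sup>2 * (\<integral>z. (min 1 \<bar>X (int m + 1) (fst z) - X (int m + 1) (mix A (fst z) (snd z))\<bar>)\<^sup>2 \<partial>PP)"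
proof -
  have "(\<integral>z. (Y h m (fst z) - Y h m (mix A (fst z) (snd z)))\<^sup>2 \<partial>PP)
    \<le> (\<integral>z. L\<^sup>2 * (min 1 \<bar>X (int m + 1) (fst z) - X (int m + 1) (mix A (fst z) (snd z))\<bar>)\<^sup>2 \<partial>PP)"
  proof (rule integral_mono)
    show "integrable PP (\<lambda>z. (Y h m (fst z) - Y h m (mix A (fst z) (snd z)))\<^sup>2)"
    proof (rule integrable_bounded_square_PP)
      show "\<bar>Y h m (fst z) - Y h m (mix A (fst z) (snd z))\<bar> \<le> 2 * K" for z
        using abs_Y_le[of m "fst z"] abs_Y_le[of m "mix A (fst z) (snd z)"] by linarith
    qed measurable
    show "(Y h m (fst z) - Y h m (mix A (fst z) (snd z)))\<^sup>2
      \<le> L\<^sup>2 * (min 1 \<bar>X (int m + 1) (fst z) - X (int m + 1) (mix A (fst z) (snd z))\<bar>)\<^sup>2" for z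
      using power_mono[OF observableD(4)[OF obs] abs_ge_zero, of _ _ 2]
      by (simp add: Y_def power_mult_distrib)
  qed (simp add: integrable_gap)
  then show ?thesis by simp
qed

lemma influence_Y: "influence (int m + 1 - int i) (Y h m) \<le> (L * c i)\<^sup>2"
proof -
  have "influence (int m + 1 - int i) (Y h m) \<le> L\<^sup>2 * (c i)\<^sup>2"
    unfolding influence_def
    by (rule order_trans[OF Y_coupling_square]) (intro mult_left_mono coupling_shift, simp)
  then show ?thesis by (simp add: power_mult_distrib)
qed

lemma Y_forgetting_square:
  assumes "j \<le> int m + 1"
  shows "(\<integral>z. (Y h m (fst z) - Y h m (mix {j<..} (fst z) (snd z)))\<^sup>2 \<partial>PP) \<le> L\<^sup>2 * gap (nat (int m + 1 - j))"
proof -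
  have "(min 1 x)\<^sup>2 \<le> min 1 x" if "0 \<le> x" for x :: real
    using power_decreasing[of 1 2 "min 1 x"] that by simp
  then have "(\<integral>z. (min 1 \<bar>X (int m + 1) (fst z) - X (int m + 1) (mix {j<..} (fst z) (snd z))\<bar>)\<^sup>2 \<partial>PP)
    \<le> (\<integral>z. min 1 \<bar>X (int m + 1) (fst z) - X (int m + 1) (mix {j<..} (fst z) (snd z))\<bar> \<partial>PP)"
    by (intro integral_mono integrable_gap) simp
  also have "\<dots> = gap (nat (int m + 1 - j))"
    by (rule gap_shift[OF assms])
  finally show ?thesis
    by (intro order_trans[OF Y_coupling_square] mult_left_mono) simp_all
qed

lemma Y_tail:
  "(\<lambda>J::nat. \<integral>z. \<bar>Y h m (snd z) - Y h m (mix {..- int J} (fst z) (snd z))\<bar> \<partial>PP) \<longlonglongrightarrow> 0"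
proof (rule tendsto_sandwich[OF _ _ tendsto_const])
  have le: "(\<integral>z. \<bar>Y h m (snd z) - Y h m (mix {..- int J} (fst z) (snd z))\<bar> \<partial>PP) \<le> L * gap (J + (m + 1))" for J
  proof -
    have "(\<integral>z. \<bar>Y h m (fst z) - Y h m (mix {- int J<..} (fst z) (snd z))\<bar> \<partial>PP)
      \<le> (\<integral>z. L * min 1 \<bar>X (int m + 1) (fst z) - X (int m + 1) (mix {- int J<..} (fst z) (snd z))\<bar> \<partial>PP)"
    proof (rule integral_mono)
      show "integrable PP (\<lambda>z. \<bar>Y h m (fst z) - Y h m (mix {- int J<..} (fst z) (snd z))\<bar>)"
      proof (rule integrable_bounded_PP)
        show "\<bar>\<bar>Y h m (fst z) - Y h m (mix {- int J<..} (fst z) (snd z))\<bar>\<bar> \<le> 2 * K" for z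
          using abs_Y_le[of m "fst z"] abs_Y_le[of m "mix {- int J<..} (fst z) (snd z)"] by linarith
      qed measurable
      show "\<bar>Y h m (fst z) - Y h m (mix {- int J<..} (fst z) (snd z))\<bar>
        \<le> L * min 1 \<bar>X (int m + 1) (fst z) - X (int m + 1) (mix {- int J<..} (fst z) (snd z))\<bar>" for z
        unfolding Y_def by (rule observableD(4)[OF obs])
    qed (simp add: integrable_gap)
    also have "\<dots> = L * gap (nat (int m + 1 - (- int J)))"
      by (subst gap_shift[symmetric]) auto
    also have "nat (int m + 1 - (- int J)) = J + (m + 1)" by simp
    finally show ?thesis by (subst integral_mix_flip) simp_all
  qed
  show "\<forall>\<^sub>F J in sequentially. (\<integral>z. \<bar>Y h m (snd z) - Y h m (mix {..- int J} (fst z) (snd z))\<bar> \<partial>PP)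
    \<le> L * gap (J + (m + 1))"
    using le by simp
  have "(\<lambda>J. L * gap (J + (m + 1))) \<longlonglongrightarrow> L * 0"
    by (intro tendsto_intros LIMSEQ_ignore_initial_segment gap_tendsto)
  then show "(\<lambda>J. L * gap (J + (m + 1))) \<longlonglongrightarrow> 0" by simp
qed simp

text \<open>An influence is at most the square of the smaller of the lag effect and the oscillation
  bound \<eta>. The variance per term is thus bounded through the series of
  \<open>min (L * c i) \<eta>\<close>, which tends to 0 with \<eta>: this is the gain for narrow
  clips.\<close>

lemma variance_sum_Y_le:
  assumes \<eta>: "0 \<le> \<eta>" "\<And>x y. \<bar>h x - h y\<bar> \<le> \<eta>"
  shows "P.variance (\<lambda>\<omega>. \<Sum>m<n. Y h m \<omega>) \<le> L * suminf c * (real n * (\<Sum>i. min (L * c i) \<eta>)) / 2"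
proof -
  have "P.variance (\<lambda>\<omega>. \<Sum>m<n. Y h m \<omega>) \<le> suminf (\<lambda>i. L * c i) * (\<Sum>m<n. \<Sum>i. min (L * c i) \<eta>) / 2"
  proof (rule variance_sum_le[where K = K and d = "\<lambda>m i. min (L * c i) \<eta>"])
    show "influence (int m + 1 - int i) (Y h m) \<le> (min (L * c i) \<eta>)\<^sup>2" for m i
    proof (cases "L * c i \<le> \<eta>")
      case True
      then show ?thesis using influence_Y[of m i] by (simp add: min_absorb1)
    next
      case False
      have "influence (int m + 1 - int i) (Y h m) \<le> (\<integral>z. \<eta>\<^sup>2 \<partial>PP)"
        unfolding influence_def
      proof (rule integral_mono)
        show "integrable PP (\<lambda>z. (Y h m (fst z) - Y h m (mix (-{int m + 1 - int i}) (fst z) (snd z)))\<^sup>2)"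
        proof (rule integrable_bounded_square_PP)
          show "\<bar>Y h m (fst z) - Y h m (mix (-{int m + 1 - int i}) (fst z) (snd z))\<bar> \<le> \<eta>" for z
            unfolding Y_def by (rule \<eta>(2))
        qed measurable
        show "(Y h m (fst z) - Y h m (mix (-{int m + 1 - int i}) (fst z) (snd z)))\<^sup>2 \<le> \<eta>\<^sup>2" for z
          using power_mono[OF \<eta>(2) abs_ge_zero, of _ _ 2] by (simp add: Y_def)
      qed simp
      then show ?thesis using False by (simp add: min_absorb2 PP.prob_space)
    qed
    show "0 \<le> min (L * c i) \<eta>" for i
      using \<eta>(1) observableD(2)[OF obs] c_nonneg[of i] by simp
  qed (auto intro: abs_Y_le Y_cong Y_tail simp: summable_c)
  then show ?thesis using summable_c by (simp add: suminf_mult)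
qed

end

end

subsection \<open>The central limit theorem for Lipschitz observables\<close>

lemma (in prob_space) abs_expectation_le_L2:
  fixes V :: "'a \<Rightarrow> real"
  assumes [measurable]: "V \<in> borel_measurable M"
    and V: "integrable M (\<lambda>x. (V x)\<^sup>2)" "expectation (\<lambda>x. (V x)\<^sup>2) \<le> a\<^sup>2" "0 \<le> a"
  shows "integrable M V" "expectation (\<lambda>x. \<bar>V x\<bar>) \<le> a"
proof -
  show i: "integrable M V"
    by (rule square_integrable_imp_integrable[OF _ V(1)]) measurable
  have "variance (\<lambda>x. \<bar>V x\<bar>) = expectation (\<lambda>x. \<bar>V x\<bar>\<^sup>2) - (expectation (\<lambda>x. \<bar>V x\<bar>))\<^sup>2"
    using i V(1) by (intro variance_eq) auto
  then have "(expectation (\<lambda>x. \<bar>V x\<bar>))\<^sup>2 \<le> a\<^sup>2"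
    using variance_positive[of "\<lambda>x. \<bar>V x\<bar>"] V(2) by simp
  then show "expectation (\<lambda>x. \<bar>V x\<bar>) \<le> a"
    by (rule power2_le_imp_le) (rule V(3))
qed

lemma norm_iexp_diff_le: "cmod (iexp x - iexp y) \<le> \<bar>x - y\<bar>"
proof -
  have "iexp x - iexp y = iexp y * (iexp (x - y) - 1)"
    by (simp add: algebra_simps exp_add[symmetric])
  then have "cmod (iexp x - iexp y) = cmod (iexp (x - y) - 1)"
    by (simp add: norm_mult)
  also have "\<dots> \<le> \<bar>x - y\<bar>"
    using iexp_approx1[of "x - y" 0] by simp
  finally show ?thesis .
qed

lemma (in prob_space) char_distr_eq:
  assumes [measurable]: "Z \<in> borel_measurable M"
  shows "char (distr M borel Z) t = (CLINT \<omega>|M. iexp (t * Z \<omega>))"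
  unfolding char_def by (subst integral_distr) auto

lemma (in prob_space) integrable_iexp_mult:
  fixes Z :: "'a \<Rightarrow> real"
  assumes [measurable]: "Z \<in> borel_measurable M"
  shows "integrable M (\<lambda>\<omega>. iexp (t * Z \<omega>))"
  by (intro integrable_const_bound[where B = 1]) auto

lemma (in prob_space) norm_char_diff_le:
  fixes Z W :: "'a \<Rightarrow> real"
  assumes [measurable]: "Z \<in> borel_measurable M" "W \<in> borel_measurable M"
    and "integrable M (\<lambda>\<omega>. (Z \<omega> - W \<omega>)\<^sup>2)" "expectation (\<lambda>\<omega>. (Z \<omega> - W \<omega>)\<^sup>2) \<le> a\<^sup>2" "0 \<le> a"
  shows "cmod (char (distr M borel Z) t - char (distr M borel W) t) \<le> \<bar>t\<bar> * a"
proof -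
  note L1 = abs_expectation_le_L2[of "\<lambda>\<omega>. Z \<omega> - W \<omega>", OF _ assms(3-5)]
  have "char (distr M borel Z) t - char (distr M borel W) t = (CLINT \<omega>|M. iexp (t * Z \<omega>) - iexp (t * W \<omega>))"
    by (subst Bochner_Integration.integral_diff[OF integrable_iexp_mult integrable_iexp_mult])
       (simp_all add: char_distr_eq)
  also have "cmod \<dots> \<le> (\<integral>\<omega>. cmod (iexp (t * Z \<omega>) - iexp (t * W \<omega>)) \<partial>M)"
    by (rule integral_norm_bound)
  also have "\<dots> \<le> (\<integral>\<omega>. \<bar>t\<bar> * \<bar>Z \<omega> - W \<omega>\<bar> \<partial>M)"
  proof (rule integral_mono)
    show "integrable M (\<lambda>\<omega>. cmod (iexp (t * Z \<omega>) - iexp (t * W \<omega>)))"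
      by (intro integrable_norm Bochner_Integration.integrable_diff integrable_iexp_mult) measurable
    show "cmod (iexp (t * Z \<omega>) - iexp (t * W \<omega>)) \<le> \<bar>t\<bar> * \<bar>Z \<omega> - W \<omega>\<bar>" for \<omega>
      using norm_iexp_diff_le[of "t * Z \<omega>" "t * W \<omega>"]
      by (simp only: right_diff_distrib[symmetric] abs_mult)
  qed (use L1(1) in auto)
  also have "\<dots> \<le> \<bar>t\<bar> * a"
    using L1(2) by (simp add: mult_left_mono)
  finally show ?thesis .
qed

text \<open>The classical theorem in terms of characteristic functions, with zero variance
  permitted: there all summands vanish almost surely. Block sums may be degenerate, so this case
  must be covered.\<close>

lemma (in prob_space) iid_char_limit:
  fixes U :: "nat \<Rightarrow> 'a \<Rightarrow> real"
  assumes indep: "indep_vars (\<lambda>_. borel) U UNIV"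
    and mean: "expectation (U 0) = 0" and sq: "integrable M (\<lambda>\<omega>. (U 0 \<omega>)\<^sup>2)"
    and distr: "\<And>n. distr M borel (U n) = distr M borel (U 0)"
  shows "(\<lambda>n. char (distr M borel (\<lambda>\<omega>. (\<Sum>i<n. U i \<omega>) / sqrt (real n))) t)
    \<longlonglongrightarrow> exp (- (expectation (\<lambda>\<omega>. (U 0 \<omega>)\<^sup>2) * t\<^sup>2 / 2))"
proof -
  have [measurable]: "U n \<in> borel_measurable M" for n
    using indep by (auto simp: indep_vars_def2)
  define v where "v = expectation (\<lambda>\<omega>. (U 0 \<omega>)\<^sup>2)"
  have same: "expectation (\<lambda>\<omega>. g (U n \<omega>)) = expectation (\<lambda>\<omega>. g (U 0 \<omega>))"
    if [measurable]: "g \<in> borel_measurable borel" for g :: "real \<Rightarrow> real" and n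
  proof -
    have "expectation (\<lambda>\<omega>. g (U n \<omega>)) = (\<integral>x. g x \<partial>distr M borel (U n))"
      by (rule integral_distr[symmetric]) measurable
    also have "\<dots> = (\<integral>x. g x \<partial>distr M borel (U 0))"
      by (subst distr[of n]) (rule refl)
    also have "\<dots> = expectation (\<lambda>\<omega>. g (U 0 \<omega>))"
      by (rule integral_distr) measurable
    finally show ?thesis .
  qed
  have mean': "expectation (U n) = 0" for n
    using same[of "\<lambda>x. x" n] mean by simp
  have v': "expectation (\<lambda>\<omega>. (U n \<omega>)\<^sup>2) = v" for n
    using same[of "\<lambda>x. x\<^sup>2" n] by (simp add: v_def)
  have sq': "integrable M (\<lambda>\<omega>. (U n \<omega>)\<^sup>2)" for n
  proof -
    have "integrable (distr M borel (U 0)) (\<lambda>x. x\<^sup>2)"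
      using sq by (subst integrable_distr_eq) measurable
    then have "integrable (distr M borel (U n)) (\<lambda>x. x\<^sup>2)"
      by (subst distr[of n])
    then show ?thesis
      by (subst (asm) integrable_distr_eq) measurable
  qed
  have "0 \<le> v" by (simp add: v_def)
  show ?thesis
  proof (cases "v = 0")
    case True
    have "AE \<omega> in M. U n \<omega> = 0" for n
      using integral_nonneg_eq_0_iff_AE[OF sq'[of n]] v'[of n] True by simp
    then have "AE \<omega> in M. \<forall>n. U n \<omega> = 0"
      by (simp add: AE_all_countable)
    have "char (distr M borel (\<lambda>\<omega>. (\<Sum>i<n. U i \<omega>) / sqrt (real n))) t = (CLINT \<omega>|M. 1)" for n
    proof (subst char_distr_eq, measurable, rule integral_cong_AE)
      show "AE \<omega> in M. iexp (t * ((\<Sum>i<n. U i \<omega>) / sqrt (real n))) = 1"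
        using \<open>AE \<omega> in M. \<forall>n. U n \<omega> = 0\<close> by eventually_elim simp
    qed measurable
    then show ?thesis using True by (simp add: prob_space v_def)
  next
    case False
    define \<sigma> where "\<sigma> = sqrt v"
    have \<sigma>: "\<sigma> > 0" "\<sigma>\<^sup>2 = v" using False \<open>0 \<le> v\<close> by (auto simp: \<sigma>_def)
    have "weak_conv_m (\<lambda>n. distr M borel (\<lambda>x. (\<Sum>i<n. U i x) / sqrt (real n * \<sigma>\<^sup>2))) std_normal_distribution"
      by (rule central_limit_theorem_zero_mean[OF indep mean' \<sigma>(1) sq' _ distr])
         (simp add: mean' v' \<sigma>(2))
    then have "(\<lambda>n. char (distr M borel (\<lambda>x. (\<Sum>i<n. U i x) / sqrt (real n * \<sigma>\<^sup>2))) (t * \<sigma>))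
        \<longlonglongrightarrow> char std_normal_distribution (t * \<sigma>)"
      by (intro levy_continuity1) (auto intro: real_dist_normal_dist real_distribution_distr)
    moreover have "char (distr M borel (\<lambda>x. (\<Sum>i<n. U i x) / sqrt (real n * \<sigma>\<^sup>2))) (t * \<sigma>)
        = char (distr M borel (\<lambda>\<omega>. (\<Sum>i<n. U i \<omega>) / sqrt (real n))) t" for n
      using \<sigma>(1) by (simp add: char_distr_eq real_sqrt_mult)
    moreover have "char std_normal_distribution (t * \<sigma>) = exp (- (v * t\<^sup>2 / 2))"
      by (simp add: char_std_normal_distribution power_mult_distrib \<sigma>(2) mult.commute)
    ultimately show ?thesis by (simp add: v_def)
  qed
qed

lemma cesaro_tendsto_0:
  fixes V :: "nat \<Rightarrow> real"
  assumes V: "V \<longlonglongrightarrow> 0" and pos: "\<And>n. 0 \<le> V n"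
  shows "(\<lambda>n. (\<Sum>r<n. V r) / real n) \<longlonglongrightarrow> 0"
proof (rule LIMSEQ_I)
  fix \<epsilon> :: real assume \<epsilon>: "\<epsilon> > 0"
  then obtain n0 where n0: "V n < \<epsilon> / 2" if "n \<ge> n0" for n
    using LIMSEQ_D[OF V, of "\<epsilon> / 2"] pos by auto
  define B where "B = (\<Sum>r<n0. V r)"
  have "0 \<le> B" unfolding B_def by (intro sum_nonneg pos)
  obtain n1 :: nat where n1: "2 * B / \<epsilon> < real n1" using reals_Archimedean2 by blast
  show "\<exists>no. \<forall>n\<ge>no. norm ((\<Sum>r<n. V r) / real n - 0) < \<epsilon>"
  proof (intro exI allI impI)
    fix n assume n: "n \<ge> max (Suc n0) n1"
    then have npos: "real n > 0" by simp
    have "(\<Sum>r<n. V r) = B + (\<Sum>r=n0..<n. V r)"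
      unfolding B_def using n by (simp add: sum.atLeastLessThan_concat[of 0 n0 n, symmetric] lessThan_atLeast0)
    also have "(\<Sum>r=n0..<n. V r) \<le> (\<Sum>r=n0..<n. \<epsilon> / 2)"
      by (intro sum_mono less_imp_le[OF n0]) simp
    also have "\<dots> \<le> real n * (\<epsilon> / 2)"
      using \<epsilon> by (simp add: mult_right_mono)
    also have "B < real n * (\<epsilon> / 2)"
    proof -
      have "2 * B / \<epsilon> < real n" using n1 n by linarith
      then show ?thesis using \<epsilon> by (simp add: field_simps)
    qed
    finally have "(\<Sum>r<n. V r) < \<epsilon> * real n" by (simp add: algebra_simps)
    then show "norm ((\<Sum>r<n. V r) / real n - 0) < \<epsilon>"
      using npos sum_nonneg[of "{..<n}" V] pos by (simp add: pos_divide_less_eq)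
  qed
qed

context causal_sequence
begin

text \<open>Averaging each term of a block over all innovations outside that block makes the block sums
  independent without leaving gaps between the blocks.\<close>

definition block :: "nat \<Rightarrow> nat \<Rightarrow> int set" where
  "block l q = {int (q * l)<..int (q * l + l)}"

text \<open>Term \<open>m\<close> sits at time \<open>m + 1\<close>, so for \<open>0 < l\<close> the
  terms with \<open>m div l = q\<close> are exactly those whose time lies in
  \<open>block l q\<close>; the latest innovation of a term always belongs to its own block.\<close>

definition Y_block :: "(real \<Rightarrow> real) \<Rightarrow> nat \<Rightarrow> nat \<Rightarrow> (int \<Rightarrow> 'c) \<Rightarrow> real" where
  "Y_block h l m = avg (block l (m div l)) (Y h m)"

definition block_sum :: "(real \<Rightarrow> real) \<Rightarrow> nat \<Rightarrow> nat \<Rightarrow> (int \<Rightarrow> 'c) \<Rightarrow> real" where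
  "block_sum h l q \<omega> = (\<Sum>m\<in>{q * l..<q * l + l}. Y_block h l m \<omega>)"

context
  fixes L K :: real and h :: "real \<Rightarrow> real"
  assumes obs: "observable L K h" and centered: "\<And>m. P.expectation (Y h m) = 0"
begin

private lemmas [measurable] = measurable_Y[OF obs]

lemma measurable_Y_block [measurable]: "Y_block h l m \<in> borel_measurable P"
  unfolding Y_block_def by measurable

lemma measurable_block_sum [measurable]: "block_sum h l q \<in> borel_measurable P"
  unfolding block_sum_def[abs_def] by measurable

lemma abs_Y_block_le: "\<bar>Y_block h l m \<omega>\<bar> \<le> K"
  unfolding Y_block_def by (rule abs_avg_le[OF abs_Y_le[OF obs]])

lemma abs_block_sum_le: "\<bar>block_sum h l q \<omega>\<bar> \<le> real l * K"
  unfolding block_sum_def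
  using order_trans[OF sum_abs sum_mono[of "{q * l..<q * l + l}" "\<lambda>m. \<bar>Y_block h l m \<omega>\<bar>" "\<lambda>_. K"]] abs_Y_block_le
  by simp

lemma Y_block_cong:
  assumes "\<And>k. k \<in> block l (m div l) \<Longrightarrow> k \<le> int m + 1 \<Longrightarrow> \<omega> k = \<omega>' k"
  shows "Y_block h l m \<omega> = Y_block h l m \<omega>'"
  unfolding Y_block_def
  by (rule avg_cong[where B = "{..int m + 1}"]) (use assms in \<open>auto intro!: Y_cong[OF obs]\<close>)

lemma expectation_Y_block: "P.expectation (Y_block h l m) = 0"
  unfolding Y_block_def using integral_avg[of "Y h m" K] abs_Y_le[OF obs] centered by simp

lemma expectation_block_sum: "P.expectation (block_sum h l q) = 0"
proof -
  have "integrable P (Y_block h l m)" for m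
    by (rule integrable_bounded_P[OF _ abs_Y_block_le]) measurable
  then show ?thesis
    by (simp add: block_sum_def[abs_def] expectation_Y_block)
qed

lemma block_sum_eq_shift:
  assumes \<omega>: "\<omega> \<in> space P" and l: "0 < l"
  shows "block_sum h l q \<omega> = block_sum h l 0 (shift (int (q * l)) \<omega>)"
proof -
  have "Y_block h l (m + q * l) \<omega> = Y_block h l m (shift (int (q * l)) \<omega>)" if "m < l" for m
  proof -
    have d: "(m + q * l) div l = q" "m div l = 0" using that l by auto
    have "Y h (m + q * l) = (\<lambda>\<omega>. Y h m (shift (int (q * l)) \<omega>))"
      by (simp add: fun_eq_iff Y_shift[OF obs] del: of_nat_mult)
    then have "Y_block h l (m + q * l) \<omega> = avg (block l q) (\<lambda>\<omega>. Y h m (shift (int (q * l)) \<omega>)) \<omega>"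
      by (simp only: Y_block_def d)
    also have "\<dots> = avg {k. k + int (q * l) \<in> block l q} (Y h m) (shift (int (q * l)) \<omega>)"
      by (rule avg_shift[OF _ \<omega>]) measurable
    also have "{k. k + int (q * l) \<in> block l q} = block l 0"
      by (auto simp: block_def)
    finally show ?thesis by (simp only: Y_block_def d)
  qed
  then have "(\<Sum>m\<in>{0..<l}. Y_block h l (m + q * l) \<omega>) = block_sum h l 0 (shift (int (q * l)) \<omega>)"
    by (simp add: block_sum_def del: of_nat_mult)
  then show ?thesis
    using sum.shift_bounds_nat_ivl[of "\<lambda>m. Y_block h l m \<omega>" 0 "q * l" l]
    by (simp add: block_sum_def add.commute)
qed

lemma distr_block_sum:
  assumes l: "0 < l"
  shows "distr P borel (block_sum h l q) = distr P borel (block_sum h l 0)"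
proof -
  have "distr P borel (block_sum h l q) = distr P borel (\<lambda>\<omega>. block_sum h l 0 (shift (int (q * l)) \<omega>))"
    by (intro distr_cong refl block_sum_eq_shift l)
  also have "\<dots> = distr (distr P P (shift (int (q * l)))) borel (block_sum h l 0)"
    by (subst distr_distr) (auto simp: comp_def)
  finally show ?thesis by (simp only: distr_shift)
qed

lemma indep_coordinates: "P.indep_vars (\<lambda>_. D) (\<lambda>k \<omega>. \<omega> k) UNIV"
proof (subst P.indep_vars_iff_distr_eq_PiM)
  have "distr P D (\<lambda>\<omega>. \<omega> k) = D" for k
    unfolding P_def by (rule distr_PiM_component) (auto intro: D.prob_space_axioms)
  moreover have "distr P (PiM UNIV (\<lambda>_. D)) (\<lambda>\<omega>. \<lambda>k\<in>UNIV. \<omega> k) = P"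
    by (simp add: restrict_def P_def[symmetric])
  ultimately show "distr P (PiM UNIV (\<lambda>_. D)) (\<lambda>\<omega>. \<lambda>k\<in>UNIV. \<omega> k) = PiM UNIV (\<lambda>k. distr P D (\<lambda>\<omega>. \<omega> k))"
    by (simp only: P_def[symmetric])
qed (auto simp: measurable_coordinate)

text \<open>Disjoint blocks of coordinates are independent, and \<open>u\<close> exhibits the block
  sum as a measurable function of the restriction to its block: the second argument of
  \<open>mix\<close> supplies the missing coordinates and is integrated out.\<close>

lemma indep_block_sum:
  assumes l: "0 < l"
  shows "P.indep_vars (\<lambda>_. borel) (block_sum h l) UNIV"
proof -
  have disj: "disjoint_family (block l)"
    unfolding disjoint_family_on_def
  proof (intro ballI impI)
    have less: "block l q \<inter> block l q' = {}" if "q < q'" for q q'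
    proof -
      have "q * l + l \<le> q' * l" using that mult_le_mono1[of "Suc q" q' l] by simp
      then have "int (q * l + l) \<le> int (q' * l)" by (simp only: of_nat_le_iff)
      then show ?thesis unfolding block_def by (auto simp del: of_nat_mult of_nat_add)
    qed
    show "block l q \<inter> block l q' = {}" if "q \<noteq> q'" for q q'
      using that less[of q q'] less[of q' q] by (cases q q' rule: linorder_cases) auto
  qed
  define u where "u q x = (\<Sum>m\<in>{q * l..<q * l + l}. \<integral>\<omega>'. Y h m (mix (block l q) x \<omega>') \<partial>P)" for q and x :: "int \<Rightarrow> 'c"
  have "P.indep_vars (\<lambda>q. PiM (block l q) (\<lambda>_. D)) (\<lambda>q \<omega>. restrict (\<lambda>k. \<omega> k) (block l q)) UNIV"
    by (rule P.indep_vars_restrict[OF indep_coordinates]) (use disj in auto)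
  then have "P.indep_vars (\<lambda>_. borel) (\<lambda>q \<omega>. u q (restrict (\<lambda>k. \<omega> k) (block l q))) UNIV"
  proof (rule P.indep_vars_compose2)
    fix q
    have "(\<lambda>z. mix (block l q) (fst z) (snd z)) \<in> PiM (block l q) (\<lambda>_. D) \<Otimes>\<^sub>M P \<rightarrow>\<^sub>M P"
    proof (rule measurable_into_P)
      show "(\<lambda>z. mix (block l q) (fst z) (snd z) k) \<in> PiM (block l q) (\<lambda>_. D) \<Otimes>\<^sub>M P \<rightarrow>\<^sub>M D" for k
        by (cases "k \<in> block l q") (simp_all add: mix_apply)
    qed
    then have [measurable]: "(\<lambda>z. Y h m (mix (block l q) (fst z) (snd z))) \<in> borel_measurable (PiM (block l q) (\<lambda>_. D) \<Otimes>\<^sub>M P)" for m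
      by measurable
    show "u q \<in> borel_measurable (PiM (block l q) (\<lambda>_. D))"
      unfolding u_def by (intro borel_measurable_sum P.borel_measurable_lebesgue_integral) (simp add: split_beta')
  qed
  moreover have "u q (restrict (\<lambda>k. \<omega> k) (block l q)) = block_sum h l q \<omega>" for q \<omega>
    unfolding u_def block_sum_def Y_block_def avg_def
  proof (intro sum.cong refl)
    fix m assume "m \<in> {q * l..<q * l + l}"
    then have "m div l = q" using l by (auto simp: div_nat_eqI mult.commute)
    moreover have "mix (block l q) (restrict (\<lambda>k. \<omega> k) (block l q)) \<omega>' = mix (block l q) \<omega> \<omega>'" for \<omega>'
      by (auto simp: mix_def)
    ultimately show "(\<integral>\<omega>'. Y h m (mix (block l q) (restrict (\<lambda>k. \<omega> k) (block l q)) \<omega>') \<partial>P)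
      = (\<integral>\<omega>'. Y h m (mix (block l (m div l)) \<omega> \<omega>') \<partial>P)" by simp
  qed
  ultimately show ?thesis by simp
qed

end


text \<open>A bound for the mean squared replacement error per observation. A term at position
  \<open>r\<close> of its block has \<open>r + 1\<close> innovations of that block behind it, hence
  \<open>gap (Suc r)\<close>. Terms near the start of a block are badly approximated, yet the Cesaro
  mean over \<open>r\<close> vanishes as \<open>l\<close> grows.\<close>

definition block_error :: "real \<Rightarrow> nat \<Rightarrow> real" where
  "block_error L l = 2 * L\<^sup>2 * suminf c * (\<Sum>r<l. \<Sum>i. min (c i) (sqrt (gap (Suc r)))) / real l"

lemma summable_min_c: "summable (\<lambda>i. min (c i) x)" if "0 \<le> x"
  by (rule summable_comparison_test[OF _ summable_c]) (use that c_nonneg in \<open>auto intro!: exI[of _ 0]\<close>)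

lemma suminf_min_c_nonneg: "0 \<le> (\<Sum>i. min (c i) x)" if "0 \<le> x"
  by (rule suminf_nonneg[OF summable_min_c[OF that]]) (use that c_nonneg in auto)

lemma suminf_c_nonneg: "0 \<le> suminf c"
  by (rule suminf_nonneg[OF summable_c c_nonneg])

lemma block_error_nonneg: "0 \<le> block_error L l"
  unfolding block_error_def
  by (intro divide_nonneg_nonneg mult_nonneg_nonneg sum_nonneg suminf_min_c_nonneg suminf_c_nonneg)
     (auto intro: gap_nonneg)

lemma block_error_tendsto: "block_error L \<longlonglongrightarrow> 0"
proof -
  have "(\<lambda>r. sqrt (gap (Suc r))) \<longlonglongrightarrow> sqrt 0"
    by (intro tendsto_real_sqrt LIMSEQ_Suc gap_tendsto)
  then have "(\<lambda>r. \<Sum>i. min (c i) (sqrt (gap (Suc r)))) \<longlonglongrightarrow> 0"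
    by (intro tendsto_suminf_min summable_c c_nonneg) (auto simp: gap_nonneg)
  then have "(\<lambda>l. (\<Sum>r<l. \<Sum>i. min (c i) (sqrt (gap (Suc r)))) / real l) \<longlonglongrightarrow> 0"
    by (rule cesaro_tendsto_0) (simp add: suminf_min_c_nonneg gap_nonneg)
  from tendsto_mult_right_zero[OF this, of "2 * L\<^sup>2 * suminf c"] show ?thesis
    by (simp add: block_error_def[abs_def] mult.assoc)
qed

context
  fixes L K :: real and h :: "real \<Rightarrow> real"
  assumes obs: "observable L K h" and centered: "\<And>m. P.expectation (Y h m) = 0"
begin

private lemmas [measurable] = measurable_Y[OF obs] measurable_Y_block[OF obs centered] measurable_block_sum[OF obs centered]

lemma L_nonneg: "0 \<le> L" and K_nonneg: "0 \<le> K"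
  using observableD(2)[OF obs] order_trans[OF abs_ge_zero observableD(3)[OF obs]] by auto

text \<open>A term does not look beyond its own time, which is still inside the block, so averaging
  outside the block in effect refreshes only the innovations up to the start of the block.\<close>

lemma L2_minus_Y_block:
  assumes l: "0 < l"
  shows "P.expectation (\<lambda>\<omega>. (Y h m \<omega> - Y_block h l m \<omega>)\<^sup>2) \<le> (L * sqrt (gap (Suc (m mod l))))\<^sup>2"
proof -
  let ?j = "int (m div l * l)"
  have m: "m = m div l * l + m mod l" by simp
  have le: "m div l * l \<le> m" "m + 1 \<le> m div l * l + l"
    using m mod_less_divisor[OF l, of m] by linarith+
  have eq: "Y h m (mix (block l (m div l)) \<omega> \<omega>') = Y h m (mix {?j<..} \<omega> \<omega>')" for \<omega> \<omega>'
  proof (rule Y_cong[OF obs])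
    fix k assume "k \<le> int m + 1"
    moreover have "int m + 1 \<le> int (m div l * l + l)" using le(2) by linarith
    ultimately show "mix (block l (m div l)) \<omega> \<omega>' k = mix {?j<..} \<omega> \<omega>' k"
      unfolding mix_apply block_def by auto
  qed
  have "P.expectation (\<lambda>\<omega>. (Y h m \<omega> - Y_block h l m \<omega>)\<^sup>2)
      \<le> (\<integral>z. (Y h m (fst z) - Y h m (mix (block l (m div l)) (fst z) (snd z)))\<^sup>2 \<partial>PP)"
    unfolding Y_block_def by (rule L2_minus_avg_le[OF _ abs_Y_le[OF obs]]) measurable
  also have "\<dots> \<le> L\<^sup>2 * gap (nat (int m + 1 - ?j))"
    unfolding eq by (rule Y_forgetting_square[OF obs]) (use le in linarith)
  also have "nat (int m + 1 - ?j) = Suc (m mod l)"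
    using m by linarith
  finally show ?thesis by (simp add: power_mult_distrib gap_nonneg)
qed

text \<open>The variance bound is applied to the differences \<open>Z\<close>. Their influence at
  lag \<open>i\<close> is at most the square of \<open>2 * L * c i\<close>, since averaging does not
  increase influences, and also that of \<open>2 * L * sqrt (gap (Suc (m mod l)))\<close>, by their
  norm. Summing the minimum over a period of length \<open>l\<close> gives
  \<open>block_error\<close>.\<close>

lemma L2_block_error:
  assumes l: "0 < l"
  shows "P.expectation (\<lambda>\<omega>. ((\<Sum>m<N * l. Y h m \<omega>) - (\<Sum>q<N. block_sum h l q \<omega>))\<^sup>2)
    \<le> real (N * l) * block_error L l"
proof -
  define Z where "Z m \<omega> = Y h m \<omega> - Y_block h l m \<omega>" for m \<omega>
  define w where "w r = (\<Sum>i. min (c i) (sqrt (gap (Suc r))))" for r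
  have [measurable]: "Z m \<in> borel_measurable P" for m
    unfolding Z_def by measurable
  have Z_le: "\<bar>Z m \<omega>\<bar> \<le> 2 * K" for m \<omega>
    using abs_Y_le[OF obs, of m \<omega>] abs_Y_block_le[OF obs centered, of l m \<omega>] unfolding Z_def by linarith
  \<comment> \<open>All blocks consist of positive times, so refreshing the innovations up to
    \<open>- int J\<close> does not touch the averaged terms, and the tail condition for
    \<open>Z\<close> reduces to that for \<open>Y\<close>.\<close>
  have Yb: "Y_block h l m \<omega> = Y_block h l m \<omega>'" if "\<And>k. 0 < k \<Longrightarrow> k \<le> int m + 1 \<Longrightarrow> \<omega> k = \<omega>' k" for m \<omega> \<omega>'
  proof (rule Y_block_cong[OF obs centered], rule that)
    fix k assume "k \<in> block l (m div l)"
    then have "int (m div l * l) < k"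
      by (simp add: block_def del: of_nat_mult of_nat_add)
    then show "0 < k" using of_nat_0_le_iff[of "m div l * l"] by (rule le_less_trans[rotated])
  qed
  have "P.variance (\<lambda>\<omega>. \<Sum>m<N * l. Z m \<omega>)
      \<le> suminf (\<lambda>i. 2 * L * c i) * (\<Sum>m<N * l. 2 * L * w (m mod l)) / 2"
  proof (rule variance_sum_le[where d = "\<lambda>m i. 2 * L * min (c i) (sqrt (gap (Suc (m mod l))))"])
    show "\<bar>Z m \<omega>\<bar> \<le> 2 * K" for m \<omega> by (rule Z_le)
    show "Z m \<omega> = Z m \<omega>'" if "\<And>k. k \<le> int m + 1 \<Longrightarrow> \<omega> k = \<omega>' k" for m \<omega> \<omega>'
      using Y_cong[OF obs, of m \<omega> \<omega>'] Yb[of m \<omega> \<omega>'] that by (simp add: Z_def)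
    show "(\<lambda>J::nat. \<integral>z. \<bar>Z m (snd z) - Z m (mix {..- int J} (fst z) (snd z))\<bar> \<partial>PP) \<longlonglongrightarrow> 0" for m
    proof -
      have "Y_block h l m (mix {..- int J} \<omega> \<omega>') = Y_block h l m \<omega>'" for J \<omega> \<omega>'
        by (rule Yb) (auto simp: mix_apply)
      then show ?thesis using Y_tail[OF obs, of m] by (simp add: Z_def)
    qed
    show "influence (int m + 1 - int i) (Z m) \<le> (2 * L * min (c i) (sqrt (gap (Suc (m mod l)))))\<^sup>2" for m i
    proof -
      let ?j = "int m + 1 - int i"
      have "influence ?j (Y_block h l m) \<le> influence ?j (Y h m)"
        unfolding Y_block_def by (rule influence_avg_le[OF _ abs_Y_le[OF obs]]) measurable
      then have "influence ?j (Z m) \<le> (L * c i + L * c i)\<^sup>2"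
        unfolding Z_def
        using influence_Y[OF obs, of m i]
          abs_Y_le[OF obs] abs_Y_block_le[OF obs centered] mult_nonneg_nonneg[OF L_nonneg c_nonneg[of i]]
        by (intro influence_diff_le[where K = K, OF measurable_Y[OF obs] measurable_Y_block[OF obs centered]])
           auto
      moreover have "influence ?j (Z m) \<le> (L * sqrt (gap (Suc (m mod l))) + L * sqrt (gap (Suc (m mod l))))\<^sup>2"
        using L2_minus_Y_block[OF l, of m]
        by (intro influence_le_L2[OF _ Z_le]) (auto simp: Z_def intro!: mult_nonneg_nonneg L_nonneg gap_nonneg)
      ultimately show ?thesis by (auto simp: min_def power_mult_distrib)
    qed
    show "0 \<le> 2 * L * min (c i) (sqrt (gap (Suc (m mod l))))" for m i
      using L_nonneg c_nonneg[of i] gap_nonneg[of "Suc (m mod l)"] by simp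
    show "2 * L * min (c i) (sqrt (gap (Suc (m mod l)))) \<le> 2 * L * c i" for m i
      using L_nonneg by (intro mult_left_mono) auto
    show "summable (\<lambda>i. 2 * L * c i)" using summable_c by simp
    show "(\<Sum>i. 2 * L * min (c i) (sqrt (gap (Suc (m mod l))))) \<le> 2 * L * w (m mod l)" for m
      by (subst suminf_mult) (auto simp: w_def intro!: summable_min_c gap_nonneg)
  qed measurable
  also have "(\<Sum>m<N * l. 2 * L * w (m mod l)) = real N * (2 * L * (\<Sum>r<l. w r))"
  proof -
    have "(\<Sum>m\<in>{q * l..<q * l + l}. 2 * L * w (m mod l)) = 2 * L * (\<Sum>r<l. w r)" for q
      using sum.shift_bounds_nat_ivl[of "\<lambda>m. 2 * L * w (m mod l)" 0 "q * l" l]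
      by (simp add: add.commute sum_distrib_left lessThan_atLeast0)
    then show ?thesis
      by (simp add: sum.nat_group[symmetric])
  qed
  also have "suminf (\<lambda>i. 2 * L * c i) = 2 * L * suminf c"
    by (rule suminf_mult[OF summable_c])
  also have "2 * L * suminf c * (real N * (2 * L * (\<Sum>r<l. w r))) / 2 = real (N * l) * block_error L l"
    using l by (simp add: block_error_def w_def power2_eq_square)
  finally have "P.variance (\<lambda>\<omega>. \<Sum>m<N * l. Z m \<omega>) \<le> real (N * l) * block_error L l" .
  moreover have "P.expectation (\<lambda>\<omega>. \<Sum>m<N * l. Z m \<omega>) = 0"
  proof -
    have i: "integrable P (Y h m)" "integrable P (Y_block h l m)" for m
      by (auto intro!: integrable_bounded_P[OF _ abs_Y_le[OF obs]]
          integrable_bounded_P[OF _ abs_Y_block_le[OF obs centered]])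
    then show ?thesis
      by (simp add: Z_def centered expectation_Y_block[OF obs centered])
  qed
  moreover have "(\<Sum>m<N * l. Z m \<omega>) = (\<Sum>m<N * l. Y h m \<omega>) - (\<Sum>q<N. block_sum h l q \<omega>)" for \<omega>
    unfolding Z_def block_sum_def by (simp add: sum_subtractf sum.nat_group)
  ultimately show ?thesis by simp
qed

lemma second_moment_sum_le:
  "P.expectation (\<lambda>\<omega>. (\<Sum>m<n. Y h m \<omega>)\<^sup>2) \<le> real n * (L * suminf c)\<^sup>2"
proof -
  have "P.variance (\<lambda>\<omega>. \<Sum>m<n. Y h m \<omega>) \<le> L * suminf c * (real n * (\<Sum>i. min (L * c i) L)) / 2"
  proof (rule variance_sum_Y_le[OF obs L_nonneg])
    show "\<bar>h x - h y\<bar> \<le> L" for x y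
      using observableD(4)[OF obs, of x y] mult_left_mono[OF min.cobounded1[of 1 "\<bar>x - y\<bar>"] L_nonneg] by simp
  qed
  also have "\<dots> \<le> L * suminf c * (real n * (L * suminf c)) / 2"
  proof -
    have "(\<Sum>i. min (L * c i) L) \<le> (\<Sum>i. L * c i)"
    proof (rule suminf_le)
      show "summable (\<lambda>i. L * c i)" using summable_c by simp
      then show "summable (\<lambda>i. min (L * c i) L)"
        by (rule summable_comparison_test[rotated]) (auto intro!: exI[of _ 0] simp: L_nonneg c_nonneg)
    qed simp
    also have "\<dots> = L * suminf c" by (rule suminf_mult[OF summable_c])
    finally show ?thesis
      by (intro divide_right_mono mult_left_mono mult_nonneg_nonneg L_nonneg suminf_c_nonneg) auto
  qed
  also have "\<dots> = real n * (L * suminf c)\<^sup>2 / 2"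
    by (simp add: power2_eq_square)
  also have "\<dots> \<le> real n * (L * suminf c)\<^sup>2"
    by simp
  finally have "P.variance (\<lambda>\<omega>. \<Sum>m<n. Y h m \<omega>) \<le> real n * (L * suminf c)\<^sup>2" .
  moreover have "P.expectation (\<lambda>\<omega>. \<Sum>m<n. Y h m \<omega>) = 0"
  proof -
    have "integrable P (Y h m)" for m
      by (rule integrable_bounded_P[OF _ abs_Y_le[OF obs]]) measurable
    then show ?thesis by (simp add: centered)
  qed
  ultimately show ?thesis by simp
qed


lemma abs_sum_Y_le: "\<bar>\<Sum>m\<in>A. Y h m \<omega>\<bar> \<le> real (card A) * K"
  using order_trans[OF sum_abs sum_mono[of A "\<lambda>m. \<bar>Y h m \<omega>\<bar>" "\<lambda>_. K"]] abs_Y_le[OF obs]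
  by simp

lemma abs_sum_block_sum_le: "\<bar>\<Sum>q<N. block_sum h l q \<omega>\<bar> \<le> real N * (real l * K)"
  using order_trans[OF sum_abs sum_mono[of "{..<N}" "\<lambda>q. \<bar>block_sum h l q \<omega>\<bar>" "\<lambda>_. real l * K"]]
    abs_block_sum_le[OF obs centered]
  by simp

text \<open>The right-hand side stays bounded in \<open>l\<close>, because
  \<open>block_error\<close> tends to 0. This is the compactness from which the limiting variance is
  extracted.\<close>

lemma second_moment_block_sum_le:
  assumes l: "0 < l"
  shows "P.expectation (\<lambda>\<omega>. (block_sum h l 0 \<omega>)\<^sup>2) / real l \<le> (L * suminf c + sqrt (block_error L l))\<^sup>2"
proof -
  let ?S = "\<lambda>\<omega>. \<Sum>m<l. Y h m \<omega>"
  have i: "integrable P (\<lambda>\<omega>. (?S \<omega>)\<^sup>2)"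
    by (rule integrable_bounded_square_P[OF _ abs_sum_Y_le]) measurable
  have bnd: "\<bar>block_sum h l 0 \<omega> - ?S \<omega>\<bar> \<le> real l * K + real (card {..<l}) * K" for \<omega>
    using abs_sum_Y_le[of \<omega> "{..<l}"] abs_block_sum_le[OF obs centered, of l 0 \<omega>] by linarith
  have i': "integrable P (\<lambda>\<omega>. (block_sum h l 0 \<omega> - ?S \<omega>)\<^sup>2)"
    by (rule integrable_bounded_square_P[OF _ bnd]) measurable
  have le: "P.expectation (\<lambda>\<omega>. (?S \<omega> + (block_sum h l 0 \<omega> - ?S \<omega>))\<^sup>2)
      \<le> (sqrt (real l) * (L * suminf c) + sqrt (real l) * sqrt (block_error L l))\<^sup>2"
  proof (rule L2_triangle(2)[OF _ _ i _ _ i'])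
    show "P.expectation (\<lambda>\<omega>. (?S \<omega>)\<^sup>2) \<le> (sqrt (real l) * (L * suminf c))\<^sup>2"
      using second_moment_sum_le[of l] by (simp add: power_mult_distrib)
    have "P.expectation (\<lambda>\<omega>. (block_sum h l 0 \<omega> - ?S \<omega>)\<^sup>2) \<le> real l * block_error L l"
      using L2_block_error[OF l, of 1] by (simp add: power2_commute)
    then show "P.expectation (\<lambda>\<omega>. (block_sum h l 0 \<omega> - ?S \<omega>)\<^sup>2) \<le> (sqrt (real l) * sqrt (block_error L l))\<^sup>2"
      by (simp add: power_mult_distrib block_error_nonneg)
    show "0 \<le> sqrt (real l) * (L * suminf c)"
      by (intro mult_nonneg_nonneg L_nonneg suminf_c_nonneg) simp
    show "0 \<le> sqrt (real l) * sqrt (block_error L l)"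
      by (simp add: block_error_nonneg)
  qed measurable
  also have "\<dots> = real l * (L * suminf c + sqrt (block_error L l))\<^sup>2"
    by (simp add: distrib_left[symmetric] power_mult_distrib)
  finally show ?thesis using l by (simp add: field_simps)
qed

text \<open>Three errors: the incomplete last block, the normalisation by \<open>n\<close> instead
  of \<open>N * l\<close>, and the replacement by block averages. For fixed \<open>l\<close> the
  first two vanish as \<open>n\<close> grows, and the third does not depend on
  \<open>n\<close>.\<close>

lemma L2_sum_minus_blocks:
  assumes l: "0 < l" and n: "l \<le> n"
  defines "N \<equiv> n div l"
  shows "P.expectation (\<lambda>\<omega>. ((\<Sum>m<n. Y h m \<omega>) / sqrt (real n) - (\<Sum>q<N. block_sum h l q \<omega>) / sqrt (real (N * l)))\<^sup>2)
    \<le> (real l * K / sqrt (real n) + L * suminf c * (real l / real n) + sqrt (block_error L l))\<^sup>2"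
proof -
  have N: "0 < N" using l n by (simp add: N_def div_greater_zero_iff)
  have n0: "0 < n" and Nl: "N * l \<le> n" "n \<le> N * l + l" "0 < N * l"
    using N l n div_mult_mod_eq[of n l] mod_less_divisor[OF l, of n] unfolding N_def by linarith+
  define s where "s = sqrt (real n)"
  define s' where "s' = sqrt (real (N * l))"
  have s: "0 < s" "0 < s'" "s' \<le> s" "s\<^sup>2 = real n" "s'\<^sup>2 = real (N * l)"
    using n0 Nl by (simp_all add: s_def s'_def del: of_nat_mult nat_0_less_mult_iff)
  define S where "S k \<omega> = (\<Sum>m<k. Y h m \<omega>)" for k \<omega>
  define B where "B \<omega> = (\<Sum>q<N. block_sum h l q \<omega>)" for \<omega>
  have [measurable]: "S k \<in> borel_measurable P" "B \<in> borel_measurable P" for k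
    unfolding S_def[abs_def] B_def[abs_def] by measurable
  have S_le: "\<bar>S k \<omega>\<bar> \<le> real k * K" for k \<omega>
    using abs_sum_Y_le[of \<omega> "{..<k}"] by (simp add: S_def)
  have B_le: "\<bar>B \<omega>\<bar> \<le> real N * (real l * K)" for \<omega>
    unfolding B_def by (rule abs_sum_block_sum_le)
  define f1 where "f1 \<omega> = (S n \<omega> - S (N * l) \<omega>) / s" for \<omega>
  define f2 where "f2 \<omega> = (1 / s - 1 / s') * S (N * l) \<omega>" for \<omega>
  define f3 where "f3 \<omega> = (S (N * l) \<omega> - B \<omega>) / s'" for \<omega>
  have [measurable]: "f1 \<in> borel_measurable P" "f2 \<in> borel_measurable P" "f3 \<in> borel_measurable P"
    unfolding f1_def[abs_def] f2_def[abs_def] f3_def[abs_def] by measurable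
  have b1: "\<bar>f1 \<omega>\<bar> \<le> real l * K / s" for \<omega>
  proof -
    have "{..<n} = {..<N * l} \<union> {N * l..<n}" using Nl by auto
    then have "S n \<omega> = S (N * l) \<omega> + (\<Sum>m\<in>{N * l..<n}. Y h m \<omega>)"
      by (simp add: S_def sum.union_disjoint ivl_disj_int del: sum.nat_group)
    then have "\<bar>S n \<omega> - S (N * l) \<omega>\<bar> \<le> real (n - N * l) * K"
      using abs_sum_Y_le[of \<omega> "{N * l..<n}"] by simp
    also have "\<dots> \<le> real l * K"
      using Nl by (intro mult_right_mono K_nonneg) linarith
    finally show ?thesis using s by (simp add: f1_def divide_right_mono)
  qed
  have i1: "integrable P (\<lambda>\<omega>. (f1 \<omega>)\<^sup>2)"
    by (rule integrable_bounded_square_P[OF _ b1]) measurable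
  have e1: "P.expectation (\<lambda>\<omega>. (f1 \<omega>)\<^sup>2) \<le> (real l * K / s)\<^sup>2"
  proof -
    have "P.expectation (\<lambda>\<omega>. (f1 \<omega>)\<^sup>2) \<le> P.expectation (\<lambda>\<omega>. (real l * K / s)\<^sup>2)"
      using power_mono[OF b1 abs_ge_zero, of _ 2] by (intro integral_mono i1) auto
    then show ?thesis by (simp add: P.prob_space)
  qed
  have iS: "integrable P (\<lambda>\<omega>. (S k \<omega>)\<^sup>2)" for k
    by (rule integrable_bounded_square_P[OF _ S_le]) measurable
  have i2: "integrable P (\<lambda>\<omega>. (f2 \<omega>)\<^sup>2)"
    unfolding f2_def power_mult_distrib by (intro integrable_mult_right iS)
  have e2: "P.expectation (\<lambda>\<omega>. (f2 \<omega>)\<^sup>2) \<le> (L * suminf c * (real l / real n))\<^sup>2"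
  proof -
    have "P.expectation (\<lambda>\<omega>. (f2 \<omega>)\<^sup>2) = (1 / s - 1 / s')\<^sup>2 * P.expectation (\<lambda>\<omega>. (S (N * l) \<omega>)\<^sup>2)"
      unfolding f2_def power_mult_distrib by simp
    also have "\<dots> \<le> (1 / s - 1 / s')\<^sup>2 * (s'\<^sup>2 * (L * suminf c)\<^sup>2)"
      unfolding s(5) S_def by (intro mult_left_mono second_moment_sum_le) simp
    also have "\<dots> = (L * suminf c * (1 - s' / s))\<^sup>2"
    proof -
      have "(1 / s - 1 / s') * s' = - (1 - s' / s)" using s by (simp add: field_simps)
      then have "((1 / s - 1 / s') * s')\<^sup>2 = (1 - s' / s)\<^sup>2" by (simp only: power2_minus)
      moreover have "(1 / s - 1 / s')\<^sup>2 * (s'\<^sup>2 * (L * suminf c)\<^sup>2) = (L * suminf c)\<^sup>2 * ((1 / s - 1 / s') * s')\<^sup>2"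
        by (simp add: power_mult_distrib)
      ultimately show ?thesis by (simp only: power_mult_distrib)
    qed
    also have "\<dots> \<le> (L * suminf c * (real l / real n))\<^sup>2"
    proof (intro power_mono mult_left_mono mult_nonneg_nonneg L_nonneg suminf_c_nonneg)
      have r: "0 \<le> s' / s" "s' / s \<le> 1" using s by simp_all
      \<comment> \<open>A number in [0, 1] is at least its square, so \<open>1 - s' / s\<close> is
        at most \<open>1 - N * l / n\<close>, which is free of roots.\<close>
      have "(s' / s)\<^sup>2 \<le> s' / s" using power_decreasing[of 1 2 "s' / s"] r by simp
      then have "1 - s' / s \<le> 1 - real (N * l) / real n"
        using s by (simp add: power_divide)
      also have "\<dots> = (real n - real (N * l)) / real n"
        using l n by (simp add: diff_divide_distrib)
      also have "\<dots> \<le> real l / real n"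
      proof (rule divide_right_mono)
        have "real n \<le> real (N * l + l)" using Nl(2) by (simp only: of_nat_le_iff)
        then show "real n - real (N * l) \<le> real l" by simp
      qed simp
      finally show "1 - s' / s \<le> real l / real n" .
      show "0 \<le> 1 - s' / s" using r by simp
    qed
    finally show ?thesis .
  qed
  have i3: "integrable P (\<lambda>\<omega>. (f3 \<omega>)\<^sup>2)"
  proof (rule integrable_bounded_square_P)
    show "\<bar>f3 \<omega>\<bar> \<le> (real (N * l) * K + real N * (real l * K)) / s'" for \<omega>
      unfolding f3_def abs_divide using S_le[of "N * l" \<omega>] B_le[of \<omega>] s
      by (simp add: divide_right_mono del: of_nat_mult)
  qed measurable
  have e3: "P.expectation (\<lambda>\<omega>. (f3 \<omega>)\<^sup>2) \<le> (sqrt (block_error L l))\<^sup>2"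
  proof -
    have "P.expectation (\<lambda>\<omega>. (f3 \<omega>)\<^sup>2) = P.expectation (\<lambda>\<omega>. (S (N * l) \<omega> - B \<omega>)\<^sup>2) / s'\<^sup>2"
      unfolding f3_def power_divide by simp
    also have "\<dots> \<le> real (N * l) * block_error L l / s'\<^sup>2"
      using L2_block_error[OF l, of N] unfolding S_def B_def by (intro divide_right_mono) simp_all
    also have "\<dots> = block_error L l" using s(5) Nl(3) by simp
    finally show ?thesis by (simp add: block_error_nonneg)
  qed
  have p: "0 \<le> real l * K / s" "0 \<le> L * suminf c * (real l / real n)"
    using s K_nonneg L_nonneg suminf_c_nonneg by simp_all
  note t12 = L2_triangle[OF _ _ i1 e1 p(1) i2 e2 p(2)]
  have "P.expectation (\<lambda>\<omega>. ((f1 \<omega> + f2 \<omega>) + f3 \<omega>)\<^sup>2)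
      \<le> ((real l * K / s + L * suminf c * (real l / real n)) + sqrt (block_error L l))\<^sup>2"
    by (rule L2_triangle(2)[OF _ _ t12(1) t12(2) _ i3 e3])
       (use p in \<open>simp_all add: block_error_nonneg\<close>)
  also have "(\<lambda>\<omega>. ((f1 \<omega> + f2 \<omega>) + f3 \<omega>)\<^sup>2) = (\<lambda>\<omega>. (S n \<omega> / s - B \<omega> / s')\<^sup>2)"
    unfolding f1_def f2_def f3_def by (simp add: algebra_simps diff_divide_distrib)
  finally show ?thesis by (simp only: S_def B_def s_def s'_def)
qed

text \<open>The comparison with blocks is uniform in large \<open>n\<close>: for one suitable length
  \<open>l\<close> the characteristic functions are eventually close to a fixed Gaussian one. It
  therefore suffices that the block variances converge along a subsequence of lengths; the whole
  sequence in \<open>n\<close> then converges.\<close>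

theorem char_limit:
  "\<exists>\<sigma>\<ge>0. \<forall>t. (\<lambda>n. char (distr P borel (\<lambda>\<omega>. (\<Sum>m<n. Y h m \<omega>) / sqrt (real n))) t)
    \<longlonglongrightarrow> exp (- (\<sigma>\<^sup>2 * t\<^sup>2 / 2))"
proof -
  \<comment> \<open>Lengths are \<open>Suc l\<close>, so that no block is empty.\<close>
  define v where "v l = P.expectation (\<lambda>\<omega>. (block_sum h (Suc l) 0 \<omega>)\<^sup>2) / real (Suc l)" for l
  define e where "e l = sqrt (block_error L (Suc l))" for l
  have e: "e \<longlonglongrightarrow> 0"
    using tendsto_real_sqrt[OF LIMSEQ_Suc[OF block_error_tendsto[of L]]] by (simp add: e_def[abs_def])
  have e_nonneg: "0 \<le> e l" for l
    by (simp add: e_def block_error_nonneg)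
  obtain E where E: "e l \<le> E" for l
    using convergent_imp_Bseq[OF convergentI[OF e]] unfolding Bseq_def by (auto simp: abs_le_iff)
  have v_nonneg: "0 \<le> v l" for l by (simp add: v_def)
  have "v l \<le> (L * suminf c + E)\<^sup>2" for l
  proof -
    have "v l \<le> (L * suminf c + e l)\<^sup>2"
      unfolding v_def e_def by (rule second_moment_block_sum_le) simp
    also have "\<dots> \<le> (L * suminf c + E)\<^sup>2"
      using E[of l] L_nonneg suminf_c_nonneg by (intro power_mono) (auto simp: e_def block_error_nonneg)
    finally show ?thesis .
  qed
  then have "bounded (range v)"
    using v_nonneg by (intro boundedI[of _ "(L * suminf c + E)\<^sup>2"]) auto
  then obtain v0 r where r: "strict_mono r" and v0: "(v \<circ> r) \<longlonglongrightarrow> v0"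
    using bounded_imp_convergent_subsequence by blast
  have "0 \<le> v0"
    by (rule LIMSEQ_le_const[OF v0]) (auto simp: v_nonneg)
  have "(\<lambda>n. char (distr P borel (\<lambda>\<omega>. (\<Sum>m<n. Y h m \<omega>) / sqrt (real n))) t)
    \<longlonglongrightarrow> complex_of_real (exp (- (v0 * t\<^sup>2 / 2)))" for t
  proof (rule LIMSEQ_I)
    fix \<epsilon> :: real assume \<epsilon>: "0 < \<epsilon>"
    have "(\<lambda>k. complex_of_real (exp (- (v (r k) * t\<^sup>2 / 2)))) \<longlonglongrightarrow> complex_of_real (exp (- (v0 * t\<^sup>2 / 2)))"
      by (intro tendsto_intros v0[unfolded comp_def]) simp
    from LIMSEQ_D[OF this, of "\<epsilon> / 4"] \<epsilon> obtain k1 where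
      k1: "\<And>k. k \<ge> k1 \<Longrightarrow> cmod (complex_of_real (exp (- (v (r k) * t\<^sup>2 / 2))) - complex_of_real (exp (- (v0 * t\<^sup>2 / 2)))) < \<epsilon> / 4"
      by auto
    have "(\<lambda>k. \<bar>t\<bar> * e (r k)) \<longlonglongrightarrow> \<bar>t\<bar> * 0"
      using LIMSEQ_subseq_LIMSEQ[OF e r] by (intro tendsto_intros) (simp add: comp_def)
    from LIMSEQ_D[OF this, of "\<epsilon> / 4"] \<epsilon> obtain k2 where k2: "\<And>k. k \<ge> k2 \<Longrightarrow> \<bar>t\<bar> * e (r k) < \<epsilon> / 4"
      by (auto simp: abs_mult e_nonneg)
    define k where "k = max k1 k2"
    define l where "l = Suc (r k)"
    have l: "0 < l" by (simp add: l_def)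
    define a where "a n = \<bar>t\<bar> * (real l * K / sqrt (real n) + L * suminf c * (real l / real n))" for n
    have "a \<longlonglongrightarrow> \<bar>t\<bar> * (0 + L * suminf c * 0)"
      unfolding a_def
      by (intro tendsto_intros lim_const_over_n)
         (rule tendsto_divide_0[OF tendsto_const filterlim_at_top_imp_at_infinity[OF
            filterlim_compose[OF sqrt_at_top filterlim_real_sequentially]]])
    then have a: "a \<longlonglongrightarrow> 0" by simp
    define \<phi> where "\<phi> N = char (distr P borel (\<lambda>\<omega>. (\<Sum>q<N. block_sum h l q \<omega>) / sqrt (real N))) (t / sqrt (real l))" for N
    have "\<phi> \<longlonglongrightarrow> exp (- (P.expectation (\<lambda>\<omega>. (block_sum h l 0 \<omega>)\<^sup>2) * (t / sqrt (real l))\<^sup>2 / 2))"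
      unfolding \<phi>_def
      using integrable_bounded_square_P[OF _ abs_block_sum_le[OF obs centered]]
      by (intro P.iid_char_limit indep_block_sum[OF obs centered l] expectation_block_sum[OF obs centered]
            distr_block_sum[OF obs centered l]) measurable
    also have "P.expectation (\<lambda>\<omega>. (block_sum h l 0 \<omega>)\<^sup>2) * (t / sqrt (real l))\<^sup>2 / 2 = v (r k) * t\<^sup>2 / 2"
      using l by (simp add: v_def l_def power_divide)
    finally have "(\<lambda>n. \<phi> (n div l)) \<longlonglongrightarrow> exp (- (v (r k) * t\<^sup>2 / 2))"
      by (rule filterlim_compose[OF _ filterlim_at_top_div_const_nat[OF l]])
    from LIMSEQ_D[OF this, of "\<epsilon> / 4"] \<epsilon> obtain n1 where
      n1: "\<And>n. n \<ge> n1 \<Longrightarrow> cmod (\<phi> (n div l) - exp (- (v (r k) * t\<^sup>2 / 2))) < \<epsilon> / 4" by auto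
    from LIMSEQ_D[OF a, of "\<epsilon> / 4"] \<epsilon> obtain n2 where n2: "\<And>n. n \<ge> n2 \<Longrightarrow> a n < \<epsilon> / 4" by fastforce
    show "\<exists>n0. \<forall>n\<ge>n0. cmod (char (distr P borel (\<lambda>\<omega>. (\<Sum>m<n. Y h m \<omega>) / sqrt (real n))) t
        - complex_of_real (exp (- (v0 * t\<^sup>2 / 2)))) < \<epsilon>"
    proof (intro exI allI impI)
      fix n assume n: "n \<ge> max l (max n1 n2)"
      let ?\<psi> = "char (distr P borel (\<lambda>\<omega>. (\<Sum>m<n. Y h m \<omega>) / sqrt (real n))) t"
      let ?N = "n div l"
      let ?a = "real l * K / sqrt (real n) + L * suminf c * (real l / real n) + sqrt (block_error L l)"
      have \<phi>: "\<phi> ?N = char (distr P borel (\<lambda>\<omega>. (\<Sum>q<?N. block_sum h l q \<omega>) / sqrt (real (?N * l)))) t"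
        unfolding \<phi>_def by (subst (1 2) P.char_distr_eq) (simp_all add: real_sqrt_mult mult.commute)
      have bnd: "\<bar>(\<Sum>m<n. Y h m \<omega>) / sqrt (real n) - (\<Sum>q<?N. block_sum h l q \<omega>) / sqrt (real (?N * l))\<bar>
          \<le> real n * K / sqrt (real n) + real ?N * (real l * K) / sqrt (real (?N * l))" for \<omega>
      proof -
        have "\<bar>(\<Sum>m<n. Y h m \<omega>) / sqrt (real n)\<bar> \<le> real n * K / sqrt (real n)"
          unfolding abs_divide using abs_sum_Y_le[of \<omega> "{..<n}"] by (simp add: divide_right_mono)
        moreover have "\<bar>(\<Sum>q<?N. block_sum h l q \<omega>) / sqrt (real (?N * l))\<bar> \<le> real ?N * (real l * K) / sqrt (real (?N * l))"
          unfolding abs_divide using abs_sum_block_sum_le[of l \<omega> ?N]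
          by (simp add: divide_right_mono del: of_nat_mult)
        ultimately show ?thesis by linarith
      qed
      have "cmod (?\<psi> - \<phi> ?N) \<le> \<bar>t\<bar> * ?a"
        unfolding \<phi>
      proof (rule P.norm_char_diff_le)
        show "0 \<le> ?a"
          using K_nonneg L_nonneg suminf_c_nonneg block_error_nonneg by simp
        show "P.expectation (\<lambda>\<omega>. ((\<Sum>m<n. Y h m \<omega>) / sqrt (real n) - (\<Sum>q<?N. block_sum h l q \<omega>) / sqrt (real (?N * l)))\<^sup>2) \<le> ?a\<^sup>2"
          by (rule L2_sum_minus_blocks[OF l]) (use n in simp)
        show "integrable P (\<lambda>\<omega>. ((\<Sum>m<n. Y h m \<omega>) / sqrt (real n) - (\<Sum>q<?N. block_sum h l q \<omega>) / sqrt (real (?N * l)))\<^sup>2)"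
          by (rule integrable_bounded_square_P[OF _ bnd]) measurable
      qed measurable
      also have "\<bar>t\<bar> * ?a = a n + \<bar>t\<bar> * e (r k)"
        by (simp add: a_def e_def l_def algebra_simps)
      also have "\<dots> < \<epsilon> / 4 + \<epsilon> / 4"
        using n2[of n] k2[of k] n by (simp add: k_def)
      finally have "cmod (?\<psi> - \<phi> ?N) < \<epsilon> / 2" by simp
      moreover have "cmod (\<phi> ?N - exp (- (v (r k) * t\<^sup>2 / 2))) < \<epsilon> / 4"
        using n1[of n] n by simp
      moreover have "cmod (complex_of_real (exp (- (v (r k) * t\<^sup>2 / 2))) - complex_of_real (exp (- (v0 * t\<^sup>2 / 2)))) < \<epsilon> / 4"
        using k1[of k] by (simp add: k_def)
      ultimately show "cmod (?\<psi> - complex_of_real (exp (- (v0 * t\<^sup>2 / 2)))) < \<epsilon>"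
        using norm_triangle_ineq[of "?\<psi> - \<phi> ?N" "\<phi> ?N - exp (- (v (r k) * t\<^sup>2 / 2))"]
          norm_triangle_ineq[of "?\<psi> - exp (- (v (r k) * t\<^sup>2 / 2))"
            "complex_of_real (exp (- (v (r k) * t\<^sup>2 / 2))) - complex_of_real (exp (- (v0 * t\<^sup>2 / 2)))"]
        by simp
    qed
  qed
  then show ?thesis
    using \<open>0 \<le> v0\<close> by (intro exI[of _ "sqrt v0"]) simp
qed

end

end

section \<open>Truncation to an interval\<close>

definition clip :: "real \<Rightarrow> real \<Rightarrow> real \<Rightarrow> real" where
  "clip a b x = max a (min b x)"

lemma borel_measurable_clip [measurable]: "clip a b \<in> borel_measurable borel"
  unfolding clip_def[abs_def] by measurable

lemma clip_bounds: "a \<le> b \<Longrightarrow> a \<le> clip a b x" "a \<le> b \<Longrightarrow> clip a b x \<le> b"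
  by (auto simp: clip_def)

lemma abs_clip_diff_le:
  assumes "a \<le> b"
  shows "\<bar>clip a b x - clip a b y\<bar> \<le> \<bar>x - y\<bar>" "\<bar>clip a b x - clip a b y\<bar> \<le> b - a"
  using assms by (auto simp: clip_def max_def min_def)

text \<open>The bridge between two descriptions: the variational formula is written with ramps,
  while the central limit theorem is applied to clips, which are bounded.\<close>

lemma clip_eq_ramp: "a \<le> b \<Longrightarrow> clip a b x = b - (max 0 (b - x) - max 0 (a - x))"
  by (auto simp: clip_def max_def min_def)

subsection \<open>Order statistics\<close>

definition order_statistics :: "(int \<Rightarrow> 'a \<Rightarrow> real) \<Rightarrow> nat \<Rightarrow> 'a \<Rightarrow> real list" where
  "order_statistics X n \<omega> = sort (map (\<lambda>k. X (int k) \<omega>) [1..<Suc n])"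

lemma length_order_statistics [simp]: "length (order_statistics X n \<omega>) = n"
  by (simp add: order_statistics_def)

lemma sum_order_statistics:
  fixes g :: "real \<Rightarrow> real"
  shows "(\<Sum>k=1..n. g (X (int k) \<omega>)) = (\<Sum>j<n. g (order_statistics X n \<omega> ! j))"
proof -
  let ?xs = "map (\<lambda>k. X (int k) \<omega>) [1..<Suc n]"
  have "(\<Sum>k=1..n. g (X (int k) \<omega>)) = (\<Sum>k\<leftarrow>[1..<Suc n]. g (X (int k) \<omega>))"
    using sum_set_upt_conv_sum_list_nat[of "\<lambda>k. g (X (int k) \<omega>)" 1 "Suc n"]
    by (simp only: set_upt atLeastLessThanSuc_atLeastAtMost)
  also have "\<dots> = sum_list (map g ?xs)"
    by (simp only: map_map comp_def)
  also have "\<dots> = sum_list (map g (sort ?xs))"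
    by (rule arg_cong[where f = sum_mset, of "mset (map g ?xs)" "mset (map g (sort ?xs))", unfolded sum_mset_sum_list])
       (simp only: mset_map mset_sort)
  also have "\<dots> = sum_list (map g (order_statistics X n \<omega>))"
    by (simp only: order_statistics_def)
  also have "\<dots> = (\<Sum>j<n. g (order_statistics X n \<omega> ! j))"
    by (simp add: sum_list_sum_nth lessThan_atLeast0)
  finally show ?thesis .
qed

lemma order_statistics_mono:
  "i \<le> j \<Longrightarrow> j < n \<Longrightarrow> order_statistics X n \<omega> ! i \<le> order_statistics X n \<omega> ! j"
  by (rule sorted_nth_mono) (simp_all add: order_statistics_def)

text \<open>Both sides say that at least \<open>i\<close> of the observations are at most
  \<open>x\<close>. Lists count from 0, so the \<open>i\<close>-th smallest observation is entry
  \<open>i - 1\<close>.\<close>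

lemma le_empirical_cdf_iff:
  assumes i: "1 \<le> i" "i \<le> n"
  shows "real i / real n \<le> empirical_cdf X n \<omega> x \<longleftrightarrow> order_statistics X n \<omega> ! (i - 1) \<le> x"
proof -
  let ?xs = "order_statistics X n \<omega>"
  define J where "J = {j\<in>{..<n}. ?xs ! j \<le> x}"
  have J: "finite J" by (simp add: J_def)
  have "(\<Sum>k=1..n. indicator {..x} (X (int k) \<omega>)) = (\<Sum>j<n. indicator {..x} (?xs ! j) :: real)"
    by (rule sum_order_statistics)
  also have "\<dots> = real (card J)"
    by (simp add: indicator_def J_def sum.If_cases Int_def)
  finally have "real i / real n \<le> empirical_cdf X n \<omega> x \<longleftrightarrow> i \<le> card J"
    using i by (simp add: empirical_cdf_def divide_right_mono pos_divide_le_eq)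
  also have "\<dots> \<longleftrightarrow> ?xs ! (i - 1) \<le> x"
  proof
    assume x: "?xs ! (i - 1) \<le> x"
    have "?xs ! j \<le> x" if "j < i" for j
      by (rule order_trans[OF order_statistics_mono x]) (use that i in auto)
    then have "{..<i} \<subseteq> J"
      using i by (auto simp: J_def)
    from card_mono[OF J this] show "i \<le> card J" by simp
  next
    assume card: "i \<le> card J"
    show "?xs ! (i - 1) \<le> x"
    proof (rule ccontr)
      assume "\<not> ?xs ! (i - 1) \<le> x"
      then have "\<not> ?xs ! j \<le> x" if "i - 1 \<le> j" "j < n" for j
        using order_statistics_mono[OF that, of X \<omega>] by linarith
      then have "J \<subseteq> {..<i - 1}"
        by (auto simp: J_def not_less[symmetric])
      from card_mono[OF _ this] card i show False by simp
    qed
  qed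
  finally show ?thesis .
qed

lemma quantile_empirical_cdf:
  assumes i: "1 \<le> i" "i \<le> n"
  shows "quantile (empirical_cdf X n \<omega>) (real i / real n) = order_statistics X n \<omega> ! (i - 1)"
proof -
  have "{x. real i / real n \<le> empirical_cdf X n \<omega> x} = {order_statistics X n \<omega> ! (i - 1)..}"
    by (auto simp: le_empirical_cdf_iff[OF i])
  then show ?thesis by (simp add: quantile_def)
qed

text \<open>Sublevel events are read off from the empirical distribution function, which is visibly
  measurable; the behaviour of \<open>sort\<close> need not be analysed.\<close>

lemma measurable_order_statistics:
  assumes [measurable]: "\<And>k. X k \<in> borel_measurable M" and i: "1 \<le> i" "i \<le> n"
  shows "(\<lambda>\<omega>. order_statistics X n \<omega> ! (i - 1)) \<in> borel_measurable M"
proof -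
  have [measurable]: "(\<lambda>\<omega>. empirical_cdf X n \<omega> x) \<in> borel_measurable M" for x
    unfolding empirical_cdf_def by measurable
  show ?thesis
    unfolding borel_measurable_iff_le
  proof
    fix a
    have "{\<omega> \<in> space M. order_statistics X n \<omega> ! (i - 1) \<le> a}
        = {\<omega> \<in> space M. real i / real n \<le> empirical_cdf X n \<omega> a}"
      by (simp only: le_empirical_cdf_iff[OF i])
    also have "\<dots> \<in> sets M" by measurable
    finally show "{\<omega> \<in> space M. order_statistics X n \<omega> ! (i - 1) \<le> a} \<in> sets M" .
  qed
qed

definition partial_sum :: "(int \<Rightarrow> 'a \<Rightarrow> real) \<Rightarrow> nat \<Rightarrow> nat \<Rightarrow> 'a \<Rightarrow> real" where
  "partial_sum X n m \<omega> = (\<Sum>j<m. order_statistics X n \<omega> ! j)"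

text \<open>As a function of \<open>t\<close> this is \<open>n\<close> times the antiderivative of
  the empirical distribution function that vanishes at minus infinity; hence its convexity.\<close>

definition ramp_sum :: "(int \<Rightarrow> 'a \<Rightarrow> real) \<Rightarrow> nat \<Rightarrow> 'a \<Rightarrow> real \<Rightarrow> real" where
  "ramp_sum X n \<omega> t = (\<Sum>k=1..n. max 0 (t - X (int k) \<omega>))"

lemma sum_quantile_empirical_cdf:
  assumes "b \<le> n" "a \<le> b"
  shows "(\<Sum>i=a + 1..b. quantile (empirical_cdf X n \<omega>) (real i / real n))
    = partial_sum X n b \<omega> - partial_sum X n a \<omega>"
proof -
  have "(\<Sum>i=a + 1..b. quantile (empirical_cdf X n \<omega>) (real i / real n))
      = (\<Sum>i=a + 1..b. order_statistics X n \<omega> ! (i - 1))"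
    using assms by (intro sum.cong quantile_empirical_cdf) auto
  also have "\<dots> = (\<Sum>j=a..<b. order_statistics X n \<omega> ! j)"
    by (rule sum.reindex_bij_witness[of _ Suc "\<lambda>i. i - 1"]) auto
  also have "\<dots> = partial_sum X n b \<omega> - partial_sum X n a \<omega>"
    using sum.atLeastLessThan_concat[of 0 a b "\<lambda>j. order_statistics X n \<omega> ! j"] assms
    by (simp add: partial_sum_def lessThan_atLeast0)
  finally show ?thesis .
qed

text \<open>The sum of the \<open>m\<close> smallest observations is \<open>max\<^sub>t (m t - \<Sum>\<^sub>k (t - X\<^sub>k)\<^sup>+)\<close>: this
  variational formula replaces the Bahadur representation of the sample quantiles.\<close>

lemma partial_sum_ge:
  assumes "m \<le> n"
  shows "real m * t - ramp_sum X n \<omega> t \<le> partial_sum X n m \<omega>"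
proof -
  let ?xs = "order_statistics X n \<omega>"
  have "(\<Sum>j<m. t - ?xs ! j) \<le> (\<Sum>j<m. max 0 (t - ?xs ! j))"
    by (intro sum_mono) simp
  also have "\<dots> \<le> (\<Sum>j<n. max 0 (t - ?xs ! j))"
    using assms by (intro sum_mono2) auto
  also have "\<dots> = ramp_sum X n \<omega> t"
    unfolding ramp_sum_def by (rule sum_order_statistics[symmetric])
  finally show ?thesis by (simp add: partial_sum_def sum_subtractf)
qed

text \<open>The \<open>m\<close>-th order statistic is a maximiser: before index \<open>m\<close>
  the ramp equals the difference, from there on it is 0. For \<open>m = 0\<close> there is no such
  entry, whence \<open>0 < m\<close>.\<close>

lemma partial_sum_eq:
  assumes "m \<le> n" "0 < m"
  obtains t where "partial_sum X n m \<omega> = real m * t - ramp_sum X n \<omega> t"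
proof
  let ?xs = "order_statistics X n \<omega>"
  let ?t = "?xs ! (m - 1)"
  have "ramp_sum X n \<omega> ?t = (\<Sum>j<n. max 0 (?t - ?xs ! j))"
    unfolding ramp_sum_def by (rule sum_order_statistics)
  also have "\<dots> = (\<Sum>j<m. max 0 (?t - ?xs ! j))"
  proof (rule sum.mono_neutral_right)
    show "\<forall>j\<in>{..<n} - {..<m}. max 0 (?t - ?xs ! j) = 0"
    proof
      fix j assume "j \<in> {..<n} - {..<m}"
      then have "?t \<le> ?xs ! j" using assms by (intro order_statistics_mono) auto
      then show "max 0 (?t - ?xs ! j) = 0" by simp
    qed
  qed (use assms in auto)
  also have "\<dots> = (\<Sum>j<m. ?t - ?xs ! j)"
  proof (rule sum.cong)
    fix j assume "j \<in> {..<m}"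
    then have "?xs ! j \<le> ?t" using assms by (intro order_statistics_mono) auto
    then show "max 0 (?t - ?xs ! j) = ?t - ?xs ! j" by simp
  qed simp
  finally show "partial_sum X n m \<omega> = real m * ?t - ramp_sum X n \<omega> ?t"
    by (simp add: partial_sum_def sum_subtractf)
qed

text \<open>Within distance \<delta> of \<open>z\<close>, the point \<open>z\<close> lies between
  \<open>t\<close> and the endpoint on the opposite side, and convexity with \<open>g z = 0\<close>
  bounds \<open>- g t\<close> by the value there. Farther out, \<open>g z = 0\<close> and
  nonnegativity at the nearer endpoint force \<open>g t\<close> to be nonnegative.\<close>

lemma convex_lower_bound:
  fixes g :: "real \<Rightarrow> real"
  assumes convex: "\<And>u v x y. 0 \<le> u \<Longrightarrow> 0 \<le> v \<Longrightarrow> u + v = 1 \<Longrightarrow> g (u * x + v * y) \<le> u * g x + v * g y"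
    and z: "g z = 0" and \<delta>: "0 < \<delta>" and nonneg: "0 \<le> g (z - \<delta>)" "0 \<le> g (z + \<delta>)"
  shows "- g t \<le> max (g (z - \<delta>)) (g (z + \<delta>))"
proof -
  \<comment> \<open>The sign of \<open>d\<close> selects the side of \<open>z\<close>, and
    \<open>s\<close> points in the same direction, so both sides are handled at once.\<close>
  have one: "- g (z + s) \<le> g (z - d)" if d: "d \<noteq> 0" "0 \<le> s / d" and gm: "0 \<le> g (z - d)" and gp: "0 \<le> g (z + d)"
    for s d :: real
  proof (cases "s / d \<le> 1")
    case True
    define \<rho> where "\<rho> = s / d"
    have \<rho>: "0 \<le> \<rho>" "\<rho> \<le> 1" using that True by (auto simp: \<rho>_def)
    have s: "s = \<rho> * d" using d by (simp add: \<rho>_def)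
    have "g ((1 / (1 + \<rho>)) * (z + s) + (\<rho> / (1 + \<rho>)) * (z - d)) \<le> (1 / (1 + \<rho>)) * g (z + s) + (\<rho> / (1 + \<rho>)) * g (z - d)"
      using \<rho> by (intro convex) (auto simp: add_divide_distrib[symmetric])
    also have "(1 / (1 + \<rho>)) * (z + s) + (\<rho> / (1 + \<rho>)) * (z - d) = ((z + \<rho> * d) + \<rho> * (z - d)) / (1 + \<rho>)"
      by (simp add: s add_divide_distrib)
    also have "\<dots> = (1 + \<rho>) * z / (1 + \<rho>)"
      by (simp add: algebra_simps)
    also have "\<dots> = z"
      using \<rho> by simp
    finally have "0 \<le> (g (z + s) + \<rho> * g (z - d)) / (1 + \<rho>)"
      by (simp add: z add_divide_distrib)
    then have "0 \<le> g (z + s) + \<rho> * g (z - d)"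
      using \<rho> by (simp add: zero_le_divide_iff)
    moreover have "\<rho> * g (z - d) \<le> g (z - d)"
      using \<rho> gm by (simp add: mult_left_le_one_le)
    ultimately show ?thesis by simp
  next
    case False
    define \<mu> where "\<mu> = 1 / (s / d)"
    have \<mu>: "0 < \<mu>" "\<mu> \<le> 1"
      using False by (simp_all add: \<mu>_def del: divide_divide_eq_right divide_divide_eq_left)
    have "s \<noteq> 0" using False by auto
    then have s: "\<mu> * s = d" by (simp add: \<mu>_def)
    have "g (\<mu> * (z + s) + (1 - \<mu>) * z) \<le> \<mu> * g (z + s) + (1 - \<mu>) * g z"
      using \<mu> by (intro convex) auto
    also have "\<mu> * (z + s) + (1 - \<mu>) * z = z + d"
      by (simp add: s[symmetric] algebra_simps)
    finally have "0 \<le> \<mu> * g (z + s)" using gp z by simp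
    then have "0 \<le> g (z + s)" using \<mu> by (simp add: zero_le_mult_iff)
    then show ?thesis using gm by simp
  qed
  show ?thesis
  proof (cases "z \<le> t")
    case True
    then show ?thesis using one[of \<delta> "t - z"] \<delta> nonneg by simp
  next
    case False
    then have "0 \<le> (t - z) / - \<delta>" using \<delta> by (intro divide_nonpos_neg) auto
    then show ?thesis using one[of "- \<delta>" "t - z"] \<delta> nonneg by simp
  qed
qed

lemma ramp_sum_diff:
  assumes "s \<le> t"
  shows "ramp_sum X n \<omega> t - ramp_sum X n \<omega> s = (\<Sum>k=1..n. t - clip s t (X (int k) \<omega>))"
  by (simp add: ramp_sum_def clip_eq_ramp[OF assms] sum_subtractf)

text \<open>\<open>convex_lower_bound\<close> applied to the function \<open>g\<close> below, whose
  negative at the maximiser is the remainder. Only sums of clips over the two intervals of length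
  \<delta> next to \<open>z\<close> enter the bound, and these have small variance.\<close>

lemma partial_sum_remainder_le:
  assumes m: "m \<le> n" "0 < m" and \<delta>: "0 < \<delta>"
    and up: "0 \<le> (\<Sum>k=1..n. z + \<delta> - clip z (z + \<delta>) (X (int k) \<omega>)) - real m * \<delta>"
    and down: "0 \<le> real m * \<delta> - (\<Sum>k=1..n. z - clip (z - \<delta>) z (X (int k) \<omega>))"
  shows "partial_sum X n m \<omega> - (real m * z - ramp_sum X n \<omega> z)
    \<le> max (real m * \<delta> - (\<Sum>k=1..n. z - clip (z - \<delta>) z (X (int k) \<omega>)))
        ((\<Sum>k=1..n. z + \<delta> - clip z (z + \<delta>) (X (int k) \<omega>)) - real m * \<delta>)"
proof -
  define g where "g t = ramp_sum X n \<omega> t - ramp_sum X n \<omega> z - real m * (t - z)" for t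
  obtain t where t: "partial_sum X n m \<omega> = real m * t - ramp_sum X n \<omega> t"
    by (rule partial_sum_eq[OF m])
  have gp: "g (z + \<delta>) = (\<Sum>k=1..n. z + \<delta> - clip z (z + \<delta>) (X (int k) \<omega>)) - real m * \<delta>"
    using \<delta> by (simp add: g_def ramp_sum_diff)
  have gm: "g (z - \<delta>) = real m * \<delta> - (\<Sum>k=1..n. z - clip (z - \<delta>) z (X (int k) \<omega>))"
    using \<delta> ramp_sum_diff[of "z - \<delta>" z X n \<omega>] by (simp add: g_def)
  have convex: "g (u * x + v * y) \<le> u * g x + v * g y" if uv: "0 \<le> u" "0 \<le> v" "u + v = 1" for u v x y
  proof -
    have "ramp_sum X n \<omega> (u * x + v * y) \<le> u * ramp_sum X n \<omega> x + v * ramp_sum X n \<omega> y"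
      unfolding ramp_sum_def sum_distrib_left sum.distrib[symmetric]
    proof (rule sum_mono)
      fix k
      have "u * x + v * y - X (int k) \<omega> = u * (x - X (int k) \<omega>) + v * (y - X (int k) \<omega>)"
        using uv(3) by (simp add: algebra_simps flip: distrib_right)
      also have "\<dots> \<le> u * max 0 (x - X (int k) \<omega>) + v * max 0 (y - X (int k) \<omega>)"
        using uv by (intro add_mono mult_left_mono) auto
      finally show "max 0 (u * x + v * y - X (int k) \<omega>)
        \<le> u * max 0 (x - X (int k) \<omega>) + v * max 0 (y - X (int k) \<omega>)"
        using uv by simp
    qed
    moreover have v: "v = 1 - u" using uv(3) by simp
    ultimately show ?thesis
      unfolding g_def v by (simp add: algebra_simps)
  qed
  have "- g t \<le> max (g (z - \<delta>)) (g (z + \<delta>))"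
    by (rule convex_lower_bound[OF convex _ \<delta>]) (use up down in \<open>simp_all add: gp gm\<close>, simp add: g_def)
  then show ?thesis
    unfolding gp gm t by (simp add: g_def algebra_simps)
qed

lemma trim_index_bounds:
  assumes "0 \<le> p"
  shows "real (trim_index p n) \<le> real n * p" "real n * p < real (trim_index p n) + 1"
proof -
  have "0 \<le> \<lfloor>real n * p\<rfloor>" using assms by simp
  then have "real (trim_index p n) = of_int \<lfloor>real n * p\<rfloor>" by (simp add: trim_index_def)
  then show "real (trim_index p n) \<le> real n * p" "real n * p < real (trim_index p n) + 1"
    by linarith+
qed

lemma trim_index_mono: "p \<le> q \<Longrightarrow> trim_index p n \<le> trim_index q n"
  unfolding trim_index_def by (intro nat_mono floor_mono mult_left_mono) auto

lemma trim_index_le: "0 \<le> p \<Longrightarrow> p \<le> 1 \<Longrightarrow> trim_index p n \<le> n"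
  using trim_index_bounds(1)[of p n] mult_left_mono[of p 1 "real n"] by (simp flip: of_nat_le_iff)

subsection \<open>The integral of the quantile function\<close>

text \<open>\<open>quantile C\<close> of a uniform variable has law \<open>M\<close>, so the
  integral of \<open>clip A B\<close> against \<open>M\<close> is an integral over the unit
  interval, where the clipped quantile equals \<open>A\<close> up to \<open>p\<^sub>0\<close>,
  \<open>B\<close> from \<open>p\<^sub>1\<close> on, and the quantile itself in between.\<close>

lemma (in cdf_distribution) integral_quantile:
  assumes p: "0 < p\<^sub>0" "p\<^sub>0 \<le> p\<^sub>1" "p\<^sub>1 < 1"
  defines "A \<equiv> quantile C p\<^sub>0" and "B \<equiv> quantile C p\<^sub>1"
  shows "integral {p\<^sub>0..p\<^sub>1} (quantile C) = (\<integral>x. clip A B x \<partial>M) + (p\<^sub>1 - 1) * B - p\<^sub>0 * A"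
proof -
  have Q: "quantile C = I" by (rule ext) (simp only: quantile_def)
  have mono: "quantile C u \<le> quantile C v" if "0 < u" "u \<le> v" "v < 1" for u v
    unfolding Q using that by (intro mono_onD[OF mono_I]) auto
  define \<phi> where "\<phi> u = clip A B (quantile C u)" for u
  have AB: "A \<le> B" unfolding A_def B_def using p by (intro mono) auto
  have [measurable]: "\<phi> \<in> borel_measurable (restrict_space lborel {0<..<1})"
  proof -
    have sets_eq: "sets (restrict_space lborel {0<..<1::real}) = sets (restrict_space borel {0<..<1})"
      by (simp add: sets_restrict_space)
    have "(\<lambda>u. clip A B (I u)) \<in> borel_measurable (restrict_space borel {0<..<1})"
      by (rule measurable_compose[OF measurable_CI]) measurable
    then show ?thesis
      unfolding \<phi>_def[abs_def] Q measurable_cong_sets[OF sets_eq refl] .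
  qed
  have "(\<integral>x. clip A B x \<partial>M) = (\<integral>u. \<phi> u \<partial>restrict_space lborel {0<..<1})"
    unfolding \<phi>_def Q
    by (subst distr_I_eq_M[symmetric], subst integral_distr) (auto simp: measurable_CI)
  also have "\<dots> = (LINT u:{0<..<1}|lborel. \<phi> u)"
    by (simp add: integral_restrict_space set_lebesgue_integral_def)
  also have "\<dots> = integral {0<..<1} \<phi>"
  proof (rule set_borel_integral_eq_integral(2))
    have "finite_measure (restrict_space lborel {0<..<1::real})"
      by (rule finite_measureI) (simp add: emeasure_restrict_space space_restrict_space)
    then have "integrable (restrict_space lborel {0<..<1}) \<phi>"
    proof (rule finite_measure.integrable_const_bound[where B = "\<bar>A\<bar> + \<bar>B\<bar>"])
      have "\<bar>\<phi> u\<bar> \<le> \<bar>A\<bar> + \<bar>B\<bar>" for u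
        using clip_bounds[OF AB, of "quantile C u"] unfolding \<phi>_def by linarith
      then show "AE u in restrict_space lborel {0<..<1}. norm (\<phi> u) \<le> \<bar>A\<bar> + \<bar>B\<bar>" by simp
    qed measurable
    then show "set_integrable lborel {0<..<1} \<phi>"
      by (simp add: set_integrable_def integrable_restrict_space)
  qed
  finally have clip: "(\<integral>x. clip A B x \<partial>M) = integral {0<..<1} \<phi>" .
  have "(\<phi> has_integral A * (p\<^sub>0 - 0)) {0..p\<^sub>0}"
  \<comment> \<open>At 0 the infimum in \<open>quantile\<close> runs over all reals, so its value
    carries no meaning; the endpoint 1 is removed in the same way below.\<close>
  proof (rule has_integral_spike_finite[where S = "{0}"])
    show "((\<lambda>_. A) has_integral A * (p\<^sub>0 - 0)) {0..p\<^sub>0}"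
      using has_integral_const_real[of A 0 p\<^sub>0] p by (simp add: mult.commute)
    show "\<phi> u = A" if "u \<in> {0..p\<^sub>0} - {0}" for u
      using mono[of u p\<^sub>0] that p AB by (auto simp: \<phi>_def clip_def A_def)
  qed simp
  moreover have "(\<phi> has_integral B * (1 - p\<^sub>1)) {p\<^sub>1..1}"
  proof (rule has_integral_spike_finite[where S = "{1}"])
    show "((\<lambda>_. B) has_integral B * (1 - p\<^sub>1)) {p\<^sub>1..1}"
      using has_integral_const_real[of B p\<^sub>1 1] p by (simp add: mult.commute)
    show "\<phi> u = B" if "u \<in> {p\<^sub>1..1} - {1}" for u
      using mono[of p\<^sub>1 u] that p AB by (auto simp: \<phi>_def clip_def B_def)
  qed simp
  moreover have "(\<phi> has_integral integral {p\<^sub>0..p\<^sub>1} (quantile C)) {p\<^sub>0..p\<^sub>1}"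
  proof (rule has_integral_eq)
    show "quantile C u = \<phi> u" if "u \<in> {p\<^sub>0..p\<^sub>1}" for u
      using mono[of p\<^sub>0 u] mono[of u p\<^sub>1] that p by (auto simp: \<phi>_def clip_def A_def B_def)
    have "mono_on {p\<^sub>0..p\<^sub>1} (quantile C)"
      using p by (intro mono_onI mono) auto
    then show "(quantile C has_integral integral {p\<^sub>0..p\<^sub>1} (quantile C)) {p\<^sub>0..p\<^sub>1}"
      by (intro integrable_integral integrable_on_mono_on)
  qed
  ultimately have "(\<phi> has_integral A * (p\<^sub>0 - 0) + integral {p\<^sub>0..p\<^sub>1} (quantile C) + B * (1 - p\<^sub>1)) {0..1}"
    using p by (intro has_integral_combine[of 0 p\<^sub>1 1] has_integral_combine[of 0 p\<^sub>0 p\<^sub>1]) auto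
  then have "integral {0<..<1} \<phi> = A * (p\<^sub>0 - 0) + integral {p\<^sub>0..p\<^sub>1} (quantile C) + B * (1 - p\<^sub>1)"
    using integral_open_interval_real[of 0 1 \<phi>] by (simp add: integral_unique)
  with clip show ?thesis by (simp add: algebra_simps)
qed

subsection \<open>Convergence in probability\<close>

context prob_space
begin

definition null_in_prob :: "(nat \<Rightarrow> 'a \<Rightarrow> real) \<Rightarrow> bool" where
  "null_in_prob V \<longleftrightarrow> (\<forall>\<epsilon>>0. (\<lambda>n. prob {\<omega>\<in>space M. \<epsilon> < \<bar>V n \<omega>\<bar>}) \<longlonglongrightarrow> 0)"

lemma null_in_probI:
  assumes "\<And>\<epsilon>. 0 < \<epsilon> \<Longrightarrow> (\<lambda>n. prob {\<omega>\<in>space M. \<epsilon> < \<bar>V n \<omega>\<bar>}) \<longlonglongrightarrow> 0"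
  shows "null_in_prob V"
  using assms by (simp add: null_in_prob_def)

lemma null_in_prob_cong:
  assumes "null_in_prob V" and "\<forall>\<^sub>F n in sequentially. \<forall>\<omega>\<in>space M. W n \<omega> = V n \<omega>"
  shows "null_in_prob W"
proof (rule null_in_probI)
  fix \<epsilon> :: real assume "0 < \<epsilon>"
  with assms(1) have "(\<lambda>n. prob {\<omega>\<in>space M. \<epsilon> < \<bar>V n \<omega>\<bar>}) \<longlonglongrightarrow> 0"
    by (simp add: null_in_prob_def)
  moreover have "\<forall>\<^sub>F n in sequentially. prob {\<omega>\<in>space M. \<epsilon> < \<bar>V n \<omega>\<bar>} = prob {\<omega>\<in>space M. \<epsilon> < \<bar>W n \<omega>\<bar>}"
    using assms(2) by eventually_elim (auto intro!: arg_cong[where f = prob])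
  ultimately show "(\<lambda>n. prob {\<omega>\<in>space M. \<epsilon> < \<bar>W n \<omega>\<bar>}) \<longlonglongrightarrow> 0"
    by (rule Lim_transform_eventually)
qed

lemma null_in_prob_add:
  assumes [measurable]: "\<And>n. V n \<in> borel_measurable M" "\<And>n. W n \<in> borel_measurable M"
    and "null_in_prob V" "null_in_prob W"
  shows "null_in_prob (\<lambda>n \<omega>. V n \<omega> + W n \<omega>)"
proof (rule null_in_probI)
  fix \<epsilon> :: real assume \<epsilon>: "0 < \<epsilon>"
  show "(\<lambda>n. prob {\<omega>\<in>space M. \<epsilon> < \<bar>V n \<omega> + W n \<omega>\<bar>}) \<longlonglongrightarrow> 0"
  proof (rule tendsto_sandwich[OF _ _ tendsto_const])
    show "\<forall>\<^sub>F n in sequentially. prob {\<omega>\<in>space M. \<epsilon> < \<bar>V n \<omega> + W n \<omega>\<bar>}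
      \<le> prob {\<omega>\<in>space M. \<epsilon> / 2 < \<bar>V n \<omega>\<bar>} + prob {\<omega>\<in>space M. \<epsilon> / 2 < \<bar>W n \<omega>\<bar>}"
    proof (intro always_eventually allI)
      fix n
      have "prob {\<omega>\<in>space M. \<epsilon> < \<bar>V n \<omega> + W n \<omega>\<bar>}
        \<le> prob ({\<omega>\<in>space M. \<epsilon> / 2 < \<bar>V n \<omega>\<bar>} \<union> {\<omega>\<in>space M. \<epsilon> / 2 < \<bar>W n \<omega>\<bar>})"
        by (intro finite_measure_mono) (auto simp: abs_real_def split: if_splits)
      also have "\<dots> \<le> prob {\<omega>\<in>space M. \<epsilon> / 2 < \<bar>V n \<omega>\<bar>} + prob {\<omega>\<in>space M. \<epsilon> / 2 < \<bar>W n \<omega>\<bar>}"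
        by (intro measure_Un_le) measurable
      finally show "prob {\<omega>\<in>space M. \<epsilon> < \<bar>V n \<omega> + W n \<omega>\<bar>} \<le> \<dots>" .
    qed
    have "(\<lambda>n. prob {\<omega>\<in>space M. \<epsilon> / 2 < \<bar>V n \<omega>\<bar>} + prob {\<omega>\<in>space M. \<epsilon> / 2 < \<bar>W n \<omega>\<bar>}) \<longlonglongrightarrow> 0 + 0"
      using assms(3,4)[unfolded null_in_prob_def, rule_format, of "\<epsilon> / 2"] \<epsilon>
      by (intro tendsto_add) (simp_all del: less_divide_eq_numeral1 divide_less_eq_numeral1)
    then show "(\<lambda>n. prob {\<omega>\<in>space M. \<epsilon> / 2 < \<bar>V n \<omega>\<bar>} + prob {\<omega>\<in>space M. \<epsilon> / 2 < \<bar>W n \<omega>\<bar>}) \<longlonglongrightarrow> 0"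
      by simp
  qed simp
qed

lemma null_in_prob_const:
  assumes "x \<longlonglongrightarrow> (0::real)"
  shows "null_in_prob (\<lambda>n _. x n)"
proof (rule null_in_probI)
  fix \<epsilon> :: real assume "0 < \<epsilon>"
  then have "\<forall>\<^sub>F n in sequentially. \<bar>x n\<bar> < \<epsilon>"
    using tendstoD[OF assms, of \<epsilon>] by (simp add: dist_real_def)
  then have "\<forall>\<^sub>F n in sequentially. 0 = prob {\<omega>\<in>space M. \<epsilon> < \<bar>x n\<bar>}"
    by eventually_elim simp
  then show "(\<lambda>n. prob {\<omega>\<in>space M. \<epsilon> < \<bar>x n\<bar>}) \<longlonglongrightarrow> 0"
    by (rule Lim_transform_eventually[OF tendsto_const])
qed

lemma null_in_prob_mult_bounded:
  assumes [measurable]: "\<And>n. V n \<in> borel_measurable M" and V: "null_in_prob V" and r: "\<And>n. \<bar>r n\<bar> \<le> B"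
  shows "null_in_prob (\<lambda>n \<omega>. r n * V n \<omega>)"
proof (rule null_in_probI)
  fix \<epsilon> :: real assume \<epsilon>: "0 < \<epsilon>"
  have B: "0 \<le> B" using r[of 0] by simp
  show "(\<lambda>n. prob {\<omega>\<in>space M. \<epsilon> < \<bar>r n * V n \<omega>\<bar>}) \<longlonglongrightarrow> 0"
  proof (rule tendsto_sandwich[OF _ _ tendsto_const])
    show "\<forall>\<^sub>F n in sequentially. prob {\<omega>\<in>space M. \<epsilon> < \<bar>r n * V n \<omega>\<bar>}
      \<le> prob {\<omega>\<in>space M. \<epsilon> / (B + 1) < \<bar>V n \<omega>\<bar>}"
    proof (intro always_eventually allI finite_measure_mono subsetI CollectI conjI; clarify?)
      fix n \<omega> assume "\<epsilon> < \<bar>r n * V n \<omega>\<bar>"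
      also have "\<dots> \<le> (B + 1) * \<bar>V n \<omega>\<bar>"
        using r[of n] by (simp add: abs_mult mult_right_mono)
      finally show "\<epsilon> / (B + 1) < \<bar>V n \<omega>\<bar>"
        using B by (simp add: pos_divide_less_eq mult.commute)
    qed measurable
    show "(\<lambda>n. prob {\<omega>\<in>space M. \<epsilon> / (B + 1) < \<bar>V n \<omega>\<bar>}) \<longlonglongrightarrow> 0"
      using V \<epsilon> B by (simp add: null_in_prob_def)
  qed simp
qed

lemma null_in_prob_L2:
  assumes [measurable]: "\<And>n. V n \<in> borel_measurable M" and i: "\<And>n. integrable M (\<lambda>\<omega>. (V n \<omega>)\<^sup>2)"
    and le: "\<And>n. expectation (\<lambda>\<omega>. (V n \<omega>)\<^sup>2) \<le> v n" and v: "v \<longlonglongrightarrow> 0"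
  shows "null_in_prob V"
proof (rule null_in_probI)
  fix \<epsilon> :: real assume \<epsilon>: "0 < \<epsilon>"
  show "(\<lambda>n. prob {\<omega>\<in>space M. \<epsilon> < \<bar>V n \<omega>\<bar>}) \<longlonglongrightarrow> 0"
  proof (rule tendsto_sandwich[OF _ _ tendsto_const])
    show "\<forall>\<^sub>F n in sequentially. prob {\<omega>\<in>space M. \<epsilon> < \<bar>V n \<omega>\<bar>} \<le> v n / \<epsilon>\<^sup>2"
    proof (intro always_eventually allI)
      fix n
      have "prob {\<omega>\<in>space M. \<epsilon> < \<bar>V n \<omega>\<bar>} \<le> prob {\<omega>\<in>space M. \<epsilon>\<^sup>2 \<le> (V n \<omega>)\<^sup>2}"
      proof (intro finite_measure_mono subsetI CollectI conjI; clarify?)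
        fix \<omega> assume "\<epsilon> < \<bar>V n \<omega>\<bar>"
        then have "\<epsilon>\<^sup>2 \<le> \<bar>V n \<omega>\<bar>\<^sup>2" using \<epsilon> by (intro power_mono) auto
        then show "\<epsilon>\<^sup>2 \<le> (V n \<omega>)\<^sup>2" by simp
      qed measurable
      also have "\<dots> \<le> expectation (\<lambda>\<omega>. (V n \<omega>)\<^sup>2) / \<epsilon>\<^sup>2"
        using \<epsilon> by (intro integral_Markov_inequality_measure[OF i, of "{}"]) auto
      also have "\<dots> \<le> v n / \<epsilon>\<^sup>2"
        by (intro divide_right_mono le) simp
      finally show "prob {\<omega>\<in>space M. \<epsilon> < \<bar>V n \<omega>\<bar>} \<le> v n / \<epsilon>\<^sup>2" .
    qed
    show "(\<lambda>n. v n / \<epsilon>\<^sup>2) \<longlonglongrightarrow> 0"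
      using tendsto_divide[OF v tendsto_const[of "\<epsilon>\<^sup>2"]] \<epsilon> by simp
  qed simp
qed

text \<open>Slutsky's theorem at the level of characteristic functions: the exponentials differ by
  at most \<open>\<bar>t\<bar> * \<epsilon>\<close> where the variables are \<epsilon>-close, and by
  at most 2 elsewhere.\<close>

lemma char_limit_null_in_prob:
  assumes [measurable]: "\<And>n. Z n \<in> borel_measurable M" "\<And>n. W n \<in> borel_measurable M"
    and null: "null_in_prob (\<lambda>n \<omega>. Z n \<omega> - W n \<omega>)"
    and lim: "(\<lambda>n. char (distr M borel (W n)) t) \<longlonglongrightarrow> \<psi>"
  shows "(\<lambda>n. char (distr M borel (Z n)) t) \<longlonglongrightarrow> \<psi>"
proof -
  have bound: "cmod (char (distr M borel (Z n)) t - char (distr M borel (W n)) t)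
      \<le> \<bar>t\<bar> * \<epsilon> + 2 * prob {\<omega>\<in>space M. \<epsilon> < \<bar>Z n \<omega> - W n \<omega>\<bar>}" if \<epsilon>: "0 < \<epsilon>" for n \<epsilon>
  proof -
    let ?A = "{\<omega>\<in>space M. \<epsilon> < \<bar>Z n \<omega> - W n \<omega>\<bar>}"
    have "char (distr M borel (Z n)) t - char (distr M borel (W n)) t
        = (CLINT \<omega>|M. iexp (t * Z n \<omega>) - iexp (t * W n \<omega>))"
      by (subst Bochner_Integration.integral_diff[OF integrable_iexp_mult integrable_iexp_mult])
         (simp_all add: char_distr_eq)
    also have "cmod \<dots> \<le> (\<integral>\<omega>. cmod (iexp (t * Z n \<omega>) - iexp (t * W n \<omega>)) \<partial>M)"
      by (rule integral_norm_bound)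
    also have "\<dots> \<le> (\<integral>\<omega>. \<bar>t\<bar> * \<epsilon> + 2 * indicator ?A \<omega> \<partial>M)"
    proof (rule integral_mono)
      show "integrable M (\<lambda>\<omega>. cmod (iexp (t * Z n \<omega>) - iexp (t * W n \<omega>)))"
        by (intro integrable_norm Bochner_Integration.integrable_diff integrable_iexp_mult) measurable
      show "integrable M (\<lambda>\<omega>. \<bar>t\<bar> * \<epsilon> + 2 * indicator ?A \<omega>)"
        by (intro Bochner_Integration.integrable_add integrable_const integrable_mult_right
            integrable_real_indicator) (auto simp: emeasure_finite less_top[symmetric])
      fix \<omega> assume \<omega>: "\<omega> \<in> space M"
      show "cmod (iexp (t * Z n \<omega>) - iexp (t * W n \<omega>)) \<le> \<bar>t\<bar> * \<epsilon> + 2 * indicator ?A \<omega>"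
      proof (cases "\<epsilon> < \<bar>Z n \<omega> - W n \<omega>\<bar>")
        case True
        have "cmod (iexp (t * Z n \<omega>) - iexp (t * W n \<omega>)) \<le> cmod (iexp (t * Z n \<omega>)) + cmod (iexp (t * W n \<omega>))"
          by (rule norm_triangle_ineq4)
        also have "\<dots> = 2" by (simp only: norm_exp_i_times)
        also have "\<dots> \<le> \<bar>t\<bar> * \<epsilon> + 2 * indicator ?A \<omega>" using True \<omega> \<epsilon> by simp
        finally show ?thesis .
      next
        case False
        have "cmod (iexp (t * Z n \<omega>) - iexp (t * W n \<omega>)) \<le> \<bar>t * Z n \<omega> - t * W n \<omega>\<bar>"
          by (rule norm_iexp_diff_le)
        also have "\<dots> = \<bar>t\<bar> * \<bar>Z n \<omega> - W n \<omega>\<bar>"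
          by (simp only: right_diff_distrib[symmetric] abs_mult)
        also have "\<dots> \<le> \<bar>t\<bar> * \<epsilon>"
          using False by (intro mult_left_mono) auto
        finally show ?thesis using False by simp
      qed
    qed
    also have "\<dots> = \<bar>t\<bar> * \<epsilon> + 2 * prob ?A"
      by (subst Bochner_Integration.integral_add)
         (auto simp: prob_space emeasure_finite less_top[symmetric])
    finally show ?thesis .
  qed
  have "(\<lambda>n. char (distr M borel (Z n)) t - char (distr M borel (W n)) t) \<longlonglongrightarrow> 0"
  proof (rule LIMSEQ_I)
    fix e :: real assume e: "0 < e"
    define s where "s = \<bar>t\<bar> + 1"
    have s: "0 < s" by (simp add: s_def)
    define \<epsilon> where "\<epsilon> = e / (2 * s)"
    have \<epsilon>: "0 < \<epsilon>" using e s by (simp add: \<epsilon>_def)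
    have te: "\<bar>t\<bar> * \<epsilon> \<le> e / 2"
    proof -
      have "\<bar>t\<bar> * \<epsilon> \<le> s * \<epsilon>" using \<epsilon> by (simp add: s_def)
      also have "\<dots> = e / 2" using s by (simp add: \<epsilon>_def)
      finally show ?thesis .
    qed
    from null \<epsilon> have "(\<lambda>n. prob {\<omega>\<in>space M. \<epsilon> < \<bar>Z n \<omega> - W n \<omega>\<bar>}) \<longlonglongrightarrow> 0"
      by (simp add: null_in_prob_def)
    from LIMSEQ_D[OF this, of "e / 4"] e obtain n0
      where n0: "\<And>n. n \<ge> n0 \<Longrightarrow> prob {\<omega>\<in>space M. \<epsilon> < \<bar>Z n \<omega> - W n \<omega>\<bar>} < e / 4" by auto
    show "\<exists>n0. \<forall>n\<ge>n0. cmod (char (distr M borel (Z n)) t - char (distr M borel (W n)) t - 0) < e"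
    proof (intro exI allI impI)
      fix n assume "n \<ge> n0"
      then show "cmod (char (distr M borel (Z n)) t - char (distr M borel (W n)) t - 0) < e"
        using bound[OF \<epsilon>, of n] te n0[of n] by simp
    qed
  qed
  from tendsto_add[OF this lim] show ?thesis by simp
qed

end

subsection \<open>The remainder at a regular quantile\<close>

text \<open>The lower bound supplies the quadratic drop of the concave function on both sides of
  \<open>z\<close>; the upper bound keeps the cost of missing the maximum of order
  \<open>n * \<delta>\<^sup>2\<close>.\<close>

definition regular_at :: "(real \<Rightarrow> real) \<Rightarrow> real \<Rightarrow> bool" where
  "regular_at F z \<longleftrightarrow> (\<exists>c C \<delta>. 0 < c \<and> 0 < \<delta> \<and>
    (\<forall>x. \<bar>x - z\<bar> \<le> \<delta> \<longrightarrow> c * \<bar>x - z\<bar> \<le> \<bar>F x - F z\<bar> \<and> \<bar>F x - F z\<bar> \<le> C * \<bar>x - z\<bar>))"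

text \<open>The two expectations are the integrals of the distribution function over
  \<open>[z, z + \<delta>]\<close> and \<open>[z - \<delta>, z]\<close>. A step at the midpoint
  retains a fixed share of the growth of \<open>cdf M\<close>; the one-step bounds only have to be
  of the right order.\<close>

lemma (in real_distribution) expectation_clip_bounds:
  assumes \<delta>: "0 < \<delta>"
  shows "\<delta> / 2 * (cdf M z + cdf M (z + \<delta> / 2)) \<le> (\<integral>x. z + \<delta> - clip z (z + \<delta>) x \<partial>M)"
    and "(\<integral>x. z + \<delta> - clip z (z + \<delta>) x \<partial>M) \<le> \<delta> * cdf M (z + \<delta>)"
    and "\<delta> * cdf M (z - \<delta>) \<le> (\<integral>x. z - clip (z - \<delta>) z x \<partial>M)"
    and "(\<integral>x. z - clip (z - \<delta>) z x \<partial>M) \<le> \<delta> / 2 * (cdf M z + cdf M (z - \<delta> / 2))"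
proof -
  have ind: "integrable M (indicator {..y} :: real \<Rightarrow> real)" for y
    by (simp add: emeasure_finite less_top[symmetric])
  have ic: "integrable M (\<lambda>x. u - clip a b x)" if "a \<le> b" for u a b
  proof (rule integrable_const_bound[where B = "\<bar>u\<bar> + (\<bar>a\<bar> + \<bar>b\<bar>)"])
    have "\<bar>u - clip a b x\<bar> \<le> \<bar>u\<bar> + (\<bar>a\<bar> + \<bar>b\<bar>)" for x
      using clip_bounds[OF that, of x] by linarith
    then show "AE x in M. norm (u - clip a b x) \<le> \<bar>u\<bar> + (\<bar>a\<bar> + \<bar>b\<bar>)" by simp
  qed measurable
  have "(\<integral>x. \<delta> / 2 * indicator {..z} x + \<delta> / 2 * indicator {..z + \<delta> / 2} x \<partial>M)
      \<le> (\<integral>x. z + \<delta> - clip z (z + \<delta>) x \<partial>M)"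
    using \<delta>
    by (intro integral_mono ic Bochner_Integration.integrable_add integrable_mult_right ind)
       (auto simp: clip_def indicator_def)
  then show "\<delta> / 2 * (cdf M z + cdf M (z + \<delta> / 2)) \<le> (\<integral>x. z + \<delta> - clip z (z + \<delta>) x \<partial>M)"
    using ind by (simp add: cdf_def distrib_left)
  have "(\<integral>x. z + \<delta> - clip z (z + \<delta>) x \<partial>M) \<le> (\<integral>x. \<delta> * indicator {..z + \<delta>} x \<partial>M)"
    using \<delta>
    by (intro integral_mono ic Bochner_Integration.integrable_add integrable_mult_right ind)
       (auto simp: clip_def indicator_def)
  then show "(\<integral>x. z + \<delta> - clip z (z + \<delta>) x \<partial>M) \<le> \<delta> * cdf M (z + \<delta>)"
    using ind by (simp add: cdf_def)
  have "(\<integral>x. \<delta> * indicator {..z - \<delta>} x \<partial>M) \<le> (\<integral>x. z - clip (z - \<delta>) z x \<partial>M)"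
    using \<delta>
    by (intro integral_mono ic Bochner_Integration.integrable_add integrable_mult_right ind)
       (auto simp: clip_def indicator_def)
  then show "\<delta> * cdf M (z - \<delta>) \<le> (\<integral>x. z - clip (z - \<delta>) z x \<partial>M)"
    using ind by (simp add: cdf_def)
  have "(\<integral>x. z - clip (z - \<delta>) z x \<partial>M)
      \<le> (\<integral>x. \<delta> / 2 * indicator {..z} x + \<delta> / 2 * indicator {..z - \<delta> / 2} x \<partial>M)"
    using \<delta>
    by (intro integral_mono ic Bochner_Integration.integrable_add integrable_mult_right ind)
       (auto simp: clip_def indicator_def)
  then show "(\<integral>x. z - clip (z - \<delta>) z x \<partial>M) \<le> \<delta> / 2 * (cdf M z + cdf M (z - \<delta> / 2))"
    using ind by (simp add: cdf_def distrib_left)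
qed

context causal_sequence
begin

lemma observable_clip:
  assumes "a \<le> b"
  shows "observable (max 1 (b - a)) (\<bar>a\<bar> + \<bar>b\<bar>) (clip a b)"
  unfolding observable_def
proof (intro conjI allI)
  show "\<bar>clip a b x\<bar> \<le> \<bar>a\<bar> + \<bar>b\<bar>" for x
    using clip_bounds[OF assms, of x] by linarith
  show "\<bar>clip a b x - clip a b y\<bar> \<le> max 1 (b - a) * min 1 \<bar>x - y\<bar>" for x y
  proof (cases "1 \<le> \<bar>x - y\<bar>")
    case True
    then show ?thesis using abs_clip_diff_le(2)[OF assms, of x y] by (simp add: min_absorb1)
  next
    case False
    have "\<bar>clip a b x - clip a b y\<bar> \<le> 1 * \<bar>x - y\<bar>"
      using abs_clip_diff_le(1)[OF assms, of x y] by simp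
    also have "\<dots> \<le> max 1 (b - a) * \<bar>x - y\<bar>"
      by (rule mult_right_mono) auto
    finally show ?thesis using False by (simp add: min_absorb2)
  qed
qed auto

lemma sum_Y: "(\<Sum>k=1..n. g (X (int k) \<omega>)) = (\<Sum>m<n. Y g m \<omega>)"
  by (simp add: Y_def sum.atLeast1_atMost_eq add.commute)

lemma expectation_X:
  fixes g :: "real \<Rightarrow> real"
  assumes [measurable]: "g \<in> borel_measurable borel"
  shows "P.expectation (\<lambda>\<omega>. g (X k \<omega>)) = (\<integral>x. g x \<partial>distr P borel (X 0))"
proof -
  have "P.expectation (\<lambda>\<omega>. g (X k \<omega>)) = P.expectation (\<lambda>\<omega>. g (X 0 (shift k \<omega>)))"
    by (simp add: X_shift)
  also have "\<dots> = P.expectation (\<lambda>\<omega>. g (X 0 \<omega>))"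
    by (rule integral_shift) measurable
  also have "\<dots> = (\<integral>x. g x \<partial>distr P borel (X 0))"
    by (subst integral_distr) auto
  finally show ?thesis .
qed

text \<open>Chebyshev's inequality. An interval of length at most 1 gives Lipschitz constant 1, and
  its length \<delta> caps the oscillation, so the variance carries
  \<open>min (c i) \<delta>\<close>.\<close>

lemma clip_sum_deviation:
  assumes \<delta>: "0 < \<delta>" "\<delta> \<le> 1" "b = a + \<delta>" and \<theta>: "0 < \<theta>"
  shows "P.prob {\<omega>\<in>space P. \<theta> \<le> \<bar>(\<Sum>k=1..n. clip a b (X (int k) \<omega>)) - real n * (\<integral>x. clip a b x \<partial>distr P borel (X 0))\<bar>}
    \<le> suminf c * (real n * (\<Sum>i. min (c i) \<delta>)) / 2 / \<theta>\<^sup>2"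
proof -
  have obs: "observable 1 (\<bar>a\<bar> + \<bar>b\<bar>) (clip a b)"
    using observable_clip[of a b] \<delta> by simp
  note [measurable] = measurable_Y[OF obs]
  let ?S = "\<lambda>\<omega>. \<Sum>m<n. Y (clip a b) m \<omega>"
  have bnd: "\<bar>?S \<omega>\<bar> \<le> real n * (\<bar>a\<bar> + \<bar>b\<bar>)" for \<omega>
    using order_trans[OF sum_abs sum_mono[of "{..<n}" "\<lambda>m. \<bar>Y (clip a b) m \<omega>\<bar>" "\<lambda>_. \<bar>a\<bar> + \<bar>b\<bar>"]]
      abs_Y_le[OF obs] by simp
  have iY: "integrable P (Y (clip a b) m)" for m
    by (rule integrable_bounded_P[OF _ abs_Y_le[OF obs]]) measurable
  have E: "P.expectation ?S = real n * (\<integral>x. clip a b x \<partial>distr P borel (X 0))"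
  proof -
    have "P.expectation (Y (clip a b) m) = (\<integral>x. clip a b x \<partial>distr P borel (X 0))" for m
      unfolding Y_def by (rule expectation_X) measurable
    then show ?thesis using iY by simp
  qed
  have "P.prob {\<omega>\<in>space P. \<theta> \<le> \<bar>?S \<omega> - P.expectation ?S\<bar>} \<le> P.variance ?S / \<theta>\<^sup>2"
    by (rule P.Chebyshev_inequality[OF _ integrable_bounded_square_P[OF _ bnd] \<theta>]) measurable
  also have "\<dots> \<le> suminf c * (real n * (\<Sum>i. min (c i) \<delta>)) / 2 / \<theta>\<^sup>2"
    using variance_sum_Y_le[OF obs, of \<delta> n] abs_clip_diff_le(2)[of a b] \<delta>
    by (intro divide_right_mono) auto
  finally show ?thesis by (simp only: E sum_Y)
qed

definition remainder :: "real \<Rightarrow> real \<Rightarrow> nat \<Rightarrow> (int \<Rightarrow> 'c) \<Rightarrow> real" where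
  "remainder p z n \<omega> = partial_sum X n (trim_index p n) \<omega>
    - (real (trim_index p n) * z - ramp_sum X n \<omega> z)"

text \<open>Off two events of vanishing probability, the clip sums on both sides of \<open>z\<close>
  deviate from their means by less than half of the quadratic drop. Then the hypotheses of
  \<open>partial_sum_remainder_le\<close> hold and its bound is below
  \<open>\<epsilon> * sqrt n\<close>. The remainder is nonnegative, so an upper bound
  suffices.\<close>

lemma remainder_null:
  assumes p: "0 < p" "p < 1" and F: "cdf (distr P borel (X 0)) z = p"
    and reg: "regular_at (cdf (distr P borel (X 0))) z"
  shows "P.null_in_prob (\<lambda>n \<omega>. remainder p z n \<omega> / sqrt (real n))"
proof (rule P.null_in_probI)
  fix \<epsilon> :: real assume \<epsilon>: "0 < \<epsilon>"
  define \<mu> where "\<mu> = distr P borel (X 0)"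
  interpret \<mu>: real_distribution \<mu>
    unfolding \<mu>_def by (rule P.real_distribution_distr) measurable
  have Fz: "cdf \<mu> z = p" using F by (simp add: \<mu>_def)
  from reg obtain c1 C1 \<delta>0 where c1: "0 < c1" and \<delta>0: "0 < \<delta>0"
    and lip: "\<And>x. \<bar>x - z\<bar> \<le> \<delta>0 \<Longrightarrow> c1 * \<bar>x - z\<bar> \<le> \<bar>cdf \<mu> x - p\<bar> \<and> \<bar>cdf \<mu> x - p\<bar> \<le> C1 * \<bar>x - z\<bar>"
    unfolding regular_at_def \<mu>_def[symmetric] Fz by blast
  have C1: "0 \<le> C1" using lip[of "z + \<delta>0"] c1 \<delta>0 by (smt (verit) mult_nonneg_nonneg mult_neg_pos abs_ge_zero)
  have mono: "x \<le> y \<Longrightarrow> cdf \<mu> x \<le> cdf \<mu> y" for x y by (rule \<mu>.cdf_nondecreasing)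
  define s where "s = C1 + c1"
  have s: "0 < s" using c1 C1 by (simp add: s_def)
  \<comment> \<open>Chosen so that \<open>(C1 + c1) * \<eta>\<^sup>2\<close> is a quarter of
    \<epsilon>; another quarter is reserved for the rounding of \<open>n * p\<close>.\<close>
  define \<eta> where "\<eta> = sqrt (\<epsilon> / (4 * s))"
  have \<eta>: "0 < \<eta>" "(C1 + c1) * \<eta>\<^sup>2 = \<epsilon> / 4"
    unfolding s_def[symmetric] using \<epsilon> s by (simp_all add: \<eta>_def)
  define d where "d n = \<eta> / sqrt (sqrt (real n))" for n
  \<comment> \<open>Half of the drop \<open>c1 * \<eta>\<^sup>2 * sqrt n / 4\<close>. On the lower
    side the other half absorbs the loss \<delta> from rounding \<open>n * p\<close> down to an
    integer.\<close>
  define \<theta> where "\<theta> n = c1 * \<eta>\<^sup>2 * sqrt (real n) / 8" for n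
  have d_lim: "d \<longlonglongrightarrow> 0"
    unfolding d_def
    by (intro tendsto_divide_0[OF tendsto_const] filterlim_at_top_imp_at_infinity
        filterlim_compose[OF sqrt_at_top] filterlim_compose[OF sqrt_at_top filterlim_real_sequentially])
  define w where "w n = (\<Sum>i. min (c i) (\<bar>d n\<bar>))" for n
  have w_lim: "w \<longlonglongrightarrow> 0"
    unfolding w_def using d_lim by (intro tendsto_suminf_min summable_c c_nonneg tendsto_rabs_zero) auto
  define up where "up n = {\<omega>\<in>space P. \<theta> n \<le> \<bar>(\<Sum>k=1..n. clip z (z + d n) (X (int k) \<omega>)) - real n * (\<integral>x. clip z (z + d n) x \<partial>\<mu>)\<bar>}" for n
  define down where "down n = {\<omega>\<in>space P. \<theta> n \<le> \<bar>(\<Sum>k=1..n. clip (z - d n) z (X (int k) \<omega>)) - real n * (\<integral>x. clip (z - d n) z x \<partial>\<mu>)\<bar>}" for n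
  define bound where "bound n = suminf c * (real n * w n) / 2 / (\<theta> n)\<^sup>2" for n
  have "\<forall>\<^sub>F n in sequentially. d n < min 1 \<delta>0"
    using order_tendstoD(2)[OF d_lim, of "min 1 \<delta>0"] \<delta>0 by simp
  moreover have "\<forall>\<^sub>F n in sequentially. d n < min (c1 * \<eta>\<^sup>2 / 8) (\<epsilon> / 4)"
    using order_tendstoD(2)[OF d_lim, of "min (c1 * \<eta>\<^sup>2 / 8) (\<epsilon> / 4)"] c1 \<eta> \<epsilon> by simp
  moreover have "\<forall>\<^sub>F n in sequentially. 1 / p < real n"
    using filterlim_real_sequentially by (simp add: filterlim_at_top_dense)
  moreover have "\<forall>\<^sub>F n in sequentially. 1 \<le> n" by (rule eventually_ge_at_top)
  ultimately have ev: "\<forall>\<^sub>F n in sequentially. P.prob {\<omega>\<in>space P. \<epsilon> < \<bar>remainder p z n \<omega> / sqrt (real n)\<bar>} \<le> 2 * bound n"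
  proof eventually_elim
    case (elim n)
    define \<delta> where "\<delta> = d n"
    define m where "m = trim_index p n"
    have n: "0 < real n" "1 \<le> sqrt (real n)" using elim(4) by simp_all
    have \<delta>: "0 < \<delta>" "\<delta> \<le> 1" "\<delta> \<le> \<delta>0" "\<delta> \<le> c1 * \<eta>\<^sup>2 / 8" "\<delta> \<le> \<epsilon> / 4"
      using elim(1,2) \<eta> n by (auto simp: \<delta>_def d_def)
    have "\<delta>\<^sup>2 = \<eta>\<^sup>2 / sqrt (real n)"
      using n by (simp add: \<delta>_def d_def power_divide)
    then have "real n * \<delta>\<^sup>2 = \<eta>\<^sup>2 * (real n / sqrt (real n))" by simp
    also have "real n / sqrt (real n) = sqrt (real n)" by (rule real_div_sqrt) simp
    finally have n\<delta>: "real n * \<delta>\<^sup>2 = \<eta>\<^sup>2 * sqrt (real n)" .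
    have \<theta>: "0 < \<theta> n" using c1 \<eta> n by (simp add: \<theta>_def)
    have m: "real m \<le> real n * p" "real n * p - 1 < real m" "m \<le> n"
      using trim_index_bounds[of p n] trim_index_le[of p n] p by (auto simp: m_def)
    have "1 < real n * p" using elim(3) p by (simp add: divide_less_eq mult.commute)
    then have m0: "0 < m" using m(2) by (cases m) auto
    have "P.prob (up n) \<le> bound n" "P.prob (down n) \<le> bound n"
      using clip_sum_deviation[of \<delta> "z + \<delta>" z "\<theta> n" n] clip_sum_deviation[of \<delta> z "z - \<delta>" "\<theta> n" n] \<delta> \<theta>
      by (simp_all add: up_def down_def bound_def w_def \<mu>_def \<delta>_def)
    then have "P.prob (up n) + P.prob (down n) \<le> 2 * bound n" by simp
    moreover have "P.prob {\<omega>\<in>space P. \<epsilon> < \<bar>remainder p z n \<omega> / sqrt (real n)\<bar>} \<le> P.prob (up n \<union> down n)"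
    proof (rule P.finite_measure_mono)
      show "up n \<union> down n \<in> sets P"
        unfolding up_def down_def by measurable
      show "{\<omega>\<in>space P. \<epsilon> < \<bar>remainder p z n \<omega> / sqrt (real n)\<bar>} \<subseteq> up n \<union> down n"
      proof (rule subsetI, rule ccontr)
        fix \<omega> assume \<omega>: "\<omega> \<in> {\<omega>\<in>space P. \<epsilon> < \<bar>remainder p z n \<omega> / sqrt (real n)\<bar>}" "\<omega> \<notin> up n \<union> down n"
        define Su where "Su = (\<Sum>k=1..n. clip z (z + \<delta>) (X (int k) \<omega>))"
        define Sd where "Sd = (\<Sum>k=1..n. clip (z - \<delta>) z (X (int k) \<omega>))"
        define Eu where "Eu = (\<integral>x. z + \<delta> - clip z (z + \<delta>) x \<partial>\<mu>)"
        define Ed where "Ed = (\<integral>x. z - clip (z - \<delta>) z x \<partial>\<mu>)"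
        have ic: "integrable \<mu> (clip a b)" if "a \<le> b" for a b
        proof (rule \<mu>.integrable_const_bound[where B = "\<bar>a\<bar> + \<bar>b\<bar>"])
          show "AE x in \<mu>. norm (clip a b x) \<le> \<bar>a\<bar> + \<bar>b\<bar>"
            using observableD(3)[OF observable_clip[OF that]] by simp
        qed (simp add: \<mu>_def)
        have Eu': "(\<integral>x. clip z (z + \<delta>) x \<partial>\<mu>) = z + \<delta> - Eu" and Ed': "(\<integral>x. clip (z - \<delta>) z x \<partial>\<mu>) = z - Ed"
          unfolding Eu_def Ed_def using ic[of z "z + \<delta>"] ic[of "z - \<delta>" z] \<delta>(1)
          using \<mu>.prob_space by simp_all
        have dev: "\<bar>Su - real n * (z + \<delta> - Eu)\<bar> < \<theta> n" "\<bar>Sd - real n * (z - Ed)\<bar> < \<theta> n"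
          using \<omega> by (auto simp: up_def down_def Su_def Sd_def Eu' Ed' \<delta>_def[symmetric])
        have su: "(\<Sum>k=1..n. z + \<delta> - clip z (z + \<delta>) (X (int k) \<omega>)) = real n * (z + \<delta>) - Su"
          and sd: "(\<Sum>k=1..n. z - clip (z - \<delta>) z (X (int k) \<omega>)) = real n * z - Sd"
          by (simp_all add: Su_def Sd_def sum_subtractf)
        \<comment> \<open>The quarter is one half times one half: only half of the interval is used,
          and \<open>cdf \<mu>\<close> has grown there over half of its length.\<close>
        have Eu1: "\<delta> * p + c1 * \<delta>\<^sup>2 / 4 \<le> Eu"
        proof -
          have "c1 * (\<delta> / 2) \<le> cdf \<mu> (z + \<delta> / 2) - p"
            using lip[of "z + \<delta> / 2"] mono[of z "z + \<delta> / 2"] Fz \<delta> by simp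
          then have "\<delta> / 2 * (p + (p + c1 * (\<delta> / 2))) \<le> \<delta> / 2 * (cdf \<mu> z + cdf \<mu> (z + \<delta> / 2))"
            using \<delta> Fz by (intro mult_left_mono) auto
          also have "\<dots> \<le> Eu" unfolding Eu_def by (rule \<mu>.expectation_clip_bounds(1)[OF \<delta>(1)])
          finally show ?thesis by (simp add: algebra_simps power2_eq_square)
        qed
        have Eu2: "Eu \<le> \<delta> * p + C1 * \<delta>\<^sup>2"
        proof -
          have "cdf \<mu> (z + \<delta>) \<le> p + C1 * \<delta>"
            using lip[of "z + \<delta>"] mono[of z "z + \<delta>"] Fz \<delta> by simp
          then have "\<delta> * cdf \<mu> (z + \<delta>) \<le> \<delta> * (p + C1 * \<delta>)"
            using \<delta> by (intro mult_left_mono) auto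
          then show ?thesis
            using \<mu>.expectation_clip_bounds(2)[OF \<delta>(1), of z] by (simp add: Eu_def algebra_simps power2_eq_square)
        qed
        have Ed1: "Ed \<le> \<delta> * p - c1 * \<delta>\<^sup>2 / 4"
        proof -
          have "cdf \<mu> (z - \<delta> / 2) \<le> p - c1 * (\<delta> / 2)"
            using lip[of "z - \<delta> / 2"] mono[of "z - \<delta> / 2" z] Fz \<delta> by simp
          then have "\<delta> / 2 * (cdf \<mu> z + cdf \<mu> (z - \<delta> / 2)) \<le> \<delta> / 2 * (p + (p - c1 * (\<delta> / 2)))"
            using \<delta> Fz by (intro mult_left_mono) auto
          with \<mu>.expectation_clip_bounds(4)[OF \<delta>(1), of z] show ?thesis
            by (simp add: Ed_def algebra_simps power2_eq_square)
        qed
        have Ed2: "\<delta> * p - C1 * \<delta>\<^sup>2 \<le> Ed"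
        proof -
          have "p - C1 * \<delta> \<le> cdf \<mu> (z - \<delta>)"
            using lip[of "z - \<delta>"] mono[of "z - \<delta>" z] Fz \<delta> by simp
          then have "\<delta> * (p - C1 * \<delta>) \<le> \<delta> * cdf \<mu> (z - \<delta>)"
            using \<delta> by (intro mult_left_mono) auto
          then show ?thesis
            using \<mu>.expectation_clip_bounds(3)[OF \<delta>(1), of z] by (simp add: Ed_def algebra_simps power2_eq_square)
        qed
        let ?q = "\<eta>\<^sup>2 * sqrt (real n)"
        have nEu: "real n * (\<delta> * p) + c1 * ?q / 4 \<le> real n * Eu" "real n * Eu \<le> real n * (\<delta> * p) + C1 * ?q"
          and nEd: "real n * Ed \<le> real n * (\<delta> * p) - c1 * ?q / 4" "real n * (\<delta> * p) - C1 * ?q \<le> real n * Ed"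
          using mult_left_mono[OF Eu1, of "real n"] mult_left_mono[OF Eu2, of "real n"]
            mult_left_mono[OF Ed1, of "real n"] mult_left_mono[OF Ed2, of "real n"] n
          unfolding n\<delta>[symmetric] by (simp_all add: algebra_simps)
        have md: "real m * \<delta> \<le> real n * (\<delta> * p)" "real n * (\<delta> * p) - \<delta> \<le> real m * \<delta>"
          using mult_right_mono[OF m(1), of \<delta>] mult_right_mono[OF less_imp_le[OF m(2)], of \<delta>] \<delta>(1)
          by (simp_all add: algebra_simps)
        have \<theta>_eq: "\<theta> n = c1 * ?q / 8" by (simp add: \<theta>_def)
        have \<delta>q: "\<delta> \<le> c1 * ?q / 8"
        proof -
          have "c1 * \<eta>\<^sup>2 * 1 \<le> c1 * \<eta>\<^sup>2 * sqrt (real n)"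
            by (rule mult_left_mono[OF n(2)]) (use c1 in simp)
          then show ?thesis using \<delta>(4) by (simp only: mult.assoc)
        qed
        have nu: "real n * (z + \<delta> - Eu) = real n * (z + \<delta>) - real n * Eu" "real n * (z - Ed) = real n * z - real n * Ed"
          by (simp_all add: algebra_simps)
        have c1q: "0 \<le> c1 * ?q" using c1 n by simp
        have up: "0 \<le> real n * (z + \<delta>) - Su - real m * \<delta>" "real n * (z + \<delta>) - Su - real m * \<delta> \<le> \<delta> + (C1 * ?q + c1 * ?q)"
          using dev(1) nEu md \<theta>_eq nu(1) c1q unfolding abs_less_iff by linarith+
        have down: "0 \<le> real m * \<delta> - (real n * z - Sd)" "real m * \<delta> - (real n * z - Sd) \<le> \<delta> + (C1 * ?q + c1 * ?q)"
          using dev(2) nEd md \<theta>_eq nu(2) c1q \<delta>q \<delta>(1) unfolding abs_less_iff by linarith+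
        have "remainder p z n \<omega> \<le> max (real m * \<delta> - (real n * z - Sd)) (real n * (z + \<delta>) - Su - real m * \<delta>)"
          using partial_sum_remainder_le[OF m(3) m0 \<delta>(1), of z X \<omega>] up down
          unfolding su sd remainder_def m_def[symmetric] by simp
        then have "remainder p z n \<omega> \<le> \<delta> + (C1 * ?q + c1 * ?q)" using up down by simp
        also have "C1 * ?q + c1 * ?q = (C1 + c1) * \<eta>\<^sup>2 * sqrt (real n)"
          by (simp add: algebra_simps)
        also have "\<delta> + (C1 + c1) * \<eta>\<^sup>2 * sqrt (real n) \<le> \<epsilon> / 4 * sqrt (real n) + \<epsilon> / 4 * sqrt (real n)"
        proof -
          have "\<epsilon> / 4 * 1 \<le> \<epsilon> / 4 * sqrt (real n)"
            by (rule mult_left_mono[OF n(2)]) (use \<epsilon> in simp)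
          then show ?thesis unfolding \<eta>(2) using \<delta>(5) by linarith
        qed
        also have "\<dots> < \<epsilon> * sqrt (real n)" using \<epsilon> n by simp
        finally have "remainder p z n \<omega> < \<epsilon> * sqrt (real n)" .
        moreover have "0 \<le> remainder p z n \<omega>"
          using partial_sum_ge[OF m(3), of z X \<omega>] by (simp add: remainder_def m_def)
        ultimately show False
          using \<omega>(1) n by (simp add: abs_divide less_divide_eq)
      qed
    qed
    moreover have "P.prob (up n \<union> down n) \<le> P.prob (up n) + P.prob (down n)"
      unfolding up_def down_def by (rule measure_Un_le) measurable
    ultimately show ?case by linarith
  qed
  \<comment> \<open>The square of \<open>\<theta> n\<close> is proportional to \<open>n\<close>,
    which cancels the factor \<open>n\<close> of the variance; what remains is a constant times
    \<open>w n\<close>.\<close>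
  have b: "\<forall>\<^sub>F n in sequentially. suminf c * w n / 2 / (c1 * \<eta>\<^sup>2 / 8)\<^sup>2 = bound n"
    using eventually_gt_at_top[of 0]
  proof eventually_elim
    case (elim n)
    have "(\<theta> n)\<^sup>2 = (c1 * \<eta>\<^sup>2 / 8)\<^sup>2 * real n"
      by (simp add: \<theta>_def power_mult_distrib power_divide)
    then show ?case using elim by (simp add: bound_def)
  qed
  have "(\<lambda>n. suminf c * w n / 2 / (c1 * \<eta>\<^sup>2 / 8)\<^sup>2) \<longlonglongrightarrow> suminf c * 0 / 2 / (c1 * \<eta>\<^sup>2 / 8)\<^sup>2"
    using c1 \<eta>(1) by (intro tendsto_intros w_lim) auto
  then have "bound \<longlonglongrightarrow> 0"
    using Lim_transform_eventually[OF _ b] by simp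
  then have "(\<lambda>n. 2 * bound n) \<longlonglongrightarrow> 0" by (rule tendsto_mult_right_zero)
  then show "(\<lambda>n. P.prob {\<omega>\<in>space P. \<epsilon> < \<bar>remainder p z n \<omega> / sqrt (real n)\<bar>}) \<longlonglongrightarrow> 0"
    by (rule tendsto_sandwich[OF _ ev tendsto_const, rotated]) simp
qed

end

subsection \<open>The trimmed mean of a causal process\<close>

lemma real_distribution_normal_distribution: "real_distribution (normal_distribution \<mu> \<sigma>)" if "0 \<le> \<sigma>"
proof (cases "\<sigma> = 0")
  case True
  interpret prob_space "return borel \<mu>" by (rule prob_space_return) simp
  show ?thesis
    unfolding normal_distribution_def using True by (simp add: real_distribution_def real_distribution_axioms_def prob_space_axioms)
next
  case False
  interpret prob_space "density lborel (normal_density \<mu> \<sigma>)"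
    using False that by (intro prob_space_normal_density) simp
  show ?thesis
    unfolding normal_distribution_def using False by (simp add: real_distribution_def real_distribution_axioms_def prob_space_axioms)
qed

lemma char_normal_distribution:
  assumes "0 \<le> \<sigma>"
  shows "char (normal_distribution 0 \<sigma>) t = exp (- (\<sigma>\<^sup>2 * t\<^sup>2 / 2))"
proof (cases "\<sigma> = 0")
  case True
  then show ?thesis by (simp add: normal_distribution_def char_def integral_return)
next
  case False
  with assms have \<sigma>: "0 < \<sigma>" by simp
  interpret N: prob_space std_normal_distribution by (rule prob_space_normal_density) simp
  have "distributed std_normal_distribution lborel (\<lambda>x. x) (normal_density 0 1)"
    by (simp add: distributed_def distr_id2)
  from N.normal_density_affine[OF this zero_less_one, of \<sigma> 0] \<sigma>
  have "distributed std_normal_distribution lborel (\<lambda>x. \<sigma> * x) (normal_density 0 \<sigma>)"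
    by simp
  then have "normal_distribution 0 \<sigma> = distr std_normal_distribution lborel (\<lambda>x. \<sigma> * x)"
    using False by (simp add: normal_distribution_def distributed_def)
  then have "char (normal_distribution 0 \<sigma>) t = (CLINT x|std_normal_distribution. iexp (t * (\<sigma> * x)))"
    unfolding char_def by (simp add: integral_distr)
  also have "\<dots> = char std_normal_distribution (t * \<sigma>)"
    by (simp add: char_def mult.assoc)
  finally show ?thesis
    by (simp add: char_std_normal_distribution power_mult_distrib mult.commute)
qed

lemma measurable_partial_sum:
  assumes "\<And>k. X k \<in> borel_measurable M" "m \<le> n"
  shows "partial_sum X n m \<in> borel_measurable M"
  unfolding partial_sum_def[abs_def]
proof (rule borel_measurable_sum)
  fix j assume "j \<in> {..<m}"
  then show "(\<lambda>\<omega>. order_statistics X n \<omega> ! j) \<in> borel_measurable M"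
    using measurable_order_statistics[of X M "Suc j" n] assms by simp
qed

lemma trimmed_mean_eq:
  assumes "0 \<le> p\<^sub>0" "p\<^sub>0 \<le> p\<^sub>1" "p\<^sub>1 \<le> 1"
  shows "trimmed_mean p\<^sub>0 p\<^sub>1 X n \<omega> =
    (partial_sum X n (trim_index p\<^sub>1 n) \<omega> - partial_sum X n (trim_index p\<^sub>0 n) \<omega>)
      / (real (trim_index p\<^sub>1 n) - real (trim_index p\<^sub>0 n))"
  unfolding trimmed_mean_def
  by (subst sum_quantile_empirical_cdf) (use assms trim_index_le[of p\<^sub>1 n] trim_index_mono[of p\<^sub>0 p\<^sub>1 n] in auto)

lemma measurable_trimmed_mean:
  assumes "\<And>k. X k \<in> borel_measurable M" and "0 \<le> p\<^sub>0" "p\<^sub>0 \<le> p\<^sub>1" "p\<^sub>1 \<le> 1"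
  shows "trimmed_mean p\<^sub>0 p\<^sub>1 X n \<in> borel_measurable M"
proof -
  have [measurable]: "partial_sum X n (trim_index p n) \<in> borel_measurable M" if "0 \<le> p" "p \<le> 1" for p
    by (rule measurable_partial_sum[OF assms(1) trim_index_le[OF that]])
  have [measurable]: "partial_sum X n (trim_index p\<^sub>0 n) \<in> borel_measurable M"
    "partial_sum X n (trim_index p\<^sub>1 n) \<in> borel_measurable M"
    using assms by (auto intro!: measurable_partial_sum trim_index_le)
  show ?thesis
    unfolding trimmed_mean_eq[OF assms(2-4), abs_def] by measurable
qed

text \<open>Algebra only. By the formula for \<open>I\<close> the multiples of \<open>A\<close> and
  \<open>B\<close> of order \<open>n\<close> cancel. Besides the main term there remain a
  deterministic part from rounding, the two remainders, and the effect of \<open>\<theta>\<close>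
  differing from \<open>\<rho>\<close>.\<close>

lemma trimmed_mean_decomposition:
  fixes A B I E :: real
  assumes n: "0 < n" and d: "0 < d" and I: "I = E + (p\<^sub>1 - 1) * B - p\<^sub>0 * A"
    and T: "T = (b * B - a * A - (real n * B - S) + (R1 - R0)) / d"
  defines "\<theta> \<equiv> real n / d"
  shows "sqrt (real n) * (T - \<rho> * I) - \<rho> * ((S - real n * E) / sqrt (real n))
    = (sqrt (real n) * (\<theta> - \<rho>) * I + \<theta> * ((b - real n * p\<^sub>1) * B - (a - real n * p\<^sub>0) * A) / sqrt (real n))
      + (\<theta> * (R1 / sqrt (real n)) + (- \<theta>) * (R0 / sqrt (real n)))
      + (\<theta> - \<rho>) * ((S - real n * E) / sqrt (real n))"
proof -
  define s where "s = sqrt (real n)"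
  have s: "0 < s" "real n = s * s" using n by (simp_all add: s_def)
  have \<theta>: "\<theta> = s * s / d" by (simp add: \<theta>_def s(2))
  define w where "w = (S - s * s * E) / s"
  have sw: "s * w = S - s * s * E" using s(1) by (simp add: w_def)
  define \<kappa> where "\<kappa> = (b - s * s * p\<^sub>1) * B - (a - s * s * p\<^sub>0) * A"
  have "b * B - a * A - (s * s * B - S) + (R1 - R0) = s * s * I + \<kappa> + s * w + (R1 - R0)"
    unfolding sw by (simp add: I \<kappa>_def algebra_simps)
  then have "s * T = \<theta> * (s * s * I + \<kappa> + s * w + (R1 - R0)) / s"
    using s(1) d by (simp add: T \<theta> s(2))
  also have "\<dots> = \<theta> * (s * I) + \<theta> * \<kappa> / s + \<theta> * w + \<theta> * (R1 / s) - \<theta> * (R0 / s)"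
    using s(1) by (simp add: field_simps)
  finally have "s * T = \<theta> * (s * I) + \<theta> * \<kappa> / s + \<theta> * w + \<theta> * (R1 / s) - \<theta> * (R0 / s)" .
  then show ?thesis
    unfolding s_def[symmetric] unfolding s(2) w_def[symmetric] \<kappa>_def[symmetric]
    by (simp add: right_diff_distrib left_diff_distrib mult_ac)
qed

text \<open>The two roundings move \<open>d\<close> by at most 1 from
  \<open>n * (p\<^sub>1 - p\<^sub>0)\<close>. Once that number is at least 2, \<open>d\<close> is at
  least half of it, which is the source of the factors 2.\<close>

lemma trim_ratio_bounds:
  assumes p: "0 \<le> p\<^sub>0" "p\<^sub>0 < p\<^sub>1" and n: "2 / (p\<^sub>1 - p\<^sub>0) \<le> real n"
  defines "d \<equiv> real (trim_index p\<^sub>1 n) - real (trim_index p\<^sub>0 n)" and "\<rho> \<equiv> 1 / (p\<^sub>1 - p\<^sub>0)"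
  shows "0 < d" "\<bar>real n / d - \<rho>\<bar> \<le> 2 * \<rho>\<^sup>2 / real n" "0 \<le> real n / d" "real n / d \<le> 2 * \<rho>"
proof -
  define D where "D = p\<^sub>1 - p\<^sub>0"
  have D: "0 < D" using p by (simp add: D_def)
  have nD: "2 \<le> real n * D" using n D by (simp add: D_def[symmetric] pos_divide_le_eq)
  have n0: "0 < real n" using nD D by (cases "n = 0") auto
  have dd: "\<bar>d - real n * D\<bar> \<le> 1"
    using trim_index_bounds[of p\<^sub>0 n] trim_index_bounds[of p\<^sub>1 n] p
    by (simp add: d_def D_def right_diff_distrib abs_le_iff)
  then have dn: "real n * D / 2 \<le> d" using nD by linarith
  then show d: "0 < d" using nD by linarith
  have \<rho>: "\<rho> = 1 / D" by (simp add: \<rho>_def D_def)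
  show "0 \<le> real n / d" using d by simp
  show "real n / d \<le> 2 * \<rho>"
    using dn d D by (simp add: \<rho> field_simps)
  have "real n / d - \<rho> = (real n * D - d) / (d * D)"
    using d D by (simp add: \<rho> field_simps)
  then have "\<bar>real n / d - \<rho>\<bar> = \<bar>real n * D - d\<bar> / (d * D)"
    using d D by (simp add: abs_mult)
  also have "\<dots> \<le> 1 / (d * D)"
    using dd d D by (intro divide_right_mono) (auto simp: abs_minus_commute)
  also have "\<dots> \<le> 1 / (real n * D / 2 * D)"
    using dn n0 D d by (intro divide_left_mono mult_right_mono) auto
  also have "\<dots> = 2 * \<rho>\<^sup>2 / real n"
    using n0 D by (simp add: \<rho> power2_eq_square)
  finally show "\<bar>real n / d - \<rho>\<bar> \<le> 2 * \<rho>\<^sup>2 / real n" .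
qed

context causal_sequence
begin

lemma clip_mean_char_limit:
  assumes AB: "A \<le> B"
  defines "E \<equiv> \<integral>x. clip A B x \<partial>distr P borel (X 0)"
  defines "W \<equiv> \<lambda>n \<omega>. ((\<Sum>k=1..n. clip A B (X (int k) \<omega>)) - real n * E) / sqrt (real n)"
  shows "\<exists>\<sigma>\<ge>0. \<forall>t. (\<lambda>n. char (distr P borel (W n)) t) \<longlonglongrightarrow> exp (- (\<sigma>\<^sup>2 * t\<^sup>2 / 2))"
    and "\<exists>C. \<forall>n. integrable P (\<lambda>\<omega>. (W n \<omega>)\<^sup>2) \<and> P.expectation (\<lambda>\<omega>. (W n \<omega>)\<^sup>2) \<le> C"
proof -
  define L where "L = max 1 (B - A)"
  define h where "h x = clip A B x - E" for x
  have obs0: "observable L (\<bar>A\<bar> + \<bar>B\<bar>) (clip A B)" unfolding L_def by (rule observable_clip[OF AB])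
  have obs: "observable L (\<bar>A\<bar> + \<bar>B\<bar> + \<bar>E\<bar>) h"
    unfolding observable_def
  proof (intro conjI allI)
    show "\<bar>h x\<bar> \<le> \<bar>A\<bar> + \<bar>B\<bar> + \<bar>E\<bar>" for x
      using observableD(3)[OF obs0, of x] unfolding h_def by linarith
    show "\<bar>h x - h y\<bar> \<le> L * min 1 \<bar>x - y\<bar>" for x y
      using observableD(4)[OF obs0, of x y] by (simp add: h_def)
  qed (auto simp: h_def[abs_def] L_def)
  have centered: "P.expectation (Y h m) = 0" for m
  proof -
    have [measurable]: "clip A B \<in> borel_measurable borel" by measurable
    have "integrable P (\<lambda>\<omega>. clip A B (X (int m + 1) \<omega>))"
      by (rule integrable_bounded_P[OF _ observableD(3)[OF obs0]]) measurable
    moreover have "Y h m = (\<lambda>\<omega>. clip A B (X (int m + 1) \<omega>) - E)"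
      by (simp add: fun_eq_iff Y_def h_def)
    ultimately show ?thesis
      by (simp add: expectation_X P.prob_space E_def)
  qed
  have W: "W n = (\<lambda>\<omega>. (\<Sum>m<n. Y h m \<omega>) / sqrt (real n))" for n
    unfolding W_def sum_Y[symmetric] by (simp add: h_def sum_subtractf)
  show "\<exists>\<sigma>\<ge>0. \<forall>t. (\<lambda>n. char (distr P borel (W n)) t) \<longlonglongrightarrow> exp (- (\<sigma>\<^sup>2 * t\<^sup>2 / 2))"
    unfolding W by (rule char_limit[OF obs centered])
  show "\<exists>C. \<forall>n. integrable P (\<lambda>\<omega>. (W n \<omega>)\<^sup>2) \<and> P.expectation (\<lambda>\<omega>. (W n \<omega>)\<^sup>2) \<le> C"
  proof (intro exI allI conjI)
    fix n
    note [measurable] = measurable_Y[OF obs]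
    have i: "integrable P (\<lambda>\<omega>. (\<Sum>m<n. Y h m \<omega>)\<^sup>2)"
      by (rule integrable_bounded_square_P[OF _ abs_sum_Y_le[OF obs centered]]) measurable
    then show "integrable P (\<lambda>\<omega>. (W n \<omega>)\<^sup>2)"
      by (simp add: W power_divide)
    have "P.expectation (\<lambda>\<omega>. (W n \<omega>)\<^sup>2) = P.expectation (\<lambda>\<omega>. (\<Sum>m<n. Y h m \<omega>)\<^sup>2) / real n"
      by (simp add: W power_divide)
    also have "\<dots> \<le> real n * (L * suminf c)\<^sup>2 / real n"
      by (intro divide_right_mono second_moment_sum_le[OF obs centered]) simp
    also have "\<dots> \<le> (L * suminf c)\<^sup>2" by (cases "n = 0") auto
    finally show "P.expectation (\<lambda>\<omega>. (W n \<omega>)\<^sup>2) \<le> (L * suminf c)\<^sup>2" .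
  qed
qed

text \<open>The normalised trimmed mean and \<rho> times the normalised clip sum differ by a null
  sequence in probability, so they share the limiting characteristic function, and Levy's theorem
  converts it into weak convergence. The limiting deviation is \<open>\<rho> * \<sigma>\<close>,
  with \<sigma> belonging to the clip observable.\<close>

theorem trimmed_mean_clt_causal:
  assumes p: "0 < p\<^sub>0" "p\<^sub>0 < p\<^sub>1" "p\<^sub>1 < 1"
  defines "F \<equiv> marginal_cdf P X"
  assumes F: "F (quantile F p\<^sub>0) = p\<^sub>0" "F (quantile F p\<^sub>1) = p\<^sub>1"
    and reg: "regular_at F (quantile F p\<^sub>0)" "regular_at F (quantile F p\<^sub>1)"
  shows "\<exists>\<sigma>\<ge>0. trimmed_mean_clt p\<^sub>0 p\<^sub>1 P X \<sigma>"
proof -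
  define \<mu> where "\<mu> = distr P borel (X 0)"
  interpret \<mu>: real_distribution \<mu>
    unfolding \<mu>_def by (rule P.real_distribution_distr) measurable
  interpret \<mu>: cdf_distribution \<mu> ..
  have F_eq: "F = cdf \<mu>" by (simp add: F_def marginal_cdf_def \<mu>_def)
  define A where "A = quantile F p\<^sub>0"
  define B where "B = quantile F p\<^sub>1"
  have AB: "A \<le> B"
    using mono_onD[OF \<mu>.mono_I, of p\<^sub>0 p\<^sub>1] p by (simp add: A_def B_def quantile_def F_eq)
  define E where "E = (\<integral>x. clip A B x \<partial>distr P borel (X 0))"
  define I where "I = integral {p\<^sub>0..p\<^sub>1} (quantile F)"
  have I: "I = E + (p\<^sub>1 - 1) * B - p\<^sub>0 * A"
    using \<mu>.integral_quantile[of p\<^sub>0 p\<^sub>1] p by (simp add: I_def E_def A_def B_def F_eq \<mu>_def)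
  define W where "W n \<omega> = ((\<Sum>k=1..n. clip A B (X (int k) \<omega>)) - real n * E) / sqrt (real n)" for n \<omega>
  have [measurable]: "W n \<in> borel_measurable P" for n
    unfolding W_def[abs_def] by measurable
  obtain \<sigma> where \<sigma>: "0 \<le> \<sigma>" and W_char: "\<And>t. (\<lambda>n. char (distr P borel (W n)) t) \<longlonglongrightarrow> exp (- (\<sigma>\<^sup>2 * t\<^sup>2 / 2))"
    using clip_mean_char_limit(1)[OF AB] unfolding W_def[abs_def] E_def by blast
  obtain C where WC: "\<And>n. integrable P (\<lambda>\<omega>. (W n \<omega>)\<^sup>2)" "\<And>n. P.expectation (\<lambda>\<omega>. (W n \<omega>)\<^sup>2) \<le> C"
    using clip_mean_char_limit(2)[OF AB] unfolding W_def[abs_def] E_def by blast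
  define \<rho> where "\<rho> = 1 / (p\<^sub>1 - p\<^sub>0)"
  have \<rho>: "0 < \<rho>" using p by (simp add: \<rho>_def)
  define Z where "Z n \<omega> = sqrt (real n) * (trimmed_mean p\<^sub>0 p\<^sub>1 X n \<omega> - \<rho> * I)" for n \<omega>
  have [measurable]: "Z n \<in> borel_measurable P" for n
  proof -
    have [measurable]: "trimmed_mean p\<^sub>0 p\<^sub>1 X n \<in> borel_measurable P"
      using p by (intro measurable_trimmed_mean measurable_X) auto
    show ?thesis unfolding Z_def[abs_def] by measurable
  qed
  define a where "a n = trim_index p\<^sub>0 n" for n
  define b where "b n = trim_index p\<^sub>1 n" for n
  define d where "d n = real (b n) - real (a n)" for n
  define big where "big n \<longleftrightarrow> 2 / (p\<^sub>1 - p\<^sub>0) \<le> real n" for n :: nat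
  \<comment> \<open>For small \<open>n\<close> the divisor \<open>d n\<close> may be 0; the value
    \<rho> keeps the bounds valid for every \<open>n\<close>.\<close>
  define \<theta> where "\<theta> n = (if big n then real n / d n else \<rho>)" for n
  have bigD: "0 < d n" "0 < n" "\<theta> n = real n / d n" if "big n" for n
    using trim_ratio_bounds(1)[of p\<^sub>0 p\<^sub>1 n] that p
    by (auto simp: big_def d_def a_def b_def \<theta>_def intro!: Nat.gr0I)
  have \<theta>_diff: "\<bar>\<theta> n - \<rho>\<bar> \<le> 2 * \<rho>\<^sup>2 / real n" for n
    using trim_ratio_bounds(2)[of p\<^sub>0 p\<^sub>1 n] p by (auto simp: \<theta>_def big_def d_def a_def b_def \<rho>_def)
  have \<theta>_abs: "\<bar>\<theta> n\<bar> \<le> 2 * \<rho>" for n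
    using trim_ratio_bounds(3,4)[of p\<^sub>0 p\<^sub>1 n] p \<rho> by (auto simp: \<theta>_def big_def d_def a_def b_def \<rho>_def)
  have big: "\<forall>\<^sub>F n in sequentially. big n"
    using filterlim_real_sequentially by (simp add: big_def filterlim_at_top)
  define \<kappa> where "\<kappa> n = (real (b n) - real n * p\<^sub>1) * B - (real (a n) - real n * p\<^sub>0) * A" for n
  have \<kappa>: "\<bar>\<kappa> n\<bar> \<le> \<bar>A\<bar> + \<bar>B\<bar>" for n
  proof -
    have "\<bar>real (b n) - real n * p\<^sub>1\<bar> \<le> 1" "\<bar>real (a n) - real n * p\<^sub>0\<bar> \<le> 1"
      using trim_index_bounds[of p\<^sub>0 n] trim_index_bounds[of p\<^sub>1 n] p by (auto simp: a_def b_def)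
    then have "\<bar>(real (b n) - real n * p\<^sub>1) * B\<bar> \<le> 1 * \<bar>B\<bar>" "\<bar>(real (a n) - real n * p\<^sub>0) * A\<bar> \<le> 1 * \<bar>A\<bar>"
      unfolding abs_mult by (intro mult_right_mono; simp)+
    then show ?thesis unfolding \<kappa>_def by linarith
  qed
  define x where "x n = sqrt (real n) * (\<theta> n - \<rho>) * I + \<theta> n * \<kappa> n / sqrt (real n)" for n
  have inv_sqrt: "(\<lambda>n. K / sqrt (real n)) \<longlonglongrightarrow> 0" for K :: real
    by (intro tendsto_divide_0[OF tendsto_const] filterlim_at_top_imp_at_infinity
        filterlim_compose[OF sqrt_at_top filterlim_real_sequentially])
  have x: "x \<longlonglongrightarrow> 0"
  proof (rule Lim_null_comparison)
    show "(\<lambda>n. (2 * \<rho>\<^sup>2 * \<bar>I\<bar> + 2 * \<rho> * (\<bar>A\<bar> + \<bar>B\<bar>)) / sqrt (real n)) \<longlonglongrightarrow> 0"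
      by (rule inv_sqrt)
    show "\<forall>\<^sub>F n in sequentially. norm (x n) \<le> (2 * \<rho>\<^sup>2 * \<bar>I\<bar> + 2 * \<rho> * (\<bar>A\<bar> + \<bar>B\<bar>)) / sqrt (real n)"
    proof (intro always_eventually allI)
      fix n
      have "\<bar>sqrt (real n) * (\<theta> n - \<rho>) * I\<bar> \<le> sqrt (real n) * (2 * \<rho>\<^sup>2 / real n) * \<bar>I\<bar>"
        unfolding abs_mult abs_of_nonneg[OF real_sqrt_ge_zero[OF of_nat_0_le_iff]]
        by (intro mult_right_mono mult_left_mono \<theta>_diff) auto
      also have "\<dots> = 2 * \<rho>\<^sup>2 * \<bar>I\<bar> * (sqrt (real n) / real n)"
        by simp
      also have "sqrt (real n) / real n = 1 / sqrt (real n)"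
        by (cases "n = 0") (simp_all add: sqrt_divide_self_eq inverse_eq_divide)
      finally have 1: "\<bar>sqrt (real n) * (\<theta> n - \<rho>) * I\<bar> \<le> 2 * \<rho>\<^sup>2 * \<bar>I\<bar> / sqrt (real n)" by simp
      have "\<bar>\<theta> n * \<kappa> n\<bar> \<le> 2 * \<rho> * (\<bar>A\<bar> + \<bar>B\<bar>)"
        unfolding abs_mult using \<theta>_abs[of n] \<kappa>[of n] \<rho> by (intro mult_mono) auto
      then have 2: "\<bar>\<theta> n * \<kappa> n / sqrt (real n)\<bar> \<le> 2 * \<rho> * (\<bar>A\<bar> + \<bar>B\<bar>) / sqrt (real n)"
        unfolding abs_divide by (simp add: divide_right_mono)
      show "norm (x n) \<le> (2 * \<rho>\<^sup>2 * \<bar>I\<bar> + 2 * \<rho> * (\<bar>A\<bar> + \<bar>B\<bar>)) / sqrt (real n)"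
        using 1 2 unfolding x_def real_norm_def add_divide_distrib by linarith
    qed
  qed
  define R where "R p z n \<omega> = remainder p z n \<omega> / sqrt (real n)" for p z n \<omega>
  have R_meas: "R p z n \<in> borel_measurable P" if "0 \<le> p" "p \<le> 1" for p z n
  proof -
    have [measurable]: "partial_sum X n (trim_index p n) \<in> borel_measurable P"
      using that by (intro measurable_partial_sum trim_index_le measurable_X)
    show ?thesis
      unfolding R_def[abs_def] remainder_def ramp_sum_def by measurable
  qed
  have [measurable]: "R p\<^sub>0 A n \<in> borel_measurable P" "R p\<^sub>1 B n \<in> borel_measurable P" for n
    using p by (auto intro!: R_meas)
  have R_null: "P.null_in_prob (R p\<^sub>0 A)" "P.null_in_prob (R p\<^sub>1 B)"
    unfolding R_def[abs_def] using p F reg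
    by (auto intro!: remainder_null simp: A_def B_def F_eq \<mu>_def)
  have eq: "Z n \<omega> - \<rho> * W n \<omega> = x n + (\<theta> n * R p\<^sub>1 B n \<omega> + (- \<theta> n) * R p\<^sub>0 A n \<omega>) + (\<theta> n - \<rho>) * W n \<omega>"
    if "big n" for n \<omega>
  proof -
    let ?S = "\<Sum>k=1..n. clip A B (X (int k) \<omega>)"
    have ramp: "ramp_sum X n \<omega> B - ramp_sum X n \<omega> A = real n * B - ?S"
      by (simp add: ramp_sum_diff[OF AB] sum_subtractf)
    have T: "trimmed_mean p\<^sub>0 p\<^sub>1 X n \<omega> = (real (b n) * B - real (a n) * A - (real n * B - ?S)
        + (remainder p\<^sub>1 B n \<omega> - remainder p\<^sub>0 A n \<omega>)) / d n"
      using p unfolding ramp[symmetric] remainder_def a_def[symmetric] b_def[symmetric]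
      by (simp add: trimmed_mean_eq d_def a_def b_def)
    show ?thesis
      using trimmed_mean_decomposition[OF bigD(2,1)[OF that] I T, of \<rho>]
      by (simp only: Z_def W_def R_def x_def \<kappa>_def bigD(3)[OF that])
  qed
  have null: "P.null_in_prob (\<lambda>n \<omega>. Z n \<omega> - \<rho> * W n \<omega>)"
  proof (rule P.null_in_prob_cong)
    show "\<forall>\<^sub>F n in sequentially. \<forall>\<omega>\<in>space P. Z n \<omega> - \<rho> * W n \<omega>
        = x n + (\<theta> n * R p\<^sub>1 B n \<omega> + (- \<theta> n) * R p\<^sub>0 A n \<omega>) + (\<theta> n - \<rho>) * W n \<omega>"
      using big by eventually_elim (simp add: eq)
    have "P.null_in_prob (\<lambda>n \<omega>. (\<theta> n - \<rho>) * W n \<omega>)"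
    proof (rule P.null_in_prob_L2)
      show "integrable P (\<lambda>\<omega>. ((\<theta> n - \<rho>) * W n \<omega>)\<^sup>2)" for n
        unfolding power_mult_distrib by (intro integrable_mult_right WC)
      show "P.expectation (\<lambda>\<omega>. ((\<theta> n - \<rho>) * W n \<omega>)\<^sup>2) \<le> (2 * \<rho>\<^sup>2 / real n)\<^sup>2 * \<bar>C\<bar>" for n
      proof -
        have "(\<theta> n - \<rho>)\<^sup>2 \<le> (2 * \<rho>\<^sup>2 / real n)\<^sup>2"
          using power_mono[OF \<theta>_diff abs_ge_zero, of n 2] by simp
        moreover have "P.expectation (\<lambda>\<omega>. (W n \<omega>)\<^sup>2) \<le> \<bar>C\<bar>" using WC(2)[of n] by simp
        ultimately show ?thesis
          unfolding power_mult_distrib by (simp add: mult_mono)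
      qed
      have "(\<lambda>n. (2 * \<rho>\<^sup>2 / real n)\<^sup>2 * \<bar>C\<bar>) \<longlonglongrightarrow> 0\<^sup>2 * \<bar>C\<bar>"
        by (intro tendsto_intros lim_const_over_n)
      then show "(\<lambda>n. (2 * \<rho>\<^sup>2 / real n)\<^sup>2 * \<bar>C\<bar>) \<longlonglongrightarrow> 0" by simp
    qed measurable
    then show "P.null_in_prob (\<lambda>n \<omega>. x n + (\<theta> n * R p\<^sub>1 B n \<omega> + (- \<theta> n) * R p\<^sub>0 A n \<omega>) + (\<theta> n - \<rho>) * W n \<omega>)"
    proof (intro P.null_in_prob_add P.null_in_prob_const[OF x])
      show "P.null_in_prob (\<lambda>n \<omega>. \<theta> n * R p\<^sub>1 B n \<omega>)"
        by (rule P.null_in_prob_mult_bounded[OF _ R_null(2) \<theta>_abs]) measurable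
      show "P.null_in_prob (\<lambda>n \<omega>. - \<theta> n * R p\<^sub>0 A n \<omega>)"
        by (rule P.null_in_prob_mult_bounded[where r = "\<lambda>n. - \<theta> n" and B = "2 * \<rho>", OF _ R_null(1)]) (simp_all add: \<theta>_abs)
    qed measurable
  qed
  have "(\<lambda>n. char (distr P borel (Z n)) t) \<longlonglongrightarrow> char (normal_distribution 0 (\<rho> * \<sigma>)) t" for t
  proof (rule P.char_limit_null_in_prob[OF _ _ null])
    have "char (distr P borel (\<lambda>\<omega>. \<rho> * W n \<omega>)) t = char (distr P borel (W n)) (t * \<rho>)" for n
      by (simp add: P.char_distr_eq mult.assoc)
    moreover have "char (normal_distribution 0 (\<rho> * \<sigma>)) t = exp (- (\<sigma>\<^sup>2 * (t * \<rho>)\<^sup>2 / 2))"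
      using \<sigma> \<rho> by (simp add: char_normal_distribution power_mult_distrib mult_ac)
    ultimately show "(\<lambda>n. char (distr P borel (\<lambda>\<omega>. \<rho> * W n \<omega>)) t) \<longlonglongrightarrow> char (normal_distribution 0 (\<rho> * \<sigma>)) t"
      using W_char[of "t * \<rho>"] by simp
  qed measurable
  then have "weak_conv_m (\<lambda>n. distr P borel (Z n)) (normal_distribution 0 (\<rho> * \<sigma>))"
    using \<sigma> \<rho> by (intro levy_continuity P.real_distribution_distr real_distribution_normal_distribution) auto
  then have "trimmed_mean_clt p\<^sub>0 p\<^sub>1 P X (\<rho> * \<sigma>)"
    by (simp only: trimmed_mean_clt_def Z_def[abs_def] \<rho>_def I_def F_def)
  then show ?thesis using \<sigma> \<rho> by (intro exI[of _ "\<rho> * \<sigma>"]) simp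
qed

end

subsection \<open>Regular quantiles from a density\<close>

text \<open>To the left of the quantile the distribution function stays below \<open>p\<close>, and
  continuity passes this to the quantile itself; at a discontinuity the function could jump over
  \<open>p\<close>.\<close>

lemma (in real_distribution) cdf_quantile:
  assumes cont_at: "isCont (cdf M) (quantile (cdf M) p)" and p: "0 < p" "p < 1"
  shows "cdf M (quantile (cdf M) p) = p"
proof -
  interpret cdf_distribution M ..
  let ?z = "quantile (cdf M) p"
  have iff: "p \<le> cdf M x \<longleftrightarrow> ?z \<le> x" for x
    unfolding quantile_def by (rule pseudoinverse[OF p])
  have "cdf M ?z \<le> p"
  proof (rule tendsto_upperbound)
    show "(cdf M \<longlongrightarrow> cdf M ?z) (at_left ?z)"
      using cont_at unfolding isCont_def by (rule tendsto_within_subset) simp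
    show "\<forall>\<^sub>F x in at_left ?z. cdf M x \<le> p"
    proof (rule eventually_at_leftI)
      show "cdf M x \<le> p" if "x \<in> {?z - 1<..<?z}" for x
        using iff[of x] that by (cases "p \<le> cdf M x") simp_all
    qed simp
  qed simp
  moreover have "p \<le> cdf M ?z" by (rule iff[THEN iffD2]) simp
  ultimately show ?thesis by (rule antisym)
qed

lemma (in real_distribution) cdf_increment_bounds:
  assumes M: "M = density lborel (\<lambda>x. ennreal (f x))" and f: "f \<in> borel_measurable borel"
    and c: "0 \<le> c" "\<And>t. x \<le> t \<Longrightarrow> t \<le> y \<Longrightarrow> c \<le> f t" "\<And>t. x \<le> t \<Longrightarrow> t \<le> y \<Longrightarrow> f t \<le> C"
    and xy: "x \<le> y"
  shows "c * (y - x) \<le> cdf M y - cdf M x" "cdf M y - cdf M x \<le> C * (y - x)"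
proof -
  have C: "0 \<le> C" using c(1) c(2)[of x] c(3)[of x] xy by simp
  have eq: "cdf M y - cdf M x = measure M {x<..y}"
    using cdf_diff_eq[of x y] xy by (cases "x = y") auto
  have em: "emeasure M {x<..y} = (\<integral>\<^sup>+t. ennreal (f t) * indicator {x<..y} t \<partial>lborel)"
    unfolding M using f by (simp add: emeasure_density)
  have len: "(\<integral>\<^sup>+t. ennreal k * indicator {x<..y} t \<partial>lborel) = ennreal (k * (y - x))" if "0 \<le> k" for k
    using xy that by (simp add: nn_integral_cmult_indicator ennreal_mult)
  have "ennreal (c * (y - x)) \<le> emeasure M {x<..y}"
    unfolding em len[OF c(1), symmetric]
    by (intro nn_integral_mono) (auto simp: indicator_def intro!: ennreal_leI c)
  then show "c * (y - x) \<le> cdf M y - cdf M x"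
    unfolding eq emeasure_eq_measure by simp
  have "emeasure M {x<..y} \<le> ennreal (C * (y - x))"
    unfolding em len[OF C, symmetric]
    by (intro nn_integral_mono) (auto simp: indicator_def intro!: ennreal_leI c)
  then show "cdf M y - cdf M x \<le> C * (y - x)"
    unfolding eq emeasure_eq_measure using C xy by simp
qed

text \<open>Near \<open>z\<close> continuity keeps the density between half and twice
  \<open>f z\<close>, and integration gives both linear bounds.\<close>

lemma (in real_distribution) regular_at_density:
  assumes M: "M = density lborel (\<lambda>x. ennreal (f x))" and f: "f \<in> borel_measurable borel"
    and cont: "isCont f z" and pos: "0 < f z"
  shows "regular_at (cdf M) z"
proof -
  have "\<forall>\<^sub>F x in at z. dist (f x) (f z) < f z / 2"
    using cont pos by (intro tendstoD) (auto simp: isCont_def)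
  then obtain d where d: "0 < d" "\<And>x. x \<noteq> z \<Longrightarrow> \<bar>x - z\<bar> < d \<Longrightarrow> \<bar>f x - f z\<bar> < f z / 2"
    by (auto simp: eventually_at dist_real_def)
  have near: "f z / 2 \<le> f t \<and> f t \<le> 2 * f z" if "\<bar>t - z\<bar> < d" for t
  proof (cases "t = z")
    case False
    from d(2)[OF this that] show ?thesis using pos by linarith
  qed (use pos in simp)
  have "f z / 2 * \<bar>x - z\<bar> \<le> \<bar>cdf M x - cdf M z\<bar> \<and> \<bar>cdf M x - cdf M z\<bar> \<le> 2 * f z * \<bar>x - z\<bar>"
    if x: "\<bar>x - z\<bar> \<le> d / 2" for x
  proof (cases "z \<le> x")
    case True
    have "f z / 2 \<le> f t \<and> f t \<le> 2 * f z" if "z \<le> t" "t \<le> x" for t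
      using near[of t] that x d(1) by linarith
    from cdf_increment_bounds[OF M f, of "f z / 2" z x "2 * f z"] this True pos cdf_nondecreasing[OF True]
    show ?thesis by simp
  next
    case False
    have "f z / 2 \<le> f t \<and> f t \<le> 2 * f z" if "x \<le> t" "t \<le> z" for t
      using near[of t] that x d(1) by linarith
    from cdf_increment_bounds[OF M f, of "f z / 2" x z "2 * f z"] this False pos cdf_nondecreasing[of x z]
    show ?thesis by simp
  qed
  then show ?thesis
    unfolding regular_at_def using d(1) pos by (intro exI[of _ "f z / 2"] exI[of _ "2 * f z"] exI[of _ "d / 2"]) auto
qed

lemma regular_quantiles:
  assumes M: "prob_space M" and distributed: "distributed M lborel Z (\<lambda>x. ennreal (f x))"
    and f: "\<And>x. 0 \<le> f x" "\<And>x. isCont f x" and p: "0 < p\<^sub>0" "p\<^sub>0 < p\<^sub>1" "p\<^sub>1 < 1"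
    and inf: "0 < (INF p\<in>{p\<^sub>0..p\<^sub>1}. f (quantile (cdf (distr M borel Z)) p))"
    and q: "p\<^sub>0 \<le> q" "q \<le> p\<^sub>1"
  defines "F \<equiv> cdf (distr M borel Z)"
  shows "F (quantile F q) = q" "regular_at F (quantile F q)"
proof -
  interpret prob_space M by fact
  have Z [measurable]: "Z \<in> borel_measurable M"
    using distributed_measurable[OF distributed] by simp
  interpret \<mu>: real_distribution "distr M borel Z"
    by (rule real_distribution_distr[OF Z])
  have "distr M borel Z = distr M lborel Z" by (rule distr_cong) simp_all
  then have \<mu>: "distr M borel Z = density lborel (\<lambda>x. ennreal (f x))"
    using distributed_distr_eq_density[OF distributed] by simp
  have fm: "f \<in> borel_measurable borel"
    using f(2) by (intro borel_measurable_continuous_onI) (simp add: continuous_at_imp_continuous_on)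
  have "isCont F x" for x
  proof -
    have "emeasure (distr M borel Z) {x} = 0"
      unfolding \<mu> using fm by (simp add: emeasure_density nn_integral_null_set null_sets_def flip: nn_integral_restrict_space)
    then show ?thesis unfolding F_def \<mu>.isCont_cdf by (simp add: measure_def)
  qed
  then show "F (quantile F q) = q"
    unfolding F_def by (rule \<mu>.cdf_quantile) (use p q in auto)
  have "(INF p\<in>{p\<^sub>0..p\<^sub>1}. f (quantile F p)) \<le> f (quantile F q)"
    using q f(1) by (intro cINF_lower bdd_belowI[of _ 0]) auto
  then show "regular_at F (quantile F q)"
    unfolding F_def using inf by (intro \<mu>.regular_at_density[OF \<mu> fm f(2)]) simp
qed

subsection \<open>Transfer to the coordinate process\<close>

lemma causal_process_coord: "causal_process G \<epsilon> k \<omega> = causal_process G coord k (\<lambda>k. \<epsilon> k \<omega>)"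
  by (simp add: causal_process_def past_def coord_def)

lemma trimmed_mean_compose: "trimmed_mean p\<^sub>0 p\<^sub>1 (\<lambda>k \<omega>. X k (J \<omega>)) n \<omega> = trimmed_mean p\<^sub>0 p\<^sub>1 X n (J \<omega>)"
  by (simp add: trimmed_mean_def empirical_cdf_def[abs_def])

lemma iid_distr:
  assumes "prob_space M" and iid: "iid M S \<epsilon>" and D: "D = distr M S (\<epsilon> 0)"
  shows "iid_sequence D"
    and "(\<lambda>\<omega> k. \<epsilon> k \<omega>) \<in> M \<rightarrow>\<^sub>M PiM UNIV (\<lambda>_. S)"
    and "distr M (PiM UNIV (\<lambda>_. S)) (\<lambda>\<omega> k. \<epsilon> k \<omega>) = iid_sequence.P D"
    and "sets (iid_sequence.P D) = sets (PiM UNIV (\<lambda>_. S))"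
proof -
  interpret prob_space M by fact
  have rv: "\<epsilon> k \<in> M \<rightarrow>\<^sub>M S" for k
    using iid by (auto simp: iid_def indep_vars_def2)
  show I: "iid_sequence D"
    unfolding D iid_sequence_def by (rule prob_space_distr[OF rv])
  then interpret iid_sequence D .
  show "(\<lambda>\<omega> k. \<epsilon> k \<omega>) \<in> M \<rightarrow>\<^sub>M PiM UNIV (\<lambda>_. S)"
    by (rule measurable_PiM_single') (use measurable_space[OF rv] in \<open>auto intro: rv\<close>)
  have "distr M (PiM UNIV (\<lambda>_. S)) (\<lambda>\<omega>. \<lambda>k\<in>UNIV. \<epsilon> k \<omega>) = PiM UNIV (\<lambda>k. distr M S (\<epsilon> k))"
    using iid indep_vars_iff_distr_eq_PiM[where I = UNIV and M' = "\<lambda>_. S" and X = \<epsilon>] rv by (simp add: iid_def)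
  also have "\<dots> = P"
    unfolding P_def unfolding D using iid by (intro PiM_cong) (auto simp: iid_def)
  finally show "distr M (PiM UNIV (\<lambda>_. S)) (\<lambda>\<omega> k. \<epsilon> k \<omega>) = P"
    by (simp add: restrict_def)
  show "sets P = sets (PiM UNIV (\<lambda>_. S))"
    unfolding P_def unfolding D by (intro sets_PiM_cong) auto
qed

text \<open>Each trimmed mean is a measurable function of the innovations, so its law depends only
  on the law of the whole sequence.\<close>

lemma (in causal_map) trimmed_mean_clt_transfer:
  assumes J: "J \<in> M \<rightarrow>\<^sub>M P" "distr M P J = P"
    and p: "0 \<le> p\<^sub>0" "p\<^sub>0 \<le> p\<^sub>1" "p\<^sub>1 \<le> 1"
  shows "marginal_cdf M (\<lambda>k \<omega>. X k (J \<omega>)) = marginal_cdf P X"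
    and "trimmed_mean_clt p\<^sub>0 p\<^sub>1 M (\<lambda>k \<omega>. X k (J \<omega>)) \<sigma> \<longleftrightarrow> trimmed_mean_clt p\<^sub>0 p\<^sub>1 P X \<sigma>"
proof -
  have tr: "distr M borel (\<lambda>\<omega>. g (J \<omega>)) = distr P borel g" if "g \<in> borel_measurable P" for g :: "_ \<Rightarrow> real"
    using distr_distr[OF that J(1)] J(2) by (simp add: comp_def)
  show m: "marginal_cdf M (\<lambda>k \<omega>. X k (J \<omega>)) = marginal_cdf P X"
    using tr[OF measurable_X] by (simp add: marginal_cdf_def)
  have "distr M borel (\<lambda>\<omega>. sqrt (real n) * (trimmed_mean p\<^sub>0 p\<^sub>1 X n (J \<omega>) - c))
      = distr P borel (\<lambda>\<omega>. sqrt (real n) * (trimmed_mean p\<^sub>0 p\<^sub>1 X n \<omega> - c))" for n c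
  proof -
    have [measurable]: "trimmed_mean p\<^sub>0 p\<^sub>1 X n \<in> borel_measurable P"
      by (intro measurable_trimmed_mean measurable_X p)
    show ?thesis by (rule tr) measurable
  qed
  then show "trimmed_mean_clt p\<^sub>0 p\<^sub>1 M (\<lambda>k \<omega>. X k (J \<omega>)) \<sigma> \<longleftrightarrow> trimmed_mean_clt p\<^sub>0 p\<^sub>1 P X \<sigma>"
    unfolding trimmed_mean_clt_def m trimmed_mean_compose by simp
qed

text \<open>The common end of both cases, which differ in how \<open>causal_sequence\<close> is
  established.\<close>

lemma causal_process_clt:
  assumes M: "prob_space M" and iid: "iid M S \<epsilon>" and D: "D = distr M S (\<epsilon> 0)"
    and seq: "causal_sequence D G c"
    and distributed: "distributed M lborel (causal_process G \<epsilon> 0) (\<lambda>x. ennreal (f x))"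
    and f: "\<And>x. 0 \<le> f x" "\<And>x. isCont f x" and p: "0 < p\<^sub>0" "p\<^sub>0 < p\<^sub>1" "p\<^sub>1 < 1"
    and inf: "0 < (INF p\<in>{p\<^sub>0..p\<^sub>1}. f (quantile (marginal_cdf M (causal_process G \<epsilon>)) p))"
  shows "\<exists>\<sigma>\<ge>0. trimmed_mean_clt p\<^sub>0 p\<^sub>1 M (causal_process G \<epsilon>) \<sigma>"
proof -
  interpret causal_sequence D G c by (rule seq)
  note J = iid_distr[OF M iid D]
  let ?J = "\<lambda>\<omega> k. \<epsilon> k \<omega>"
  have Jm: "?J \<in> M \<rightarrow>\<^sub>M P"
    using J(2) by (simp add: measurable_cong_sets[OF refl J(4)])
  have "distr M P ?J = distr M (PiM UNIV (\<lambda>_. S)) ?J"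
    by (rule distr_cong) (simp_all add: J(4))
  then have Jd: "distr M P ?J = P" using J(3) by simp
  have X: "causal_process G \<epsilon> = (\<lambda>k \<omega>. X k (?J \<omega>))"
    by (intro ext causal_process_coord)
  have marginal: "marginal_cdf M (causal_process G \<epsilon>) = marginal_cdf P X"
    unfolding X by (rule trimmed_mean_clt_transfer(1)[OF Jm Jd, of p\<^sub>0 p\<^sub>1]) (use p in auto)
  have mc: "marginal_cdf M (causal_process G \<epsilon>) = cdf (distr M borel (causal_process G \<epsilon> 0))"
    by (rule marginal_cdf_def)
  note reg = regular_quantiles[OF M distributed f p inf[unfolded mc], folded mc, unfolded marginal]
  have "\<exists>\<sigma>\<ge>0. trimmed_mean_clt p\<^sub>0 p\<^sub>1 P X \<sigma>"
    using p by (intro trimmed_mean_clt_causal reg) auto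
  then show ?thesis
    unfolding X using trimmed_mean_clt_transfer(2)[OF Jm Jd, of p\<^sub>0 p\<^sub>1] p by auto
qed

subsection \<open>Geometric moment contraction\<close>

lemma min_one_le_powr:
  fixes x \<alpha> l :: real
  assumes "0 \<le> x" "0 < \<alpha>" "0 < l"
  shows "min 1 x \<le> l + x powr \<alpha> / l powr \<alpha>"
proof (cases "x \<le> l")
  case True
  then show ?thesis using assms by (simp add: min.coboundedI2 add_increasing2)
next
  case False
  then have "1 powr \<alpha> \<le> (x / l) powr \<alpha>" using assms by (intro powr_mono2) auto
  then have "1 \<le> x powr \<alpha> / l powr \<alpha>" using assms by (simp add: powr_divide)
  then show ?thesis using assms by (simp add: min.coboundedI1 add_increasing)
qed

context causal_map
begin

lemma gap_le_geometric:
  assumes "0 < \<alpha>" "0 < C" "0 < r" "r < 1"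
    and moment: "(\<integral>\<^sup>+z. ennreal (\<bar>X (int n) (fst z) - X (int n) (mix {0<..} (fst z) (snd z))\<bar> powr \<alpha>) \<partial>PP)
      \<le> ennreal (C * r ^ n)"
  defines "q \<equiv> max (r powr (1 / (2 * \<alpha>))) (r powr (1 / 2))"
  shows "gap n \<le> (1 + C) * q ^ n"
proof -
  define \<Delta> where "\<Delta> z = \<bar>X (int n) (fst z) - X (int n) (mix {0<..} (fst z) (snd z))\<bar>" for z
  have [measurable]: "\<Delta> \<in> borel_measurable PP" unfolding \<Delta>_def[abs_def] by measurable
  have int: "integrable PP (\<lambda>z. \<Delta> z powr \<alpha>)"
    using moment by (intro integrableI_nonneg) (auto simp: \<Delta>_def intro: le_less_trans)
  have "ennreal (\<integral>z. \<Delta> z powr \<alpha> \<partial>PP) \<le> ennreal (C * r ^ n)"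
    using moment nn_integral_eq_integral[OF int] by (simp add: \<Delta>_def)
  then have E: "(\<integral>z. \<Delta> z powr \<alpha> \<partial>PP) \<le> C * r ^ n"
    using assms by (subst (asm) ennreal_le_iff) auto
  \<comment> \<open>The threshold spends half of the geometric decay: \<open>l powr \<alpha>\<close>
    is \<open>r powr (n / 2)\<close>, so both terms of \<open>min_one_le_powr\<close> decay
    geometrically, and \<open>q\<close> is the slower of the two rates.\<close>
  define l where "l = r powr (real n / (2 * \<alpha>))"
  have l: "0 < l" using assms by (simp add: l_def)
  have "gap n = (\<integral>z. min 1 (\<Delta> z) \<partial>PP)" by (simp add: gap_def \<Delta>_def)
  also have "\<dots> \<le> (\<integral>z. l + \<Delta> z powr \<alpha> / l powr \<alpha> \<partial>PP)"
  proof (rule integral_mono)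
    show "integrable PP (\<lambda>z. min 1 (\<Delta> z))" unfolding \<Delta>_def by (rule integrable_gap)
    show "integrable PP (\<lambda>z. l + \<Delta> z powr \<alpha> / l powr \<alpha>)" using int by simp
    show "min 1 (\<Delta> z) \<le> l + \<Delta> z powr \<alpha> / l powr \<alpha>" for z
      by (rule min_one_le_powr) (use assms l in \<open>simp_all add: \<Delta>_def\<close>)
  qed
  also have "\<dots> = l + (\<integral>z. \<Delta> z powr \<alpha> \<partial>PP) / l powr \<alpha>"
    using int by (simp add: PP.prob_space)
  also have "\<dots> \<le> l + C * r ^ n / l powr \<alpha>"
    using E by (intro add_left_mono divide_right_mono) auto
  also have "C * r ^ n / l powr \<alpha> = C * r powr (real n / 2)"
  proof -
    have "l powr \<alpha> = r powr (real n / 2)"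
      using assms by (simp add: l_def powr_powr)
    moreover have "r ^ n = r powr (real n / 2) * r powr (real n / 2)"
      using assms by (simp flip: powr_add add: powr_realpow)
    ultimately show ?thesis using assms by simp
  qed
  also have "l = (r powr (1 / (2 * \<alpha>))) ^ n"
    using assms by (simp add: l_def powr_powr flip: powr_realpow)
  also have "r powr (real n / 2) = (r powr (1 / 2)) ^ n"
    using assms by (simp add: powr_powr flip: powr_realpow)
  also have "(r powr (1 / (2 * \<alpha>))) ^ n + C * (r powr (1 / 2)) ^ n \<le> q ^ n + C * q ^ n"
    using assms by (intro add_mono mult_left_mono power_mono) (auto simp: q_def)
  finally show ?thesis by (simp add: algebra_simps)
qed

text \<open>Replacing only \<open>\<epsilon>\<^sub>0\<close> is the difference of replacing all \<open>\<epsilon>\<^sub>k\<close> with \<open>k \<le> 0\<close> and replacing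
  those with \<open>k \<le> -1\<close>.\<close>

lemma coupling_le_gap:
  "(\<integral>z. (min 1 \<bar>X (int n) (fst z) - X (int n) (mix (-{0}) (fst z) (snd z))\<bar>)\<^sup>2 \<partial>PP) \<le> gap n + gap (Suc n)"
proof -
  define g where "g z = min 1 \<bar>X (int n) (fst z) - X (int n) (mix {0<..} (fst z) (snd z))\<bar>" for z
  define g' where "g' z = min 1 \<bar>X (int n) (fst z) - X (int n) (mix {-1<..} (fst z) (snd z))\<bar>" for z
  have [measurable]: "g \<in> borel_measurable PP" "g' \<in> borel_measurable PP"
    unfolding g_def[abs_def] g'_def[abs_def] by measurable
  \<comment> \<open>\<open>exchange (-{0})\<close> puts the sequence with refreshed entry 0 first.
    Refreshing its past up to -1 yields the same sequence as refreshing the past of the original up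
    to 0, so \<open>g\<close> and \<open>g'\<close> compare the two sequences with a common third
    one.\<close>
  have mix: "mix {-1<..} (mix (-{0}) \<omega> \<omega>') (mix (-{0}) \<omega>' \<omega>) = mix {0<..} \<omega> \<omega>'" for \<omega> \<omega>' :: "int \<Rightarrow> 'c"
    by (auto simp: mix_def)
  have i: "integrable PP g" "integrable PP (\<lambda>z. g' (exchange (-{0}) z))"
    by (auto intro!: integrable_bounded_PP[where K = 1] simp: g_def g'_def)
  have "(\<integral>z. (min 1 \<bar>X (int n) (fst z) - X (int n) (mix (-{0}) (fst z) (snd z))\<bar>)\<^sup>2 \<partial>PP)
      \<le> (\<integral>z. g z + g' (exchange (-{0}) z) \<partial>PP)"
  proof (rule integral_mono)
    show "(min 1 \<bar>X (int n) (fst z) - X (int n) (mix (-{0}) (fst z) (snd z))\<bar>)\<^sup>2 \<le> g z + g' (exchange (-{0}) z)" for z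
    proof -
      have sq: "(min 1 \<bar>u\<bar>)\<^sup>2 \<le> min 1 \<bar>u\<bar>" for u :: real
        using power_decreasing[of 1 2 "min 1 \<bar>u\<bar>"] by simp
      have tri: "min 1 \<bar>a - b\<bar> \<le> min 1 \<bar>a - m\<bar> + min 1 \<bar>b - m\<bar>" for a b m :: real
        by (auto simp: min_def)
      show ?thesis
        unfolding g_def g'_def exchange_def fst_conv snd_conv mix by (rule order_trans[OF sq tri])
    qed
  qed (use i in \<open>simp_all add: integrable_gap\<close>)
  also have "\<dots> = (\<integral>z. g z \<partial>PP) + (\<integral>z. g' (exchange (-{0}) z) \<partial>PP)"
    using i by simp
  also have "(\<integral>z. g' (exchange (-{0}) z) \<partial>PP) = (\<integral>z. g' z \<partial>PP)"
    by (rule integral_exchange) measurable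
  also have "(\<integral>z. g' z \<partial>PP) = gap (Suc n)"
    using gap_shift[of "-1" "int n"] by (simp add: g'_def nat_add_distrib)
  finally show ?thesis by (simp add: g_def gap_def)
qed

lemma causal_sequence_geometric:
  assumes "0 < \<alpha>" "0 < C" "0 < r" "r < 1"
    and moment: "\<And>n. (\<integral>\<^sup>+z. ennreal (\<bar>X (int n) (fst z) - X (int n) (mix {0<..} (fst z) (snd z))\<bar> powr \<alpha>) \<partial>PP)
      \<le> ennreal (C * r ^ n)"
  shows "\<exists>c. causal_sequence D G c"
proof -
  define q where "q = max (r powr (1 / (2 * \<alpha>))) (r powr (1 / 2))"
  have q: "0 < q" "q < 1"
    using assms powr_less_mono2[of "1 / (2 * \<alpha>)" r 1] powr_less_mono2[of "1 / 2" r 1]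
    by (auto simp: q_def less_max_iff_disj)
  have gap: "gap n \<le> (1 + C) * q ^ n" for n
    unfolding q_def by (rule gap_le_geometric[OF assms(1-4) moment])
  \<comment> \<open>The coupling bound is a square, so the rate is \<open>sqrt q\<close>; the 2
    collects the two gaps.\<close>
  define c where "c n = sqrt (2 * (1 + C)) * sqrt q ^ n" for n
  have "causal_sequence D G c"
  proof
    show "summable c"
      unfolding c_def using q by (intro summable_mult summable_geometric) simp
    show "0 \<le> c n" for n
      using assms q by (simp add: c_def)
    show "(\<integral>z. (min 1 \<bar>X (int n) (fst z) - X (int n) (mix (-{0}) (fst z) (snd z))\<bar>)\<^sup>2 \<partial>PP) \<le> (c n)\<^sup>2" for n
    proof -
      have "q ^ Suc n \<le> q ^ n" using q by (intro power_decreasing) auto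
      then have "(1 + C) * q ^ Suc n \<le> (1 + C) * q ^ n" using assms by (intro mult_left_mono) auto
      then have "gap n + gap (Suc n) \<le> 2 * ((1 + C) * q ^ n)"
        using gap[of n] gap[of "Suc n"] by linarith
      also have "q ^ n = (sqrt q ^ n)\<^sup>2"
      proof -
        have "(sqrt q ^ n)\<^sup>2 = ((sqrt q)\<^sup>2) ^ n" by (simp only: power_mult[symmetric] mult.commute)
        then show ?thesis using q by simp
      qed
      also have "2 * ((1 + C) * (sqrt q ^ n)\<^sup>2) = (c n)\<^sup>2"
        using assms by (simp add: c_def power_mult_distrib)
      finally show ?thesis using coupling_le_gap[of n] by linarith
    qed
    show "gap \<longlonglongrightarrow> 0"
    proof (rule tendsto_sandwich[OF _ _ tendsto_const])
      have "(\<lambda>n. (1 + C) * q ^ n) \<longlonglongrightarrow> (1 + C) * 0"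
        using q by (intro tendsto_intros LIMSEQ_power_zero) simp
      then show "(\<lambda>n. (1 + C) * q ^ n) \<longlonglongrightarrow> 0" by simp
    qed (simp_all add: gap gap_nonneg)
  qed
  then show ?thesis by blast
qed

end

subsection \<open>Linear processes\<close>

text \<open>The constant 4 is \<open>2 powr 2\<close>: the difference is at most twice the larger
  modulus, and \<open>\<gamma> \<le> 2\<close>.\<close>

lemma abs_diff_powr_le:
  fixes x y \<alpha> \<gamma> :: real
  assumes "0 < \<gamma>" "\<gamma> \<le> 2" "\<gamma> \<le> \<alpha>"
  shows "\<bar>x - y\<bar> powr \<gamma> \<le> 4 * (1 + \<bar>x\<bar> powr \<alpha> + \<bar>y\<bar> powr \<alpha>)"
proof -
  define m where "m = max \<bar>x\<bar> \<bar>y\<bar>"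
  have m: "0 \<le> m" "\<bar>x - y\<bar> \<le> 2 * m" by (auto simp: m_def)
  have "\<bar>x - y\<bar> powr \<gamma> \<le> (2 * m) powr \<gamma>" using m assms by (intro powr_mono2) auto
  also have "\<dots> = 2 powr \<gamma> * m powr \<gamma>" using m by (simp add: powr_mult)
  also have "\<dots> \<le> 2 powr 2 * (1 + m powr \<alpha>)"
  proof (intro mult_mono powr_mono)
    show "m powr \<gamma> \<le> 1 + m powr \<alpha>"
    proof (cases "m \<le> 1")
      case True
      then have "m powr \<gamma> \<le> 1 powr \<gamma>" using m assms by (intro powr_mono2) auto
      then show ?thesis by (simp add: add_increasing2)
    next
      case False
      then have "m powr \<gamma> \<le> m powr \<alpha>" using assms by (intro powr_mono) auto
      then show ?thesis by simp
    qed
  qed (use assms in auto)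
  also have "m powr \<alpha> \<le> \<bar>x\<bar> powr \<alpha> + \<bar>y\<bar> powr \<alpha>"
    by (simp add: m_def max_def)
  finally show ?thesis by simp
qed

lemma square_min_one_le_powr:
  fixes x \<gamma> :: real
  assumes "0 \<le> x" "0 < \<gamma>" "\<gamma> \<le> 2"
  shows "(min 1 x)\<^sup>2 \<le> x powr \<gamma>"
proof (cases "x = 0")
  case False
  then have x: "0 < x" using assms by simp
  show ?thesis
  proof (cases "x \<le> 1")
    case True
    have "x\<^sup>2 = x powr 2" using x by (simp add: powr_numeral)
    also have "\<dots> \<le> x powr \<gamma>" using x True assms by (intro powr_mono') auto
    finally show ?thesis using True by (simp add: min_absorb2)
  next
    case False
    then show ?thesis using ge_one_powr_ge_zero[of x \<gamma>] assms by (simp add: min_absorb1)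
  qed
qed simp

context iid_sequence
begin

lemma AE_fst_PP:
  assumes "AE \<omega> in P. Q \<omega>"
  shows "AE z in PP. Q (fst z)"
proof (rule AE_distrD[of fst PP P Q])
  show "AE \<omega> in distr PP P fst. Q \<omega>" unfolding P.distr_pair_fst by (rule assms)
qed measurable

lemma AE_snd_PP:
  assumes "AE \<omega> in P. Q \<omega>"
  shows "AE z in PP. Q (snd z)"
proof (rule AE_distrD[of snd PP P Q])
  have "distr PP P snd = P" using distr_mix[of "{}"] by simp
  then show "AE \<omega> in distr PP P snd. Q \<omega>" using assms by metis
qed measurable

end

text \<open>Refreshing innovation 0 changes \<open>X n\<close> by exactly \<open>a n\<close> times
  the difference of the two innovations, so the truncated second moment is at most a multiple of
  \<open>\<bar>a n\<bar> powr \<gamma>\<close>. With \<gamma> twice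
  \<open>min (\<alpha> / 2) 1\<close>, its root has the exponent of
  \<open>summable_a\<close>.\<close>

lemma causal_sequence_linear:
  fixes a :: "nat \<Rightarrow> real"
  assumes D: "prob_space D" "sets D = sets borel"
    and summable_AE: "AE \<omega> in iid_sequence.P D. summable (\<lambda>i. a i * \<omega> (- int i))"
    and \<alpha>: "0 < \<alpha>" and moment: "integrable D (\<lambda>x. \<bar>x\<bar> powr \<alpha>)"
    and summable_a: "summable (\<lambda>i. \<bar>a (Suc i)\<bar> powr min (\<alpha> / 2) 1)"
  shows "\<exists>c. causal_sequence D (\<lambda>x. \<Sum>i. a i * x i) c"
proof -
  interpret prob_space D by fact
  interpret iid_sequence D ..
  have coord_borel: "(\<lambda>x. x i) \<in> borel_measurable (PiM UNIV (\<lambda>_::nat. D))" for i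
    using measurable_component_singleton[of i UNIV "\<lambda>_. D"]
    by (simp add: measurable_cong_sets[OF refl D(2)])
  interpret causal_map D "\<lambda>x. \<Sum>i. a i * x i"
    by unfold_locales (use coord_borel in measurable)
  have coord [measurable]: "(\<lambda>\<omega>. \<omega> k) \<in> borel_measurable P" for k
    using measurable_coordinate[of k] by (simp add: measurable_cong_sets[OF refl D(2)])
  define S where "S k \<omega> \<longleftrightarrow> summable (\<lambda>i. a i * \<omega> (k - int i))" for k and \<omega> :: "int \<Rightarrow> real"
  have S_meas [measurable]: "Measurable.pred P (S k)" for k
  proof -
    \<comment> \<open>The Cauchy property is a countable condition on the partial sums and hence
      measurable.\<close>
    have "S k \<omega> \<longleftrightarrow> Cauchy (\<lambda>n. \<Sum>i<n. a i * \<omega> (k - int i))" for \<omega>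
      unfolding S_def summable_iff_convergent Cauchy_convergent_iff ..
    then show ?thesis unfolding pred_def by simp
  qed
  have S_AE: "AE \<omega> in P. S k \<omega>" for k
  proof -
    have "AE \<omega> in distr P P (shift k). S 0 \<omega>"
      unfolding distr_shift using summable_AE by (simp add: S_def)
    from AE_distrD[OF measurable_shift this] show ?thesis
      by (simp add: S_def shift_def)
  qed
  have S_fst: "AE z in PP. S k (fst z)" and S_snd: "AE z in PP. S k (snd z)" for k
    by (auto intro!: AE_fst_PP AE_snd_PP S_AE)
  define \<gamma> where "\<gamma> = 2 * min (\<alpha> / 2) 1"
  have \<gamma>: "0 < \<gamma>" "\<gamma> \<le> 2" "\<gamma> \<le> \<alpha>" using \<alpha> by (auto simp: \<gamma>_def)
  define E where "E = (\<integral>x. \<bar>x\<bar> powr \<alpha> \<partial>D)"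
  have coord_distr: "distr P D (\<lambda>\<omega>. \<omega> 0) = D"
    unfolding P_def by (rule distr_PiM_component) (auto intro: D(1))
  have D_meas: "(\<lambda>x. \<bar>x\<bar> powr \<alpha>) \<in> borel_measurable D"
    using moment by (rule borel_measurable_integrable)
  have i0: "integrable P (\<lambda>\<omega>. \<bar>\<omega> 0\<bar> powr \<alpha>)"
    using moment integrable_distr_eq[OF measurable_coordinate D_meas, of 0] by (simp add: coord_distr)
  have e0: "P.expectation (\<lambda>\<omega>. \<bar>\<omega> 0\<bar> powr \<alpha>) = E"
    using integral_distr[OF measurable_coordinate D_meas, of 0] by (simp add: coord_distr E_def)
  have i_fst: "integrable PP (\<lambda>z. \<bar>fst z 0\<bar> powr \<alpha>)"
    using i0 integrable_distr_eq[of fst PP P "\<lambda>\<omega>. \<bar>\<omega> 0\<bar> powr \<alpha>"] by (simp add: P.distr_pair_fst)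
  have i_snd: "integrable PP (\<lambda>z. \<bar>snd z 0\<bar> powr \<alpha>)"
    using i0 integrable_distr_eq[of snd PP P "\<lambda>\<omega>. \<bar>\<omega> 0\<bar> powr \<alpha>"] distr_mix[of "{}"] by simp
  define B where "B z = 4 * (1 + \<bar>fst z 0\<bar> powr \<alpha> + \<bar>snd z 0\<bar> powr \<alpha>)" for z :: "(int \<Rightarrow> real) \<times> (int \<Rightarrow> real)"
  have iB: "integrable PP B" unfolding B_def using i_fst i_snd by simp
  define K where "K = 4 * (1 + 2 * E)"
  have EB: "(\<integral>z. B z \<partial>PP) = K"
    using i_fst i_snd integral_fst_PP[of "\<lambda>\<omega>. \<bar>\<omega> 0\<bar> powr \<alpha>"] integral_snd_PP[of "\<lambda>\<omega>. \<bar>\<omega> 0\<bar> powr \<alpha>"]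
    by (simp add: B_def K_def e0 PP.prob_space)
  have K0: "0 \<le> K" by (simp add: K_def E_def)
  define c where "c n = sqrt K * \<bar>a n\<bar> powr (\<gamma> / 2)" for n
  have "causal_sequence D (\<lambda>x. \<Sum>i. a i * x i) c"
  proof
    show "summable c"
      using summable_a unfolding c_def \<gamma>_def
      by (intro summable_mult) (simp add: summable_Suc_iff[of "\<lambda>i. \<bar>a i\<bar> powr min (\<alpha> / 2) 1"])
    show "0 \<le> c n" for n by (simp add: c_def K0)
    show "(\<integral>z. (min 1 \<bar>X (int n) (fst z) - X (int n) (mix (-{0}) (fst z) (snd z))\<bar>)\<^sup>2 \<partial>PP) \<le> (c n)\<^sup>2" for n
    proof -
      have "(\<integral>z. (min 1 \<bar>X (int n) (fst z) - X (int n) (mix (-{0}) (fst z) (snd z))\<bar>)\<^sup>2 \<partial>PP)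
          \<le> (\<integral>z. \<bar>a n\<bar> powr \<gamma> * B z \<partial>PP)"
      proof (rule integral_mono_AE)
        show "AE z in PP. (min 1 \<bar>X (int n) (fst z) - X (int n) (mix (-{0}) (fst z) (snd z))\<bar>)\<^sup>2 \<le> \<bar>a n\<bar> powr \<gamma> * B z"
          using S_fst[of "int n"]
        proof eventually_elim
          case (elim z)
          define u where "u i = a i * fst z (int n - int i)" for i
          define v where "v i = a i * mix (-{0}) (fst z) (snd z) (int n - int i)" for i
          have uv: "u i - v i = (if i = n then a n * (fst z 0 - snd z 0) else 0)" for i
            by (auto simp: u_def v_def mix_apply algebra_simps)
          have u: "summable u" using elim by (simp add: S_def u_def[abs_def])
          have s: "(\<lambda>i. u i - v i) sums (a n * (fst z 0 - snd z 0))"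
            unfolding uv by (rule sums_single)
          \<comment> \<open>\<open>v\<close> differs from \<open>u\<close> at index \<open>n\<close>
            only, so almost sure convergence for the first copy suffices.\<close>
          have v: "summable v"
            using summable_diff[OF u sums_summable[OF s]] by simp
          from s have "suminf u - suminf v = a n * (fst z 0 - snd z 0)"
            using suminf_diff[OF u v] sums_unique by metis
          then have X: "X (int n) (fst z) - X (int n) (mix (-{0}) (fst z) (snd z)) = a n * (fst z 0 - snd z 0)"
            by (simp add: X_eq u_def[abs_def] v_def[abs_def])
          have "(min 1 \<bar>a n * (fst z 0 - snd z 0)\<bar>)\<^sup>2 \<le> \<bar>a n * (fst z 0 - snd z 0)\<bar> powr \<gamma>"
            by (rule square_min_one_le_powr) (use \<gamma> in auto)
          also have "\<dots> = \<bar>a n\<bar> powr \<gamma> * \<bar>fst z 0 - snd z 0\<bar> powr \<gamma>"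
            by (simp add: abs_mult powr_mult)
          also have "\<dots> \<le> \<bar>a n\<bar> powr \<gamma> * B z"
            unfolding B_def by (intro mult_left_mono abs_diff_powr_le \<gamma>) simp
          finally show ?case unfolding X .
        qed
      qed (use iB in \<open>simp_all add: integrable_gap\<close>)
      also have "\<bar>a n\<bar> powr \<gamma> = (\<bar>a n\<bar> powr (\<gamma> / 2))\<^sup>2"
        by (simp add: power2_eq_square flip: powr_add)
      also have "(\<integral>z. (\<bar>a n\<bar> powr (\<gamma> / 2))\<^sup>2 * B z \<partial>PP) = (c n)\<^sup>2"
        using K0 by (simp add: EB c_def power_mult_distrib mult.commute)
      finally show ?thesis .
    qed
    show "gap \<longlonglongrightarrow> 0"
    proof -
      \<comment> \<open>By stationarity \<open>gap n\<close> is computed at time 0 with the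
        replacement receding into the past. For the fixed variable \<open>X 0\<close> the tails of
        two convergent series then vanish pointwise, and the constant 1 dominates.\<close>
      define g where "g n z = min 1 \<bar>X 0 (fst z) - X 0 (mix {- int n<..} (fst z) (snd z))\<bar>" for n z
      have "(\<lambda>n. \<integral>z. g n z \<partial>PP) \<longlonglongrightarrow> (\<integral>z. 0 \<partial>PP)"
      proof (rule integral_dominated_convergence[where w = "\<lambda>_. 1"])
        show "AE z in PP. (\<lambda>n. g n z) \<longlonglongrightarrow> 0"
          using S_fst[of 0] S_snd[of 0]
        proof eventually_elim
          case (elim z)
          define u where "u i = a i * fst z (- int i)" for i
          define v where "v i = a i * snd z (- int i)" for i
          have uv: "summable u" "summable v" using elim by (simp_all add: S_def u_def[abs_def] v_def[abs_def])
          have diff: "X 0 (fst z) - X 0 (mix {- int n<..} (fst z) (snd z))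
              = (suminf u - (\<Sum>i<n. u i)) - (suminf v - (\<Sum>i<n. v i))" for n
          proof -
            define w where "w i = (if i < n then u i else v i)" for i
            have w_eq: "(\<lambda>i. a i * mix {- int n<..} (fst z) (snd z) (- int i)) = w"
              by (auto simp: w_def u_def v_def mix_apply)
            have tail: "(\<lambda>i. w (i + n)) = (\<lambda>i. v (i + n))" by (simp add: w_def)
            have w: "summable w"
              using summable_iff_shift[of w n] summable_iff_shift[of v n] uv(2) unfolding tail by simp
            have "suminf w = (\<Sum>i. w (i + n)) + (\<Sum>i<n. w i)"
              by (rule suminf_split_initial_segment[OF w])
            also have "(\<Sum>i<n. w i) = (\<Sum>i<n. u i)"
              by (intro sum.cong) (auto simp: w_def)
            also have "(\<Sum>i. w (i + n)) = suminf v - (\<Sum>i<n. v i)"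
              unfolding tail using suminf_split_initial_segment[OF uv(2), of n] by simp
            finally show ?thesis
              by (simp add: X_eq w_eq u_def[abs_def])
          qed
          have "(\<lambda>n. (suminf u - (\<Sum>i<n. u i)) - (suminf v - (\<Sum>i<n. v i))) \<longlonglongrightarrow> (suminf u - suminf u) - (suminf v - suminf v)"
            by (intro tendsto_intros summable_LIMSEQ uv)
          then have "(\<lambda>n. \<bar>(suminf u - (\<Sum>i<n. u i)) - (suminf v - (\<Sum>i<n. v i))\<bar>) \<longlonglongrightarrow> 0"
            by (intro tendsto_rabs_zero) simp
          from tendsto_min[OF tendsto_const[of 1] this] show ?case
            unfolding g_def diff by simp
        qed
      qed (auto simp: g_def)
      moreover have "(\<integral>z. g n z \<partial>PP) = gap n" for n
        using gap_shift[of "- int n" 0] by (simp add: g_def)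
      ultimately show ?thesis by (simp add: tendsto_cong)
    qed
  qed
  then show ?thesis by blast
qed

section \<open>Application to the two classes of processes\<close>

lemma linear_process_eq: "linear_process a \<epsilon> = causal_process (\<lambda>x. \<Sum>i. a i * x i) \<epsilon>"
  by (intro ext) (simp add: linear_process_def causal_process_def past_def)

lemma AE_summable_coord:
  assumes M: "prob_space M" "iid M borel \<epsilon>"
    and summable_AE: "AE \<omega> in M. summable (\<lambda>i. a i * \<epsilon> (0 - int i) \<omega> :: real)"
  shows "AE x in iid_sequence.P (distr M borel (\<epsilon> 0)). summable (\<lambda>i. a i * x (- int i))"
proof -
  note J = iid_distr[OF M refl]
  let ?PB = "PiM UNIV (\<lambda>_::int. borel :: real measure)"
  have "{x \<in> space ?PB. Cauchy (\<lambda>n. \<Sum>i<n. a i * x (- int i))} \<in> sets ?PB"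
    by measurable
  then have "{x \<in> space ?PB. summable (\<lambda>i. a i * x (- int i))} \<in> sets ?PB"
    unfolding summable_iff_convergent Cauchy_convergent_iff .
  from AE_distr_iff[OF J(2) this] summable_AE show ?thesis
    unfolding J(3)[symmetric] by simp
qed

text \<open>Independence makes the joint law of the two sequences the product of their laws, and
  equal marginals make both factors \<open>P\<close>; this carries the contraction hypothesis to the
  canonical space.\<close>

lemma nn_integral_independent_copies:
  assumes M: "prob_space M" and \<epsilon>: "iid M S \<epsilon>" and \<epsilon>': "iid M S \<epsilon>'"
    and same: "distr M S (\<epsilon>' 0) = distr M S (\<epsilon> 0)"
    and indep: "prob_space.indep_var M (PiM UNIV (\<lambda>_. S)) (\<lambda>\<omega> k. \<epsilon> k \<omega>) (PiM UNIV (\<lambda>_. S)) (\<lambda>\<omega> k. \<epsilon>' k \<omega>)"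
    and D: "D = distr M S (\<epsilon> 0)"
    and g: "g \<in> borel_measurable (iid_sequence.P D \<Otimes>\<^sub>M iid_sequence.P D)"
  shows "(\<integral>\<^sup>+z. g z \<partial>(iid_sequence.P D \<Otimes>\<^sub>M iid_sequence.P D)) = (\<integral>\<^sup>+\<omega>. g (\<lambda>k. \<epsilon> k \<omega>, \<lambda>k. \<epsilon>' k \<omega>) \<partial>M)"
proof -
  interpret prob_space M by fact
  note J = iid_distr[OF M \<epsilon> D]
  note J' = iid_distr[OF M \<epsilon>' D[folded same]]
  let ?S = "PiM UNIV (\<lambda>_::int. S)"
  let ?P = "iid_sequence.P D"
  have eq: "?P \<Otimes>\<^sub>M ?P = distr M (?S \<Otimes>\<^sub>M ?S) (\<lambda>\<omega>. (\<lambda>k. \<epsilon> k \<omega>, \<lambda>k. \<epsilon>' k \<omega>))"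
    using indep unfolding indep_var_distribution_eq J(3) J'(3) by simp
  have sets: "sets (?P \<Otimes>\<^sub>M ?P) = sets (?S \<Otimes>\<^sub>M ?S)"
    by (intro sets_pair_measure_cong J(4))
  have "(\<integral>\<^sup>+z. g z \<partial>(?P \<Otimes>\<^sub>M ?P)) = (\<integral>\<^sup>+z. g z \<partial>distr M (?S \<Otimes>\<^sub>M ?S) (\<lambda>\<omega>. (\<lambda>k. \<epsilon> k \<omega>, \<lambda>k. \<epsilon>' k \<omega>)))"
    by (simp only: eq)
  also have "\<dots> = (\<integral>\<^sup>+\<omega>. g (\<lambda>k. \<epsilon> k \<omega>, \<lambda>k. \<epsilon>' k \<omega>) \<partial>M)"
    using g J(2) J'(2)
    by (intro nn_integral_distr measurable_Pair) (simp_all add: measurable_cong_sets[OF sets refl])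
  finally show ?thesis .
qed

lemma coupled_eq_mix:
  "causal_process G (coupled \<epsilon> \<epsilon>') k \<omega> = causal_process G coord k (mix {0<..} (\<lambda>k. \<epsilon> k \<omega>) (\<lambda>k. \<epsilon>' k \<omega>))"
proof -
  have "(\<lambda>k. coupled \<epsilon> \<epsilon>' k \<omega>) = mix {0<..} (\<lambda>k. \<epsilon> k \<omega>) (\<lambda>k. \<epsilon>' k \<omega>)"
    by (auto simp: coupled_def mix_def)
  then show ?thesis by (subst causal_process_coord) simp
qed

lemma linear_process_trimmed_mean_clt:
  assumes M: "prob_space M" and iid: "iid M borel \<epsilon>"
    and summable_AE: "\<And>k. AE \<omega> in M. summable (\<lambda>i. a i * \<epsilon> (k - int i) \<omega>)"
    and distributed: "distributed M lborel (linear_process a \<epsilon> 0) (\<lambda>x. ennreal (f x))"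
    and f: "\<And>x. 0 \<le> f x" "continuous_on UNIV f" and p: "0 < p\<^sub>0" "p\<^sub>0 < p\<^sub>1" "p\<^sub>1 < 1"
    and inf: "0 < (INF p\<in>{p\<^sub>0..p\<^sub>1}. f (quantile (marginal_cdf M (linear_process a \<epsilon>)) p))"
    and \<alpha>: "0 < \<alpha>" and moment: "\<And>k. integrable M (\<lambda>\<omega>. \<bar>\<epsilon> k \<omega>\<bar> powr \<alpha>)"
    and summable_a: "summable (\<lambda>i. \<bar>a (Suc i)\<bar> powr min (\<alpha> / 2) 1)"
  shows "\<exists>\<sigma>\<ge>0. trimmed_mean_clt p\<^sub>0 p\<^sub>1 M (linear_process a \<epsilon>) \<sigma>"
proof -
  define D where "D = distr M borel (\<epsilon> 0)"
  interpret prob_space M by fact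
  have \<epsilon>: "\<epsilon> 0 \<in> borel_measurable M"
    using iid by (auto simp: iid_def indep_vars_def2)
  have "\<exists>c. causal_sequence D (\<lambda>x. \<Sum>i. a i * x i) c"
  proof (rule causal_sequence_linear[OF _ _ _ \<alpha> _ summable_a])
    show "prob_space D" unfolding D_def by (rule prob_space.prob_space_distr[OF M \<epsilon>])
    show "AE \<omega> in iid_sequence.P D. summable (\<lambda>i. a i * \<omega> (- int i))"
      unfolding D_def by (rule AE_summable_coord[OF M iid summable_AE])
    show "integrable D (\<lambda>x. \<bar>x\<bar> powr \<alpha>)"
      unfolding D_def using moment[of 0] \<epsilon> by (subst integrable_distr_eq) auto
  qed (simp add: D_def)
  then obtain c where "causal_sequence D (\<lambda>x. \<Sum>i. a i * x i) c" ..
  moreover have "isCont f x" for x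
    using f(2) by (simp add: continuous_on_eq_continuous_at)
  ultimately show ?thesis
    using distributed inf unfolding linear_process_eq
    by (intro causal_process_clt[OF M iid D_def _ _ f(1) _ p]) auto
qed

lemma contracting_process_trimmed_mean_clt:
  assumes M: "prob_space M" and iid: "iid M S \<epsilon>" "iid M S \<epsilon>'"
    and same: "distr M S (\<epsilon>' 0) = distr M S (\<epsilon> 0)"
    and indep: "prob_space.indep_var M (PiM UNIV (\<lambda>_. S)) (\<lambda>\<omega> k. \<epsilon> k \<omega>) (PiM UNIV (\<lambda>_. S)) (\<lambda>\<omega> k. \<epsilon>' k \<omega>)"
    and G: "G \<in> borel_measurable (PiM UNIV (\<lambda>_. S))"
    and distributed: "distributed M lborel (causal_process G \<epsilon> 0) (\<lambda>x. ennreal (f x))"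
    and f: "\<And>x. 0 \<le> f x" "\<And>x. isCont f x" and p: "0 < p\<^sub>0" "p\<^sub>0 < p\<^sub>1" "p\<^sub>1 < 1"
    and inf: "0 < (INF p\<in>{p\<^sub>0..p\<^sub>1}. f (quantile (marginal_cdf M (causal_process G \<epsilon>)) p))"
    and C: "0 < \<alpha>" "0 < C" "0 < r" "r < 1"
    and moment: "\<And>n::nat. (\<integral>\<^sup>+\<omega>. ennreal (\<bar>causal_process G \<epsilon> (int n) \<omega>
        - causal_process G (coupled \<epsilon> \<epsilon>') (int n) \<omega>\<bar> powr \<alpha>) \<partial>M) \<le> ennreal (C * r ^ n)"
  shows "\<exists>\<sigma>\<ge>0. trimmed_mean_clt p\<^sub>0 p\<^sub>1 M (causal_process G \<epsilon>) \<sigma>"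
proof -
  define D where "D = distr M S (\<epsilon> 0)"
  interpret iid_sequence D by (rule iid_distr(1)[OF M iid(1) D_def])
  have sets: "sets (PiM UNIV (\<lambda>_::nat. D)) = sets (PiM UNIV (\<lambda>_. S))"
    unfolding D_def by (intro sets_PiM_cong) auto
  interpret causal_map D G
    by unfold_locales (use G in \<open>simp only: measurable_cong_sets[OF sets refl]\<close>)
  have "(\<integral>\<^sup>+z. ennreal (\<bar>X (int n) (fst z) - X (int n) (mix {0<..} (fst z) (snd z))\<bar> powr \<alpha>) \<partial>PP)
      \<le> ennreal (C * r ^ n)" for n
    using moment[of n]
    by (subst nn_integral_independent_copies[OF M iid same indep D_def])
       (simp_all add: causal_process_coord[of G \<epsilon>] coupled_eq_mix)
  then obtain c where "causal_sequence D G c"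
    using causal_sequence_geometric[OF C] by blast
  then show ?thesis
    by (rule causal_process_clt[OF M iid(1) D_def _ distributed f p inf])
qed

theorem theorem5:
  fixes p\<^sub>0 p\<^sub>1 :: real
  assumes "0 < p\<^sub>0" and "p\<^sub>0 < p\<^sub>1" and "p\<^sub>1 < 1"
  shows
    "(\<forall>(M :: 'a measure) (\<epsilon> :: int \<Rightarrow> 'a \<Rightarrow> real) (a :: nat \<Rightarrow> real)
        (f\<^sub>\<epsilon> :: real \<Rightarrow> real) (f :: real \<Rightarrow> real) (\<alpha> :: real).
        prob_space M \<and> iid M borel \<epsilon> \<and>
        distributed M lborel (\<epsilon> 0) (\<lambda>x. ennreal (f\<^sub>\<epsilon> x)) \<and> (\<forall>x. 0 \<le> f\<^sub>\<epsilon> x) \<and>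
        (\<forall>x. f\<^sub>\<epsilon> differentiable at x) \<and> (\<forall>x. deriv f\<^sub>\<epsilon> differentiable at x) \<and>
        a 0 = 1 \<and>
        (\<forall>k. AE \<omega> in M. summable (\<lambda>i. a i * \<epsilon> (k - int i) \<omega>)) \<and>
        distributed M lborel (linear_process a \<epsilon> 0) (\<lambda>x. ennreal (f x)) \<and> (\<forall>x. 0 \<le> f x) \<and>
        continuous_on UNIV f \<and>
        bdd_above (range (\<lambda>x. f\<^sub>\<epsilon> x + \<bar>deriv f\<^sub>\<epsilon> x\<bar>)) \<and>
        bdd_above (range (\<lambda>x. \<bar>deriv (deriv f\<^sub>\<epsilon>) x\<bar>)) \<and>
        0 < (INF p\<in>{p\<^sub>0..p\<^sub>1}. f (quantile (marginal_cdf M (linear_process a \<epsilon>)) p)) \<and>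
        0 < \<alpha> \<and>
        (\<forall>k. integrable M (\<lambda>\<omega>. \<bar>\<epsilon> k \<omega>\<bar> powr \<alpha>)) \<and>
        summable (\<lambda>i. \<bar>a (Suc i)\<bar> powr min (\<alpha> / 2) 1)
        \<longrightarrow> (\<exists>\<sigma>\<ge>0. trimmed_mean_clt p\<^sub>0 p\<^sub>1 M (linear_process a \<epsilon>) \<sigma>))
     \<and>
     (\<forall>(M :: 'b measure) (S :: 'c measure) (\<epsilon> :: int \<Rightarrow> 'b \<Rightarrow> 'c) (\<epsilon>' :: int \<Rightarrow> 'b \<Rightarrow> 'c)
        (G :: (nat \<Rightarrow> 'c) \<Rightarrow> real) (f :: real \<Rightarrow> real) (\<alpha> :: real) (C :: real) (r :: real).
        prob_space M \<and> iid M S \<epsilon> \<and> iid M S \<epsilon>' \<and>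
        (\<forall>k. distr M S (\<epsilon>' k) = distr M S (\<epsilon> 0)) \<and>
        prob_space.indep_var M
          (PiM UNIV (\<lambda>_. S)) (\<lambda>\<omega> k. \<epsilon> k \<omega>) (PiM UNIV (\<lambda>_. S)) (\<lambda>\<omega> k. \<epsilon>' k \<omega>) \<and>
        G \<in> borel_measurable (PiM UNIV (\<lambda>_. S)) \<and>
        distributed M lborel (causal_process G \<epsilon> 0) (\<lambda>x. ennreal (f x)) \<and> (\<forall>x. 0 \<le> f x) \<and>
        0 < \<alpha> \<and> 0 < C \<and> 0 < r \<and> r < 1 \<and>
        (\<forall>n::nat.
          (\<integral>\<^sup>+\<omega>. ennreal (\<bar>causal_process G \<epsilon> (int n) \<omega>
                      - causal_process G (coupled \<epsilon> \<epsilon>') (int n) \<omega>\<bar> powr \<alpha>) \<partial>M)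
          \<le> ennreal (C * r ^ n)) \<and>
        (\<forall>x. f differentiable at x) \<and>
        bdd_above (range (\<lambda>x. f x + \<bar>deriv f x\<bar>)) \<and>
        0 < (INF p\<in>{p\<^sub>0..p\<^sub>1}. f (quantile (marginal_cdf M (causal_process G \<epsilon>)) p))
        \<longrightarrow> (\<exists>\<sigma>\<ge>0. trimmed_mean_clt p\<^sub>0 p\<^sub>1 M (causal_process G \<epsilon>) \<sigma>))"
proof (intro conjI allI impI; elim conjE)
  fix M :: "'a measure" and \<epsilon> :: "int \<Rightarrow> 'a \<Rightarrow> real" and a :: "nat \<Rightarrow> real" and f\<^sub>\<epsilon> f :: "real \<Rightarrow> real" and \<alpha> :: real
  assume "prob_space M" "iid M borel \<epsilon>"
    "\<forall>k. AE \<omega> in M. summable (\<lambda>i. a i * \<epsilon> (k - int i) \<omega>)"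
    "distributed M lborel (linear_process a \<epsilon> 0) (\<lambda>x. ennreal (f x))" "\<forall>x. 0 \<le> f x"
    "continuous_on UNIV f"
    "0 < (INF p\<in>{p\<^sub>0..p\<^sub>1}. f (quantile (marginal_cdf M (linear_process a \<epsilon>)) p))"
    "0 < \<alpha>" "\<forall>k. integrable M (\<lambda>\<omega>. \<bar>\<epsilon> k \<omega>\<bar> powr \<alpha>)"
    "summable (\<lambda>i. \<bar>a (Suc i)\<bar> powr min (\<alpha> / 2) 1)"
  with assms show "\<exists>\<sigma>\<ge>0. trimmed_mean_clt p\<^sub>0 p\<^sub>1 M (linear_process a \<epsilon>) \<sigma>"
    by (intro linear_process_trimmed_mean_clt[where f = f and \<alpha> = \<alpha>]) auto
next
  fix M :: "'b measure" and S :: "'c measure" and \<epsilon> \<epsilon>' :: "int \<Rightarrow> 'b \<Rightarrow> 'c" and G :: "(nat \<Rightarrow> 'c) \<Rightarrow> real"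
    and f :: "real \<Rightarrow> real" and \<alpha> C r :: real
  assume "prob_space M" "iid M S \<epsilon>" "iid M S \<epsilon>'" "\<forall>k. distr M S (\<epsilon>' k) = distr M S (\<epsilon> 0)"
    "prob_space.indep_var M (PiM UNIV (\<lambda>_. S)) (\<lambda>\<omega> k. \<epsilon> k \<omega>) (PiM UNIV (\<lambda>_. S)) (\<lambda>\<omega> k. \<epsilon>' k \<omega>)"
    "G \<in> borel_measurable (PiM UNIV (\<lambda>_. S))"
    "distributed M lborel (causal_process G \<epsilon> 0) (\<lambda>x. ennreal (f x))" "\<forall>x. 0 \<le> f x"
    and C: "0 < \<alpha>" "0 < C" "0 < r" "r < 1"
    and moment: "\<forall>n::nat. (\<integral>\<^sup>+\<omega>. ennreal (\<bar>causal_process G \<epsilon> (int n) \<omega>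
        - causal_process G (coupled \<epsilon> \<epsilon>') (int n) \<omega>\<bar> powr \<alpha>) \<partial>M) \<le> ennreal (C * r ^ n)"
    and "\<forall>x. f differentiable at x"
    "0 < (INF p\<in>{p\<^sub>0..p\<^sub>1}. f (quantile (marginal_cdf M (causal_process G \<epsilon>)) p))"
  with assms show "\<exists>\<sigma>\<ge>0. trimmed_mean_clt p\<^sub>0 p\<^sub>1 M (causal_process G \<epsilon>) \<sigma>"
    by (intro contracting_process_trimmed_mean_clt[where \<epsilon>' = \<epsilon>' and f = f and \<alpha> = \<alpha> and C = C and r = r])
       (auto intro: differentiable_imp_continuous_within)
qed

end
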